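(* For every $d\ge1$ and $q<\omega$, the exact value of $g_{\mathrm{ord}}(d,q)$ is computable by a terminating finite algorithm; that is, there is an algorithm which, on input $(d,q)$, terminates and outputs the ordinal $g_{\mathrm{ord}}(d,q)<\omega^\omega$ in Cantor normal form.
   Context: For $d\ge1$, a $d$-colored ordinal is a structure $\mathfrak A=(A,<,C_0,\dots,C_{d-1})$ where $(A,<)$ is an ordinal (well-order) and the unary predicates $C_i$ partition $A$; empty domains and empty color classes are allowed. $\operatorname{otp}(A)$ is the order type of $(A,<)$. $\equiv_q$ means agreement on all first-order sentences of quantifier rank at most $q$. $\Sigma_d(q)$ is a (finite) set containing exactly one $q$-characteristic sentence for each $\equiv_q$-class of $d$-colored ordinals, i.e. a sentence of quantifier rank at most $q$ whose $d$-colored ordinal models are exactly the members of that class. Define $$g_{\mathrm{ord}}(d,q)=\max_{\sigma\in\Sigma_d(q)}\min\{\operatorname{otp}(A):\mathfrak A \text{ a } d\text{-colored ordinal},\ \mathfrak A\models\sigma\}.$$ *)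

theory Defs
  imports "HOL-Library.Disjoint_Sets" "HOL-Library.Nat_Bijection"
begin

unbundle cardinal_syntax

section \<open>First-order logic of colored linear orders\<close>

text \<open>Variables are named by natural numbers. The constant \<open>FF\<close> is needed because the
  vocabulary is relational: without it there would be no sentence of quantifier rank 0.\<close>

datatype fm =
    FF
  | Less nat nat
  | Equal nat nat
  | Color nat nat  \<comment> \<open>\<open>Color i x\<close> says that \<open>x\<close> has color \<open>i\<close>\<close>
  | Neg fm
  | Conj fm fm
  | Exi nat fm

fun fv :: "fm \<Rightarrow> nat set" where
  "fv FF = {}"
| "fv (Less x y) = {x, y}"
| "fv (Equal x y) = {x, y}"
| "fv (Color i x) = {x}"
| "fv (Neg \<phi>) = fv \<phi>"
| "fv (Conj \<phi> \<psi>) = fv \<phi> \<union> fv \<psi>"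
| "fv (Exi x \<phi>) = fv \<phi> - {x}"

fun colors :: "fm \<Rightarrow> nat set" where
  "colors FF = {}"
| "colors (Less x y) = {}"
| "colors (Equal x y) = {}"
| "colors (Color i x) = {i}"
| "colors (Neg \<phi>) = colors \<phi>"
| "colors (Conj \<phi> \<psi>) = colors \<phi> \<union> colors \<psi>"
| "colors (Exi x \<phi>) = colors \<phi>"

fun qrank :: "fm \<Rightarrow> nat" where
  "qrank FF = 0"
| "qrank (Less x y) = 0"
| "qrank (Equal x y) = 0"
| "qrank (Color i x) = 0"
| "qrank (Neg \<phi>) = qrank \<phi>"
| "qrank (Conj \<phi> \<psi>) = max (qrank \<phi>) (qrank \<psi>)"
| "qrank (Exi x \<phi>) = Suc (qrank \<phi>)"

definition sentence :: "nat \<Rightarrow> fm \<Rightarrow> bool" where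
  "sentence d \<phi> \<longleftrightarrow> fv \<phi> = {} \<and> colors \<phi> \<subseteq> {..<d}"

text \<open>A structure is a reflexive order relation \<open>r\<close>, whose field is the domain, together with
  the family of color classes. The strict order is \<open>r\<close> minus the diagonal.\<close>

type_synonym 'a colored = "'a rel \<times> (nat \<Rightarrow> 'a set)"

fun sat :: "'a colored \<Rightarrow> (nat \<Rightarrow> 'a) \<Rightarrow> fm \<Rightarrow> bool" where
  "sat A s FF \<longleftrightarrow> False"
| "sat A s (Less x y) \<longleftrightarrow> (s x, s y) \<in> fst A \<and> s x \<noteq> s y"
| "sat A s (Equal x y) \<longleftrightarrow> s x = s y"
| "sat A s (Color i x) \<longleftrightarrow> s x \<in> snd A i"
| "sat A s (Neg \<phi>) \<longleftrightarrow> \<not> sat A s \<phi>"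
| "sat A s (Conj \<phi> \<psi>) \<longleftrightarrow> sat A s \<phi> \<and> sat A s \<psi>"
| "sat A s (Exi x \<phi>) \<longleftrightarrow> (\<exists>a \<in> Field (fst A). sat A (s(x := a)) \<phi>)"

text \<open>Only used for sentences, where the assignment is irrelevant. Assignments into the ambient
  type exist even if the domain is empty.\<close>

definition models :: "'a colored \<Rightarrow> fm \<Rightarrow> bool" where
  "models A \<phi> \<longleftrightarrow> (\<forall>s. sat A s \<phi>)"

section \<open>Colored ordinals\<close>

text \<open>An ordinal is a well-order, and its order type is that well-order up to \<open>=o\<close>; order types
  are compared by \<open>\<le>o\<close>. Empty domains (\<open>r = {}\<close>) and empty color classes are allowed.\<close>

definition colored_ordinal :: "nat \<Rightarrow> 'a colored \<Rightarrow> bool" where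
  "colored_ordinal d A \<longleftrightarrow>
     Well_order (fst A) \<and>
     (\<Union>i<d. snd A i) = Field (fst A) \<and> disjoint_family_on (snd A) {..<d}"

definition equiv_q :: "nat \<Rightarrow> nat \<Rightarrow> 'a colored \<Rightarrow> 'a colored \<Rightarrow> bool" where
  "equiv_q d q A B \<longleftrightarrow>
     (\<forall>\<phi>. sentence d \<phi> \<and> qrank \<phi> \<le> q \<longrightarrow> (models A \<phi> \<longleftrightarrow> models B \<phi>))"

text \<open>\<open>\<sigma>\<close> is a \<open>q\<close>-characteristic sentence of the \<open>\<equiv>\<^sub>q\<close>-class of \<open>A\<close>.\<close>

definition characteristic :: "nat \<Rightarrow> nat \<Rightarrow> 'a colored \<Rightarrow> fm \<Rightarrow> bool" where
  "characteristic d q A \<sigma> \<longleftrightarrow>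
     sentence d \<sigma> \<and> qrank \<sigma> \<le> q \<and>
     (\<forall>B :: 'a colored. colored_ordinal d B \<longrightarrow> (models B \<sigma> \<longleftrightarrow> equiv_q d q A B))"

text \<open>\<open>S\<close> is a possible choice of \<open>\<Sigma>\<^sub>d(q)\<close>, for colored ordinals with domain in the
  type \<open>'a\<close>.\<close>

definition characteristic_set :: "'a itself \<Rightarrow> nat \<Rightarrow> nat \<Rightarrow> fm set \<Rightarrow> bool" where
  "characteristic_set _ d q S \<longleftrightarrow>
     finite S \<and>
     (\<forall>\<sigma>\<in>S. \<exists>A :: 'a colored. colored_ordinal d A \<and> characteristic d q A \<sigma>) \<and>
     (\<forall>A :: 'a colored. colored_ordinal d A \<longrightarrow> (\<exists>!\<sigma>. \<sigma> \<in> S \<and> characteristic d q A \<sigma>))"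

definition min_otp :: "'a itself \<Rightarrow> nat \<Rightarrow> fm \<Rightarrow> 'b rel \<Rightarrow> bool" where
  "min_otp _ d \<sigma> r \<longleftrightarrow>
     (\<exists>A :: 'a colored. colored_ordinal d A \<and> models A \<sigma> \<and> fst A =o r) \<and>
     (\<forall>A :: 'a colored. colored_ordinal d A \<and> models A \<sigma> \<longrightarrow> r \<le>o fst A)"

definition max_min_otp :: "'a itself \<Rightarrow> nat \<Rightarrow> fm set \<Rightarrow> 'b rel \<Rightarrow> bool" where
  "max_min_otp T d S r \<longleftrightarrow>
     (\<exists>\<sigma>\<in>S. min_otp T d \<sigma> r) \<and>
     (\<forall>\<sigma>\<in>S. \<forall>r' :: 'a rel. min_otp T d \<sigma> r' \<longrightarrow> r' \<le>o r)"

text \<open>\<open>r\<close> has order type \<open>g\<^sub>o\<^sub>r\<^sub>d(d,q)\<close>. The value must not depend on the choice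
  of \<open>\<Sigma>\<^sub>d(q)\<close>, and a choice must exist. HOL has no type of all ordinals, so colored
  ordinals range over the well-orders on subsets of a type \<open>'a\<close>, which is to be taken infinite
  and otherwise arbitrary. A single algorithm for all such \<open>'a\<close> is expressed by asking that its output
  be correct for \<open>'a\<close> and for \<open>nat\<close>, since the value for \<open>nat\<close> does not
  depend on \<open>'a\<close>.\<close>

definition is_g_ord :: "'a itself \<Rightarrow> nat \<Rightarrow> nat \<Rightarrow> 'b rel \<Rightarrow> bool" where
  "is_g_ord T d q r \<longleftrightarrow>
     (\<exists>S. characteristic_set T d q S) \<and>
     (\<forall>S. characteristic_set T d q S \<longrightarrow> max_min_otp T d S r)"

section \<open>Cantor normal forms below \<open>\<omega>\<^sup>\<omega>\<close>\<close>

text \<open>The list \<open>[(a\<^sub>1,c\<^sub>1), \<dots>, (a\<^sub>k,c\<^sub>k)]\<close> stands for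
  \<open>\<omega>\<^bsup>a\<^sub>1\<^esup> \<cdot> c\<^sub>1 + \<dots> + \<omega>\<^bsup>a\<^sub>k\<^esup> \<cdot> c\<^sub>k\<close>.\<close>

definition is_cnf :: "(nat \<times> nat) list \<Rightarrow> bool" where
  "is_cnf cs \<longleftrightarrow> sorted_wrt (>) (map fst cs) \<and> (\<forall>(a, c) \<in> set cs. c > 0)"

text \<open>The ordinal denoted by such a list: \<open>\<omega>\<^sup>a\<close> is the set of sequences of length \<open>a\<close> of natural
  numbers, ordered lexicographically with the most significant entry first;
  \<open>\<omega>\<^sup>a \<cdot> c\<close> is \<open>c\<close> consecutive copies of it, indexed by \<open>j\<close>; and the summands,
  indexed by \<open>i\<close>, follow each other. Within one copy all sequences have the same length, so
  \<open>lexord\<close> never compares a list with a proper prefix.\<close>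

definition cnf_points :: "(nat \<times> nat) list \<Rightarrow> nat list set" where
  "cnf_points cs =
     {i # j # xs | i j xs. i < length cs \<and> j < snd (cs ! i) \<and> length xs = fst (cs ! i)}"

definition cnf_ord :: "(nat \<times> nat) list \<Rightarrow> nat list rel" where
  "cnf_ord cs =
     {(u, v). u \<in> cnf_points cs \<and> v \<in> cnf_points cs \<and> (u = v \<or> (u, v) \<in> lexord less_than)}"

definition cnf_code :: "(nat \<times> nat) list \<Rightarrow> nat" where
  "cnf_code cs = list_encode (map prod_encode cs)"

section \<open>Algorithms: partial recursive functions\<close>

datatype recf =
    Zero
  | Succ
  | Proj nat
  | Comp recf "recf list"
  | PrimRec recf recf
  | Mu recf

text \<open>\<open>computes e xs y\<close>: the program \<open>e\<close> terminates on input \<open>xs\<close> with output \<open>y\<close>.\<close>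

inductive computes :: "recf \<Rightarrow> nat list \<Rightarrow> nat \<Rightarrow> bool" where
  Zero: "computes Zero xs 0"
| Succ: "computes Succ [x] (Suc x)"
| Proj: "i < length xs \<Longrightarrow> computes (Proj i) xs (xs ! i)"
| Comp: "list_all2 (\<lambda>g y. computes g xs y) gs ys \<Longrightarrow> computes f ys z \<Longrightarrow>
    computes (Comp f gs) xs z"
| PrimRec_0: "computes f xs y \<Longrightarrow> computes (PrimRec f g) (0 # xs) y"
| PrimRec_Suc: "computes (PrimRec f g) (n # xs) y \<Longrightarrow> computes g (n # y # xs) z \<Longrightarrow>
    computes (PrimRec f g) (Suc n # xs) z"
| Mu: "computes f (n # xs) 0 \<Longrightarrow> (\<forall>m<n. \<exists>y. computes f (m # xs) (Suc y)) \<Longrightarrow>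
    computes (Mu f) xs n"
  monos list_all2_mono

lemma computes_deterministic:
  "computes e xs y \<Longrightarrow> computes e xs z \<Longrightarrow> y = z"
proof (induction e xs y arbitrary: z rule: computes.induct)
  case (Comp xs gs ys f w)
  from Comp.prems obtain ys' where ys': "list_all2 (\<lambda>g y. computes g xs y) gs ys'"
    and f: "computes f ys' z" by (cases rule: computes.cases) auto
  have "ys = ys'"
    using Comp.IH(1) ys' by (auto simp: list_all2_conv_all_nth intro!: nth_equalityI)
  then show ?case using Comp.IH(2) f by auto
next
  case (PrimRec_Suc f g n xs y w)
  from PrimRec_Suc.prems obtain y' where "computes (PrimRec f g) (n # xs) y'"
    and "computes g (n # y' # xs) z" by (cases rule: computes.cases) auto
  then show ?case using PrimRec_Suc.IH by blast
next
  case (Mu f n xs)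
  from Mu.prems have 0: "computes f (z # xs) 0"
    and less: "\<forall>m<z. \<exists>y. computes f (m # xs) (Suc y)" by (cases rule: computes.cases, auto)+
  have "\<not> n < z" using Mu.IH(1) less by fastforce
  moreover have "\<not> z < n" using Mu.IH(2) 0 by fastforce
  ultimately show ?case by simp
next
  case Zero
  then show ?case by (cases rule: computes.cases) auto
next
  case Succ
  then show ?case by (cases rule: computes.cases) auto
next
  case Proj
  from Proj.prems show ?case by (cases rule: computes.cases) auto
next
  case PrimRec_0
  from PrimRec_0.prems show ?case by (cases rule: computes.cases) (auto intro: PrimRec_0.IH)
qed

end

theory Submission
  imports Defs "HOL-Library.List_Lexorder" "HOL-Library.Product_Lexorder"
    "HOL-Library.Countable_Set" "HOL-Library.Ramsey"
begin

text \<open>The proof is an instance of the composition method. In a linear order, a chosen point splits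
  the Ehrenfeucht-Fraisse game into independent games on the parts to its left and to its right.
  So the \<open>\<equiv>\<^sub>q\<close>-class of a colored linear order is captured by a hereditarily finite object, its type
  \<open>ty q\<close>, which is defined by recursion on \<open>q\<close> and coded by a natural number
  (\<open>equiv_q_iff_otype\<close>). There are finitely many types, and ordered sums (\<open>T_add\<close>) and, for idempotent
  types, \<open>\<omega>\<close>-fold sums (\<open>T_omega\<close>) act on types by computable operations \<open>tadd\<close> and \<open>tomega\<close>.

  Starting from the empty order and the one-point orders, these two operations produce pairs of a
  type and an ordinal in Cantor normal form; \<open>buildable\<close> is the set of these pairs. Every such pair is
  realized by a colored ordinal of at most that order type (\<open>buildable_realized\<close>). Conversely, every
  colored ordinal lies above a pair with its own type (\<open>colored_ordinal_above_buildable\<close>): by a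
  Lowenheim-Skolem argument it may be taken countable, and at a countable limit Ramsey's theorem
  yields a cofinal sequence which cuts a final segment into pieces of one idempotent type. So the
  least order type of a class is the least ordinal paired with its type, and \<open>g\<^sub>o\<^sub>r\<^sub>d(d,q)\<close> is the
  largest of these finitely many ordinals (\<open>is_g_ord_max_min_built\<close>). This description mentions
  neither structures nor the type on which they live.

  For computability, a certificate is a tuple of finite tables: values of the operations on types and
  ordinals, and a finite set of derivations of pairs. Whether all entries are justified is expressed by
  quantifiers below a common bound. Minimality is certified by a closure condition: whenever a
  construction step is applied to entries, some entry has the resulting type and an ordinal that is
  not larger. By monotonicity of ordinal addition and of multiplication by \<open>\<omega>\<close>, every derivation is
  then dominated by an entry (\<open>certificate_sound\<close>). Certificates exist (\<open>ex_certificate\<close>), and bounded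
  formulas are decidable (\<open>recursive_holds\<close>), so an unbounded search for a certificate terminates
  and finds the value.\<close>

unbundle cardinal_syntax

section \<open>Arithmetic of Cantor normal forms\<close>

type_synonym cnf = "(nat \<times> nat) list"

lemma is_cnf_Nil [simp]: "is_cnf []"
  by (simp add: is_cnf_def)

lemma is_cnf_Cons [simp]:
  "is_cnf ((a, c) # x) \<longleftrightarrow> 0 < c \<and> (\<forall>(b, e) \<in> set x. b < a) \<and> is_cnf x"
  by (auto simp: is_cnf_def)

text \<open>For normal forms, comparing ordinals means comparing the lists lexicographically, and so the
  linear order on \<open>(nat \<times> nat) list\<close> is used as the order of ordinals. This makes the normal
  forms below \<open>x\<close> a copy of the ordinal \<open>x\<close>.\<close>

definition below :: "cnf \<Rightarrow> cnf set" where
  "below x = {u. is_cnf u \<and> u < x}"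

lemma below_Nil [simp]: "below [] = {}"
  by (simp add: below_def)

lemma below_one [simp]: "below [(0, Suc 0)] = {[]}"
proof -
  have "u = []" if "is_cnf u" "u < [(0, Suc 0)]" for u
    using that by (cases u) auto
  then show ?thesis by (auto simp: below_def)
qed

text \<open>Ordinal addition: the left summand loses all powers below the leading power of the
  right summand.\<close>

fun cadd :: "cnf \<Rightarrow> cnf \<Rightarrow> cnf" where
  "cadd [] y = y"
| "cadd ((a, c) # x) [] = (a, c) # x"
| "cadd ((a, c) # x) ((b, e) # y) =
     (if a < b then (b, e) # y
      else if a = b then (a, c + e) # y
      else (a, c) # cadd x ((b, e) # y))"

lemma cadd_Nil_right [simp]: "cadd x [] = x"
  by (cases x) auto

text \<open>If \<open>\<omega>\<^sup>a\<close> is the leading power of \<open>x\<close>, then \<open>x \<cdot> \<omega> = \<omega>\<^bsup>a + 1\<^esup>\<close>.\<close>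

fun times_omega :: "cnf \<Rightarrow> cnf" where
  "times_omega [] = []"
| "times_omega ((a, c) # x) = [(Suc a, 1)]"

lemma set_cadd: "set (cadd x y) \<subseteq> set x \<union> set y \<union> {(a, c) | a c. a \<in> fst ` set y}"
  by (induction x y rule: cadd.induct) auto

lemma is_cnf_cadd: "is_cnf x \<Longrightarrow> is_cnf y \<Longrightarrow> is_cnf (cadd x y)"
proof (induction x y rule: cadd.induct)
  case (3 a c x b e y)
  then show ?case
    using set_cadd[of x "(b, e) # y"] by (fastforce split: if_splits)
qed auto

lemma is_cnf_times_omega: "is_cnf x \<Longrightarrow> is_cnf (times_omega x)"
  by (cases x rule: times_omega.cases) auto

lemma cadd_strict_mono_right: "is_cnf z \<Longrightarrow> y < z \<Longrightarrow> cadd x y < cadd x z"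
proof (induction x arbitrary: y z)
  case (Cons p x)
  obtain a c where p: "p = (a, c)" by fastforce
  obtain b e z' where z: "z = (b, e) # z'"
    using Cons.prems by (cases z) auto
  have e: "e > 0" using Cons.prems z by simp
  show ?case
  proof (cases y)
    case Nil
    then show ?thesis
      using Cons.IH[of z "[]"] Cons.prems e by (auto simp: p z)
  next
    case (Cons p' y')
    obtain b' e' where "p' = (b', e')" by fastforce
    then show ?thesis
      using Cons.IH[of z y] Cons.prems e by (auto simp: p z Cons)
  qed
qed auto

lemma le_cadd_left: "is_cnf y \<Longrightarrow> x \<le> cadd x y"
  using cadd_strict_mono_right[of y "[]" x] by (cases y) auto

lemma cadd_mono_right: "is_cnf z \<Longrightarrow> y \<le> z \<Longrightarrow> cadd x y \<le> cadd x z"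
  by (metis cadd_strict_mono_right order.order_iff_strict)

lemma cadd_right_inject: "is_cnf y \<Longrightarrow> is_cnf z \<Longrightarrow> cadd x y = cadd x z \<longleftrightarrow> y = z"
  by (metis cadd_strict_mono_right less_irrefl linorder_neqE)

lemma le_cadd_right: "is_cnf x \<Longrightarrow> is_cnf y \<Longrightarrow> y \<le> cadd x y"
proof (induction x y rule: cadd.induct)
  case (3 a c x b e y)
  then show ?case by auto
qed auto

lemma cadd_mono_left: "is_cnf x' \<Longrightarrow> is_cnf y \<Longrightarrow> x \<le> x' \<Longrightarrow> cadd x y \<le> cadd x' y"
proof (induction x y arbitrary: x' rule: cadd.induct)
  case (1 y)
  then show ?case by (simp add: le_cadd_right)
next
  case (2 a c x)
  then show ?case by simp
next
  case (3 a c x b e y)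
  obtain a' c' x'' where x': "x' = (a', c') # x''"
    using "3.prems"(3) by (cases x') auto
  have "(b, e) # y \<le> cadd x'' ((b, e) # y)"
    using 3 x' by (intro le_cadd_right) auto
  then show ?case
    using 3 by (auto simp: x')
qed

lemma times_omega_mono: "is_cnf y \<Longrightarrow> x \<le> y \<Longrightarrow> times_omega x \<le> times_omega y"
  by (cases x rule: times_omega.cases; cases y rule: times_omega.cases) auto

lemma fst_hd_in_cadd: "b \<in> fst ` set (cadd x ((b, e) # y))"
  by (induction x "(b, e) # y" rule: cadd.induct) auto

text \<open>Left subtraction. It decomposes the points below a sum into the points below the left
  summand and a shifted copy of the right summand.\<close>

lemma cadd_subtract:
  assumes "is_cnf x" "is_cnf z" "x \<le> z"
  shows "\<exists>y. is_cnf y \<and> z = cadd x y"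
  using assms
proof (induction x arbitrary: z)
  case (Cons p x)
  obtain a c where p: "p = (a, c)" by fastforce
  obtain b e z' where z: "z = (b, e) # z'"
    using Cons.prems by (cases z) (auto simp: p)
  have "a < b \<or> a = b \<and> c < e \<or> a = b \<and> c = e \<and> x \<le> z'"
    using Cons.prems by (auto simp: p z)
  then consider "a < b" | "a = b" "c < e" | "a = b" "c = e" "x \<le> z'"
    by blast
  then show ?case
  proof cases
    case 1
    then show ?thesis using Cons.prems by (intro exI[of _ z]) (auto simp: p z)
  next
    case 2
    then show ?thesis
      using Cons.prems by (intro exI[of _ "(b, e - c) # z'"]) (auto simp: p z)
  next
    case 3
    then obtain y where y: "is_cnf y" "z' = cadd x y"
      using Cons.IH[of z'] Cons.prems by (auto simp: p z)
    show ?thesis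
    proof (cases y)
      case Nil
      then show ?thesis using y 3 by (intro exI[of _ "[]"]) (auto simp: p z)
    next
      case (Cons r y')
      obtain k m where r: "r = (k, m)" by fastforce
      have "k \<in> fst ` set z'"
        unfolding y(2) Cons r by (rule fst_hd_in_cadd)
      then have "k < a" using \<open>is_cnf z\<close> 3 by (auto simp: z)
      then show ?thesis using y 3 by (intro exI[of _ y]) (auto simp: p z Cons r)
    qed
  qed
qed auto

lemma below_cadd: "is_cnf x \<Longrightarrow> is_cnf y \<Longrightarrow> below (cadd x y) = below x \<union> cadd x ` below y"
proof (intro equalityI subsetI)
  fix u assume *: "is_cnf x" "is_cnf y" "u \<in> below (cadd x y)"
  show "u \<in> below x \<union> cadd x ` below y"
  proof (cases "u < x")
    case True
    then show ?thesis using * by (auto simp: below_def)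
  next
    case False
    then have "x \<le> u" by simp
    then obtain v where v: "is_cnf v" "u = cadd x v"
      using cadd_subtract[of x u] * by (auto simp: below_def)
    have "v < y"
      using cadd_mono_right[of v y x] * v by (force simp: below_def)
    then show ?thesis using v by (auto simp: below_def)
  qed
next
  fix u assume *: "is_cnf x" "is_cnf y" "u \<in> below x \<union> cadd x ` below y"
  then show "u \<in> below (cadd x y)"
    using le_cadd_left[of y x]
    by (auto simp: below_def is_cnf_cadd intro: cadd_strict_mono_right less_le_trans)
qed

text \<open>The multiples \<open>x \<cdot> n\<close> are cofinal in \<open>x \<cdot> \<omega>\<close>; they cut it into \<open>\<omega>\<close> many copies of \<open>x\<close>.\<close>

fun cmult :: "cnf \<Rightarrow> nat \<Rightarrow> cnf" where
  "cmult x 0 = []"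
| "cmult x (Suc n) = cadd (cmult x n) x"

lemma is_cnf_cmult: "is_cnf x \<Longrightarrow> is_cnf (cmult x n)"
  by (induction n) (auto simp: is_cnf_cadd)

lemma cmult_mono: "is_cnf x \<Longrightarrow> m \<le> n \<Longrightarrow> cmult x m \<le> cmult x n"
  by (rule lift_Suc_mono_le[of "cmult x"]) (auto simp: le_cadd_left)

lemma cmult_Cons: "\<exists>y. cmult ((a, c) # x) (Suc n) = (a, c * Suc n) # y"
proof (induction n)
  case (Suc n)
  then obtain y where "cmult ((a, c) # x) (Suc n) = (a, c * Suc n) # y" by blast
  then have "cmult ((a, c) # x) (Suc (Suc n)) = (a, c * Suc (Suc n)) # x"
    by (simp del: cmult.simps add: cmult.simps(2)[of _ "Suc n"])
  then show ?case by blast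
qed auto

lemma below_times_omega:
  assumes "is_cnf x"
  shows "below (times_omega x) = (\<Union>n. below (cmult x n))"
proof (cases x rule: times_omega.cases)
  case 1
  have "cmult [] n = []" for n by (induction n) auto
  then show ?thesis using 1 by simp
next
  case (2 a c x')
  have c: "c > 0" using assms 2 by simp
  show ?thesis
  proof (intro equalityI subsetI)
    fix u assume u: "u \<in> below (times_omega x)"
    show "u \<in> (\<Union>n. below (cmult x n))"
    proof (cases u)
      case Nil
      then show ?thesis using u 2 cmult_Cons[of a c x' 0] by (auto simp: below_def intro!: exI[of _ 1])
    next
      case (Cons p u')
      obtain b k where p: "p = (b, k)" by fastforce
      have "b \<le> a" using u 2 Cons p by (auto simp: below_def)
      moreover obtain y where "cmult x (Suc k) = (a, c * Suc k) # y"
        using cmult_Cons 2 by blast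
      moreover have "k < c * Suc k" using c
        by (metis One_nat_def Suc_leI lessI less_le_trans mult_le_mono1 nat_mult_1)
      ultimately have "u < cmult x (Suc k)" by (auto simp: Cons p)
      then show ?thesis using u by (auto simp: below_def simp del: cmult.simps intro!: exI[of _ "Suc k"])
    qed
  next
    fix u assume "u \<in> (\<Union>n. below (cmult x n))"
    then obtain n where n: "is_cnf u" "u < cmult x n" by (auto simp: below_def)
    moreover have "cmult x n < times_omega x"
    proof (cases n)
      case 0
      then show ?thesis by (simp add: 2)
    next
      case (Suc m)
      then show ?thesis using cmult_Cons[of a c x' m] by (auto simp: 2 simp del: cmult.simps)
    qed
    ultimately show "u \<in> below (times_omega x)" by (auto simp: below_def)
  qed
qed

text \<open>The order of normal forms is well-founded: a normal form with exponents at most \<open>n\<close> is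
  determined by the coefficient of \<open>\<omega>\<^sup>n\<close> and a normal form with exponents below \<open>n\<close>.\<close>

lemma wf_cnf: "wf {(x, y). is_cnf x \<and> is_cnf y \<and> x < y}"
proof -
  define D where "D n = {x. is_cnf x \<and> (\<forall>(b, e)\<in>set x. b < n)}" for n :: nat
  define R where "R n = {(x, y). x \<in> D n \<and> y \<in> D n \<and> x < y}" for n
  define coeff :: "nat \<Rightarrow> cnf \<Rightarrow> nat \<times> cnf" where
    "coeff n x = (case x of [] \<Rightarrow> (0, []) | (b, e) # y \<Rightarrow> if b = n then (e, y) else (0, x))" for n x
  have wf_R: "wf (R n)" for n
  proof (induction n)
    case 0
    have "x = []" if "x \<in> D 0" for x using that by (cases x) (auto simp: D_def)
    then have "R 0 = {}" by (force simp: R_def)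
    then show ?case by simp
  next
    case (Suc n)
    have "R (Suc n) \<subseteq> inv_image (less_than <*lex*> R n) (coeff n)"
    proof
      fix p assume "p \<in> R (Suc n)"
      then obtain x y where p: "p = (x, y)" "x \<in> D (Suc n)" "y \<in> D (Suc n)" "x < y"
        by (auto simp: R_def)
      then show "p \<in> inv_image (less_than <*lex*> R n) (coeff n)"
        by (cases x; cases y) (fastforce simp: R_def D_def coeff_def)+
    qed
    then show ?case by (rule wf_subset[rotated]) (use Suc in auto)
  qed
  have down: "x \<in> D n" if "is_cnf x" "x < y" "y \<in> D n" for x y n
    using that by (cases x; cases y) (fastforce simp: D_def)+
  show ?thesis
  proof (rule wfUNIVI)
    fix P :: "cnf \<Rightarrow> bool" and x
    assume *: "\<forall>x. (\<forall>y. (y, x) \<in> {(x, y). is_cnf x \<and> is_cnf y \<and> x < y} \<longrightarrow> P y) \<longrightarrow> P x"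
    show "P x"
    proof (cases "is_cnf x")
      case False
      then show ?thesis using * by blast
    next
      case True
      have "finite (fst ` set x)" by simp
      then obtain n where "\<forall>b\<in>fst ` set x. b < n"
        by (meson finite_nat_set_iff_bounded)
      then have "x \<in> D n" using True by (auto simp: D_def)
      then show ?thesis
      proof (induction x rule: wf_induct_rule[OF wf_R[of n]])
        case (1 x)
        then show ?case using * down by (fastforce simp: R_def)
      qed
    qed
  qed
qed

lemma cnf_minimal:
  assumes "is_cnf x" "P x"
  obtains y where "is_cnf y" "P y" "\<And>z. is_cnf z \<Longrightarrow> P z \<Longrightarrow> y \<le> z"
proof -
  obtain y where "y \<in> {y. is_cnf y \<and> P y}"
    and "\<And>z. (z, y) \<in> {(x, y). is_cnf x \<and> is_cnf y \<and> x < y} \<Longrightarrow> z \<notin> {y. is_cnf y \<and> P y}"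
    using wfE_min[OF wf_cnf, of x "{y. is_cnf y \<and> P y}"] assms by auto
  then show ?thesis using that[of y] by (metis (lifting) case_prodI mem_Collect_eq not_less)
qed

section \<open>Cantor normal forms as order types\<close>

text \<open>A strictly monotone map need not have an initial segment as its image, but between
  well-orders its existence already bounds the order type: otherwise its composition with an
  isomorphism onto a proper initial segment would be a strictly monotone map that moves some
  point down.\<close>

lemma ordLeq_strict_mono:
  fixes r :: "'a rel" and s :: "'b rel"
  assumes r: "Well_order r" and s: "Well_order s"
    and f: "\<And>x. x \<in> Field r \<Longrightarrow> f x \<in> Field s"
    and mono: "\<And>x y. (x, y) \<in> r \<Longrightarrow> x \<noteq> y \<Longrightarrow> (f x, f y) \<in> s \<and> f x \<noteq> f y"
  shows "r \<le>o s"
proof (rule ccontr)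
  assume "\<not> r \<le>o s"
  then have "s <o r" using r s by (simp add: not_ordLeq_iff_ordLess)
  then obtain a where a: "a \<in> Field r" and "s =o Restr r (underS r a)"
    using ordLess_iff_ordIso_Restr[OF r s] by auto
  then obtain g where g: "iso s (Restr r (underS r a)) g"
    by (auto simp: ordIso_def)
  have lin: "Linear_order r" and wf: "wf (r - Id)"
    using r by (auto simp: well_order_on_def)
  then have anti: "antisym r" and tr: "trans r" and tot: "Total r"
    by (auto simp: linear_order_on_def partial_order_on_def preorder_on_def)
  have bij: "bij_betw g (Field s) (Field (Restr r (underS r a)))"
    using g by (simp add: iso_def)
  have fwd: "(g x, g y) \<in> Restr r (underS r a)" if "(x, y) \<in> s" for x y
    using iso_forward[OF that g] .
  have h_mono: "(g (f x), g (f y)) \<in> r \<and> g (f x) \<noteq> g (f y)" if "(x, y) \<in> r" "x \<noteq> y" for x y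
  proof -
    have "f x \<in> Field s" "f y \<in> Field s" using f that by (auto simp: Field_def)
    then have "g (f x) \<noteq> g (f y)"
      using mono[OF that] bij by (auto simp: bij_betw_def inj_on_def)
    then show ?thesis using mono[OF that] fwd by blast
  qed
  have h_under: "g (f x) \<in> underS r a" if "x \<in> Field r" for x
  proof -
    have "g (f x) \<in> Field (Restr r (underS r a))"
      using bij f[OF that] by (auto simp: bij_betw_def)
    then show ?thesis by (auto simp: Field_def)
  qed
  define B where "B = {x. (g (f x), x) \<in> r - Id}"
  have "a \<in> B"
    using h_under[OF a] by (auto simp: B_def underS_def)
  then obtain x where x: "x \<in> B" and min: "\<And>y. (y, x) \<in> r - Id \<Longrightarrow> y \<notin> B"
    using wfE_min[OF wf] by metis
  have "(g (f x), x) \<in> r - Id" using x by (simp add: B_def)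
  moreover from this have "g (f x) \<in> B" using h_mono by (simp add: B_def)
  ultimately show False using min by blast
qed

lemma cnf_points_Nil [simp]: "cnf_points [] = {}"
  by (simp add: cnf_points_def)

lemma cnf_points_Cons:
  "cnf_points ((a, c) # x) =
     {0 # j # xs | j xs. j < c \<and> length xs = a} \<union> {Suc i # w | i w. i # w \<in> cnf_points x}"
  (is "?L = ?R")
proof (intro equalityI subsetI)
  fix u assume "u \<in> ?L"
  then obtain i j xs where "u = i # j # xs" "i < length ((a, c) # x)"
    "j < snd (((a, c) # x) ! i)" "length xs = fst (((a, c) # x) ! i)"
    unfolding cnf_points_def by blast
  then show "u \<in> ?R" by (cases i) (auto simp: cnf_points_def)
next
  fix u assume "u \<in> ?R"
  then show "u \<in> ?L" by (fastforce simp: cnf_points_def)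
qed

text \<open>The most significant coefficient comes first; coefficients may be zero.\<close>

fun cnf_of_coeffs :: "nat list \<Rightarrow> cnf" where
  "cnf_of_coeffs [] = []"
| "cnf_of_coeffs (c # xs) = (if c = 0 then [] else [(length xs, c)]) @ cnf_of_coeffs xs"

lemma cnf_of_coeffs_bounded: "(b, e) \<in> set (cnf_of_coeffs xs) \<Longrightarrow> b < length xs"
  by (induction xs) (auto split: if_splits)

lemma is_cnf_cnf_of_coeffs: "is_cnf (cnf_of_coeffs xs)"
  by (induction xs) (auto dest: cnf_of_coeffs_bounded)

lemma cnf_of_coeffs_less:
  assumes "\<forall>(b, e) \<in> set x. b < n" "c > 0"
  shows "x < (n, c) # y"
  using assms by (cases x) auto

lemma cnf_of_coeffs_strict_mono:
  "length xs = length ys \<Longrightarrow> (xs, ys) \<in> lexord less_than \<Longrightarrow> cnf_of_coeffs xs < cnf_of_coeffs ys"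
proof (induction xs ys rule: list_induct2)
  case (Cons c xs e ys)
  have "\<forall>(b, e)\<in>set (cnf_of_coeffs xs). b < length ys"
    using Cons.hyps by (auto dest: cnf_of_coeffs_bounded)
  then show ?case
    using Cons cnf_of_coeffs_less[of "cnf_of_coeffs xs" "length ys" e "cnf_of_coeffs ys"] by auto
qed simp

lemma cnf_of_coeffs_surj:
  "is_cnf x \<Longrightarrow> \<forall>(b, e)\<in>set x. b < n \<Longrightarrow> \<exists>xs. length xs = n \<and> cnf_of_coeffs xs = x"
proof (induction n arbitrary: x)
  case (Suc n)
  show ?case
  proof (cases "\<exists>c y. x = (n, c) # y")
    case True
    then obtain c y where x: "x = (n, c) # y" by blast
    then obtain ys where "length ys = n" "cnf_of_coeffs ys = y"
      using Suc.IH[of y] Suc.prems by auto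
    then show ?thesis using Suc.prems by (intro exI[of _ "c # ys"]) (auto simp: x)
  next
    case False
    then have "\<forall>(b, e)\<in>set x. b < n"
      using Suc.prems by (cases x) (fastforce simp: less_Suc_eq)+
    then obtain ys where "length ys = n" "cnf_of_coeffs ys = x"
      using Suc.IH[of x] Suc.prems by auto
    then show ?thesis by (intro exI[of _ "0 # ys"]) auto
  qed
next
  case (0 x)
  then show ?case by (cases x) auto
qed

text \<open>A point \<open>i # j # xs\<close> of \<^term>\<open>cnf_ord x\<close> denotes the sum of the first \<open>i\<close>
  summands of \<open>x\<close>, of \<open>j\<close> copies of the next power, and of the ordinal with coefficients
  \<open>xs\<close> below that power.\<close>

fun cnf_of_point :: "cnf \<Rightarrow> nat list \<Rightarrow> cnf" where
  "cnf_of_point ((a, c) # x) (i # w) =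
     (case i of 0 \<Rightarrow> cnf_of_coeffs w | Suc k \<Rightarrow> (a, c) # cnf_of_point x (k # w))"
| "cnf_of_point _ _ = []"

lemma cnf_of_point_image: "is_cnf x \<Longrightarrow> cnf_of_point x ` cnf_points x = below x"
proof (induction x)
  case (Cons p x)
  obtain a c where p: "p = (a, c)" by fastforce
  have IH: "cnf_of_point x ` cnf_points x = below x" and c: "c > 0"
    and exps: "\<forall>(b, e)\<in>set x. b < a" and x: "is_cnf x"
    using Cons by (auto simp: p)
  have exps': "\<forall>(b, e)\<in>set u. b < a" if "u \<in> below x" for u
    using that exps by (cases u; cases x) (fastforce simp: below_def)+
  show ?case
  proof (intro equalityI subsetI)
    fix u assume "u \<in> cnf_of_point (p # x) ` cnf_points (p # x)"
    then consider j xs where "j < c" "length xs = a" "u = cnf_of_coeffs (j # xs)"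
      | i w where "i # w \<in> cnf_points x" "u = (a, c) # cnf_of_point x (i # w)"
      by (auto simp: p cnf_points_Cons)
    then show "u \<in> below (p # x)"
    proof cases
      case 1
      then show ?thesis
        using is_cnf_cnf_of_coeffs[of "j # xs"] cnf_of_coeffs_bounded[of _ _ xs] c
          cnf_of_coeffs_less[of "cnf_of_coeffs xs" a c x]
        by (auto simp: below_def p split: if_splits)
    next
      case 2
      then have "cnf_of_point x (i # w) \<in> below x" using IH by blast
      then show ?thesis using 2 c exps' by (auto simp: below_def p)
    qed
  next
    fix u assume u: "u \<in> below (p # x)"
    show "u \<in> cnf_of_point (p # x) ` cnf_points (p # x)"
    proof (cases "\<exists>y. u = (a, c) # y")
      case True
      then obtain y where y: "u = (a, c) # y" by blast
      then have "y \<in> cnf_of_point x ` cnf_points x"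
        using u unfolding IH by (auto simp: below_def p)
      then obtain v where v: "v \<in> cnf_points x" "cnf_of_point x v = y" by auto
      then obtain i w where iw: "v = i # w" by (auto simp: cnf_points_def)
      show ?thesis
        using v iw y by (intro image_eqI[of _ _ "Suc i # w"]) (auto simp: p cnf_points_Cons)
    next
      case False
      have "\<forall>(b, e)\<in>set u. b < Suc a"
        using u False by (cases u) (fastforce simp: below_def p)+
      then obtain xs where xs: "length xs = Suc a" "cnf_of_coeffs xs = u"
        using cnf_of_coeffs_surj u by (force simp: below_def)
      then obtain j ys where j: "xs = j # ys" "length ys = a" by (auto simp: length_Suc_conv)
      have "j < c" using u xs j c False by (auto simp: below_def p split: if_splits)
      then show ?thesis
        using xs j by (intro image_eqI[of _ _ "0 # xs"]) (auto simp: p cnf_points_Cons)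
    qed
  qed
qed simp

lemma cnf_of_point_strict_mono:
  "is_cnf x \<Longrightarrow> u \<in> cnf_points x \<Longrightarrow> v \<in> cnf_points x \<Longrightarrow> (u, v) \<in> lexord less_than \<Longrightarrow>
   cnf_of_point x u < cnf_of_point x v"
proof (induction x arbitrary: u v)
  case (Cons p x)
  obtain a c where p: "p = (a, c)" by fastforce
  have *: "cnf_of_coeffs (j # xs) < (a, c) # y" if "j < c" "length xs = a" for j xs y
    using that cnf_of_coeffs_less[of "cnf_of_coeffs xs" a c y]
    by (auto dest: cnf_of_coeffs_bounded)
  have **: "cnf_of_coeffs (j # xs) < cnf_of_coeffs (k # ys)"
    if "(j # xs, k # ys) \<in> lexord less_than" "length xs = length ys" for j xs k ys
    by (rule cnf_of_coeffs_strict_mono) (use that in simp_all)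
  obtain i u' k v' where uv: "u = i # u'" "v = k # v'"
    using Cons.prems by (auto simp: cnf_points_def)
  show ?case
  proof (cases i)
    case 0
    then obtain j xs where u': "u' = j # xs" "j < c" "length xs = a"
      using Cons.prems(2) by (auto simp: uv p cnf_points_Cons)
    show ?thesis
    proof (cases k)
      case 0
      then obtain m ys where "v' = m # ys" "length ys = a"
        using Cons.prems(3) by (auto simp: uv p cnf_points_Cons)
      then show ?thesis
        using Cons.prems(4) **[of j xs m ys] u' \<open>i = 0\<close> \<open>k = 0\<close>
        by (simp add: uv p del: cnf_of_coeffs.simps)
    next
      case (Suc l)
      then show ?thesis
        using *[of j xs] u' \<open>i = 0\<close> by (simp add: uv p del: cnf_of_coeffs.simps)
    qed
  next
    case (Suc l)
    then have "0 < k" using Cons.prems(4) by (auto simp: uv)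
    then obtain m where m: "k = Suc m" by (cases k) auto
    have "cnf_of_point x (l # u') < cnf_of_point x (m # v')"
      using Cons.prems Suc m by (intro Cons.IH) (auto simp: uv p cnf_points_Cons)
    then show ?thesis by (simp add: uv p Suc m)
  qed
qed simp

lemma Field_cnf_ord: "Field (cnf_ord x) = cnf_points x"
  by (auto simp: cnf_ord_def Field_def)

lemma cnf_ord_iff_le:
  assumes "is_cnf x" "u \<in> cnf_points x" "v \<in> cnf_points x"
  shows "(u, v) \<in> cnf_ord x \<longleftrightarrow> cnf_of_point x u \<le> cnf_of_point x v"
    and "cnf_of_point x u = cnf_of_point x v \<longleftrightarrow> u = v"
proof -
  have "u = v \<or> (u, v) \<in> lexord less_than \<or> (v, u) \<in> lexord less_than"
    using lexord_linear[of less_than u v] by (metis less_than_iff linorder_less_linear)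
  then show "(u, v) \<in> cnf_ord x \<longleftrightarrow> cnf_of_point x u \<le> cnf_of_point x v"
    and "cnf_of_point x u = cnf_of_point x v \<longleftrightarrow> u = v"
    using assms cnf_of_point_strict_mono[of x u v] cnf_of_point_strict_mono[of x v u]
    by (auto simp: cnf_ord_def)
qed

lemma Well_order_via_cnf:
  assumes "\<And>u v. u \<in> Field r \<Longrightarrow> v \<in> Field r \<Longrightarrow> (u, v) \<in> r \<longleftrightarrow> f u \<le> (f v :: cnf)"
    and "inj_on f (Field r)" and "\<And>u. u \<in> Field r \<Longrightarrow> is_cnf (f u)"
  shows "Well_order r"
proof -
  have F: "(u, v) \<in> r \<longleftrightarrow> u \<in> Field r \<and> v \<in> Field r \<and> f u \<le> f v" for u v
    using assms(1)[of u v] by (auto simp: Field_def)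
  have "Refl r" by (auto simp: refl_on_def F)
  moreover have "trans r" unfolding trans_def using F order_trans by metis
  moreover have "antisym r" using assms(2) unfolding antisym_def inj_on_def using F
    by (metis order_antisym)
  moreover have "Total r" by (auto simp: total_on_def F)
  moreover have "wf (r - Id)"
  proof (rule wf_subset[OF wf_inv_image[OF wf_cnf, of f]], rule subsetI)
    fix p assume "p \<in> r - Id"
    then obtain u v where "p = (u, v)" "(u, v) \<in> r" "u \<noteq> v" by (cases p) auto
    then show "p \<in> inv_image {(x, y). is_cnf x \<and> is_cnf y \<and> x < y} f"
      using F assms(2,3) by (auto simp: inj_on_def order_less_le)
  qed
  ultimately show ?thesis
    by (auto simp: well_order_on_def linear_order_on_def partial_order_on_def preorder_on_def
        intro: FieldI1 FieldI2)
qed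

lemma Well_order_cnf_ord: "is_cnf x \<Longrightarrow> Well_order (cnf_ord x)"
  by (rule Well_order_via_cnf[of _ "cnf_of_point x"])
    (use cnf_of_point_image[of x] in
      \<open>auto simp: Field_cnf_ord cnf_ord_iff_le inj_on_def below_def\<close>)

text \<open>Order types are compared with \<^term>\<open>cnf_ord x\<close> through strictly monotone maps into or out of the
  set of normal forms below \<open>x\<close>, which need not be onto an initial segment.\<close>

lemma ordLeq_cnf_ord:
  assumes r: "Well_order r" and x: "is_cnf x"
    and f: "\<And>u. u \<in> Field r \<Longrightarrow> f u \<in> below x"
    and mono: "\<And>u v. (u, v) \<in> r \<Longrightarrow> u \<noteq> v \<Longrightarrow> f u < f v"
  shows "r \<le>o cnf_ord x"
proof (rule ordLeq_strict_mono[OF r Well_order_cnf_ord[OF x]])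
  define g where "g = (\<lambda>u. inv_into (cnf_points x) (cnf_of_point x) (f u))"
  have g: "g u \<in> cnf_points x" "cnf_of_point x (g u) = f u" if "u \<in> Field r" for u
  proof -
    have "f u \<in> cnf_of_point x ` cnf_points x" using f[OF that] x by (simp add: cnf_of_point_image)
    then show "g u \<in> cnf_points x" and "cnf_of_point x (g u) = f u"
      by (simp_all add: g_def inv_into_into f_inv_into_f)
  qed
  then show "g u \<in> Field (cnf_ord x)" if "u \<in> Field r" for u
    using that by (simp add: Field_cnf_ord)
  show "(g u, g v) \<in> cnf_ord x \<and> g u \<noteq> g v" if "(u, v) \<in> r" "u \<noteq> v" for u v
  proof -
    have "u \<in> Field r" "v \<in> Field r" using that by (auto simp: Field_def)
    note * = g[OF this(1)] g[OF this(2)]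
    have "(g u, g v) \<in> cnf_ord x"
      unfolding cnf_ord_iff_le(1)[OF x *(1) *(3)] *(2,4) using mono[OF that] by (rule less_imp_le)
    moreover have "g u \<noteq> g v" using * mono[OF that] by auto
    ultimately show ?thesis by simp
  qed
qed

lemma cnf_ord_ordLeq:
  assumes s: "Well_order s" and x: "is_cnf x"
    and f: "\<And>u. u \<in> below x \<Longrightarrow> f u \<in> Field s"
    and mono: "\<And>u v. u \<in> below x \<Longrightarrow> v \<in> below x \<Longrightarrow> u < v \<Longrightarrow> (f u, f v) \<in> s \<and> f u \<noteq> f v"
  shows "cnf_ord x \<le>o s"
proof (rule ordLeq_strict_mono[OF Well_order_cnf_ord[OF x] s, where f = "\<lambda>u. f (cnf_of_point x u)"])
  have *: "cnf_of_point x u \<in> below x" if "u \<in> cnf_points x" for u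
    using that cnf_of_point_image[OF x] by blast
  show "f (cnf_of_point x u) \<in> Field s" if "u \<in> Field (cnf_ord x)" for u
    using that f * by (simp add: Field_cnf_ord)
  show "(f (cnf_of_point x u), f (cnf_of_point x v)) \<in> s \<and> f (cnf_of_point x u) \<noteq> f (cnf_of_point x v)"
    if "(u, v) \<in> cnf_ord x" "u \<noteq> v" for u v
  proof -
    have uv: "u \<in> cnf_points x" "v \<in> cnf_points x" "(u, v) \<in> lexord less_than"
      using that by (simp_all add: cnf_ord_def)
    show ?thesis
      by (rule mono[OF *[OF uv(1)] *[OF uv(2)] cnf_of_point_strict_mono[OF x uv]])
  qed
qed

lemma cnf_ord_mono:
  assumes "is_cnf x" "is_cnf y" "x \<le> y"
  shows "cnf_ord x \<le>o cnf_ord y"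
proof -
  define g where "g = inv_into (cnf_points y) (cnf_of_point y)"
  have g: "g u \<in> cnf_points y" "cnf_of_point y (g u) = u" if "u \<in> below x" for u
  proof -
    have "u \<in> below y" using that assms by (auto simp: below_def)
    then have "u \<in> cnf_of_point y ` cnf_points y" using assms by (simp add: cnf_of_point_image)
    then show "g u \<in> cnf_points y" and "cnf_of_point y (g u) = u"
      by (simp_all add: g_def inv_into_into f_inv_into_f)
  qed
  have mono: "(g u, g v) \<in> cnf_ord y \<and> g u \<noteq> g v" if "u \<in> below x" "v \<in> below x" "u < v" for u v
  proof
    show "(g u, g v) \<in> cnf_ord y"
      unfolding cnf_ord_iff_le(1)[OF assms(2) g(1)[OF that(1)] g(1)[OF that(2)]]
        g(2)[OF that(1)] g(2)[OF that(2)] using that(3) by (rule less_imp_le)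
    show "g u \<noteq> g v" using g(2)[OF that(1)] g(2)[OF that(2)] that(3) by (metis less_irrefl)
  qed
  have "g u \<in> Field (cnf_ord y)" if "u \<in> below x" for u
    using g(1)[OF that] by (simp add: Field_cnf_ord)
  then show ?thesis
    by (rule cnf_ord_ordLeq[OF Well_order_cnf_ord[OF assms(2)] assms(1) _ mono])
qed

section \<open>Types of colored linear orders\<close>

definition triple :: "nat \<Rightarrow> nat \<Rightarrow> nat \<Rightarrow> nat" where
  "triple c l r = prod_encode (c, prod_encode (l, r))"

definition t_color :: "nat \<Rightarrow> nat" where "t_color z = fst (prod_decode z)"
definition t_left :: "nat \<Rightarrow> nat" where "t_left z = fst (prod_decode (snd (prod_decode z)))"
definition t_right :: "nat \<Rightarrow> nat" where "t_right z = snd (prod_decode (snd (prod_decode z)))"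

lemma triple_sel [simp]:
  "t_color (triple c l r) = c" "t_left (triple c l r) = l" "t_right (triple c l r) = r"
  "triple (t_color z) (t_left z) (t_right z) = z"
  by (auto simp: triple_def t_color_def t_left_def t_right_def)

lemma triple_inject [simp]: "triple c l r = triple c' l' r' \<longleftrightarrow> c = c' \<and> l = l' \<and> r = r'"
  by (auto simp: triple_def)

lemma eq_triple_iff: "z = triple c l r \<longleftrightarrow> c = t_color z \<and> l = t_left z \<and> r = t_right z"
  using triple_sel(4)[of z] by auto

text \<open>The type of rank \<open>q + 1\<close> records the type of rank \<open>q\<close> and, for every point, its
  color together with the types of rank \<open>q\<close> of the parts to its left and to its right. In a
  linear order a chosen point splits the Ehrenfeucht-Fraisse game into independent games on
  these two parts, so that no types of tuples are needed. Coding types by natural numbers makes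
  them computable objects, and makes types over different structures comparable.\<close>

fun ty :: "nat \<Rightarrow> ('a \<Rightarrow> 'a \<Rightarrow> bool) \<Rightarrow> ('a \<Rightarrow> nat) \<Rightarrow> 'a set \<Rightarrow> nat" where
  "ty 0 lt col X = 0"
| "ty (Suc q) lt col X = prod_encode (ty q lt col X, set_encode
     ((\<lambda>a. triple (col a) (ty q lt col {x \<in> X. lt x a}) (ty q lt col {x \<in> X. lt a x})) ` X))"

definition lower :: "nat \<Rightarrow> nat" where "lower x = fst (prod_decode x)"
definition splits :: "nat \<Rightarrow> nat set" where "splits x = set_decode (snd (prod_decode x))"

lemma finite_splits [simp]: "finite (splits x)"
  by (simp add: splits_def)

lemma lower_sel [simp]: "lower (prod_encode (x, y)) = x"
  by (simp add: lower_def)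

lemma splits_sel [simp]: "finite Z \<Longrightarrow> splits (prod_encode (x, set_encode Z)) = Z"
  by (simp add: splits_def)

lemma prod_encode_lower_splits [simp]: "prod_encode (lower x, set_encode (splits x)) = x"
  by (simp add: lower_def splits_def)

lemma ty_empty [simp]: "ty q lt col {} = 0"
  by (induction q) (auto simp: prod_encode_def)

lemma ty_transport:
  assumes "inj_on f X" and "\<And>x y. x \<in> X \<Longrightarrow> y \<in> X \<Longrightarrow> lt' (f x) (f y) \<longleftrightarrow> lt x y"
    and "\<And>x. x \<in> X \<Longrightarrow> col' (f x) = col x"
  shows "ty q lt' col' (f ` X) = ty q lt col X"
  using assms
proof (induction q arbitrary: X)
  case (Suc q)
  have IH: "ty q lt' col' (f ` Y) = ty q lt col Y" if "Y \<subseteq> X" for Y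
    by (rule Suc.IH) (use that Suc.prems in \<open>blast intro: inj_on_subset\<close>)+
  have "{x \<in> f ` X. lt' x (f a)} = f ` {x \<in> X. lt x a}"
    "{x \<in> f ` X. lt' (f a) x} = f ` {x \<in> X. lt a x}" if "a \<in> X" for a
    using that Suc.prems(2) by auto
  then have "(\<lambda>a. triple (col' a) (ty q lt' col' {x \<in> f ` X. lt' x a}) (ty q lt' col' {x \<in> f ` X. lt' a x})) ` f ` X
      = (\<lambda>a. triple (col a) (ty q lt col {x \<in> X. lt x a}) (ty q lt col {x \<in> X. lt a x})) ` X"
    unfolding image_image using Suc.prems(3) by (intro image_cong) (auto simp: IH)
  then show ?case using IH[of X] by simp
qed simp

lemma ty_cong: "(\<And>x. x \<in> X \<Longrightarrow> col' x = col x) \<Longrightarrow> ty q lt col' X = ty q lt col X"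
  using ty_transport[of id X lt lt col' col q] by simp

definition triples :: "nat \<Rightarrow> nat set \<Rightarrow> nat set" where
  "triples d A = (\<lambda>(c, l, r). triple c l r) ` ({..<d} \<times> A \<times> A)"

lemma finite_triples [simp]: "finite A \<Longrightarrow> finite (triples d A)"
  by (simp add: triples_def)

lemma triples_iff [simp]: "z \<in> triples d A \<longleftrightarrow> t_color z < d \<and> t_left z \<in> A \<and> t_right z \<in> A"
proof
  show "z \<in> triples d A" if "t_color z < d \<and> t_left z \<in> A \<and> t_right z \<in> A"
    using that unfolding triples_def
    by (intro image_eqI[of _ _ "(t_color z, t_left z, t_right z)"]) auto
qed (auto simp: triples_def)

text \<open>A finite superset of the types of rank \<open>q\<close> of orders with \<open>d\<close> colors, simple enough to be
  closed under the operations on types for trivial reasons.\<close>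

fun types :: "nat \<Rightarrow> nat \<Rightarrow> nat set" where
  "types d 0 = {0}"
| "types d (Suc q) = (\<lambda>(x, Z). prod_encode (x, set_encode Z)) `
     (types d q \<times> Pow (triples d (types d q)))"

lemma finite_types [simp]: "finite (types d q)"
  by (induction q) auto

lemma types_Suc_iff:
  "x \<in> types d (Suc q) \<longleftrightarrow> lower x \<in> types d q \<and> splits x \<subseteq> triples d (types d q)"
  (is "?L \<longleftrightarrow> ?R")
proof
  show ?R if L: ?L
  proof -
    obtain p where "p \<in> types d q \<times> Pow (triples d (types d q))"
      and "x = (\<lambda>(x, Z). prod_encode (x, set_encode Z)) p"
      using L unfolding types.simps by blast
    then obtain y Z where yZ: "x = prod_encode (y, set_encode Z)" "y \<in> types d q"
        "Z \<subseteq> triples d (types d q)"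
      by (cases p) auto
    then have "finite Z" by (auto intro: finite_subset[of _ "triples d (types d q)"])
    then show ?R using yZ by simp
  qed
  show ?L if ?R
    using that unfolding types.simps
    by (intro image_eqI[of _ _ "(lower x, splits x)"]) simp_all
qed

lemma zero_in_types [simp]: "0 \<in> types d q"
proof (induction q)
  case (Suc q)
  have "lower 0 = 0" "splits 0 = {}"
    using lower_sel[of 0 0] splits_sel[of "{}" 0] by (auto simp: prod_encode_def)
  then show ?case using Suc unfolding types_Suc_iff by simp
qed simp

text \<open>The operations on types that correspond to ordered sums of two orders, to one-point
  orders, and to \<open>\<omega>\<close>-fold sums. The last one is only meaningful for types that are
  idempotent under addition: the part to the left of a point consists of a piece of its
  own summand, preceded either by nothing or by finitely many summands, which together have the
  same type as one of them.\<close>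

fun tadd :: "nat \<Rightarrow> nat \<Rightarrow> nat \<Rightarrow> nat" where
  "tadd 0 x y = 0"
| "tadd (Suc q) x y = prod_encode (tadd q (lower x) (lower y), set_encode
     ((\<lambda>z. triple (t_color z) (t_left z) (tadd q (t_right z) (lower y))) ` splits x \<union>
      (\<lambda>z. triple (t_color z) (tadd q (lower x) (t_left z)) (t_right z)) ` splits y))"

fun tpoint :: "nat \<Rightarrow> nat \<Rightarrow> nat" where
  "tpoint 0 c = 0"
| "tpoint (Suc q) c = prod_encode (tpoint q c, set_encode {triple c 0 0})"

fun tomega :: "nat \<Rightarrow> nat \<Rightarrow> nat" where
  "tomega 0 x = 0"
| "tomega (Suc q) x = prod_encode (tomega q (lower x), set_encode
     (let r' = (\<lambda>z. tadd q (t_right z) (tomega q (lower x))) in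
      (\<lambda>z. triple (t_color z) (t_left z) (r' z)) ` splits x \<union>
      (\<lambda>z. triple (t_color z) (tadd q (lower x) (t_left z)) (r' z)) ` splits x))"

lemma lower_tadd [simp]: "lower (tadd (Suc q) x y) = tadd q (lower x) (lower y)"
  by simp

lemma splits_tadd [simp]: "splits (tadd (Suc q) x y) =
     (\<lambda>z. triple (t_color z) (t_left z) (tadd q (t_right z) (lower y))) ` splits x \<union>
      (\<lambda>z. triple (t_color z) (tadd q (lower x) (t_left z)) (t_right z)) ` splits y"
  by simp

lemma lower_tomega [simp]: "lower (tomega (Suc q) x) = tomega q (lower x)"
  by simp

lemma splits_tomega [simp]: "splits (tomega (Suc q) x) =
     (\<lambda>z. triple (t_color z) (t_left z) (tadd q (t_right z) (tomega q (lower x)))) ` splits x \<union>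
     (\<lambda>z. triple (t_color z) (tadd q (lower x) (t_left z)) (tadd q (t_right z) (tomega q (lower x)))) ` splits x"
  by (simp add: Let_def)

lemma tadd_in_types: "x \<in> types d q \<Longrightarrow> y \<in> types d q \<Longrightarrow> tadd q x y \<in> types d q"
proof (induction q arbitrary: x y)
  case (Suc q)
  then show ?case
    unfolding types_Suc_iff lower_tadd splits_tadd image_subset_iff Un_subset_iff
    by (simp add: subset_iff)
qed simp

lemma tpoint_in_types: "c < d \<Longrightarrow> tpoint q c \<in> types d q"
proof (induction q)
  case (Suc q)
  have "splits (tpoint (Suc q) c) = {triple c 0 0}"
    unfolding tpoint.simps by (rule splits_sel) simp
  then show ?case using Suc unfolding types_Suc_iff by simp
qed simp

lemma tomega_in_types: "x \<in> types d q \<Longrightarrow> tomega q x \<in> types d q"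
proof (induction q arbitrary: x)
  case (Suc q)
  then have "tomega q (lower x) \<in> types d q" and "lower x \<in> types d q"
    and "\<And>z. z \<in> splits x \<Longrightarrow> z \<in> triples d (types d q)"
    unfolding types_Suc_iff by blast+
  then show ?case
    unfolding types_Suc_iff lower_tomega splits_tomega image_subset_iff Un_subset_iff
    by (simp add: tadd_in_types)
qed simp

locale colored_line =
  fixes lt :: "'a \<Rightarrow> 'a \<Rightarrow> bool" and col :: "'a \<Rightarrow> nat" and S :: "'a set" and d :: nat
  assumes irrefl: "x \<in> S \<Longrightarrow> \<not> lt x x"
    and trans: "x \<in> S \<Longrightarrow> y \<in> S \<Longrightarrow> z \<in> S \<Longrightarrow> lt x y \<Longrightarrow> lt y z \<Longrightarrow> lt x z"
    and total: "x \<in> S \<Longrightarrow> y \<in> S \<Longrightarrow> x \<noteq> y \<Longrightarrow> lt x y \<or> lt y x"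
    and col_less: "x \<in> S \<Longrightarrow> col x < d"
begin

lemma asym: "x \<in> S \<Longrightarrow> y \<in> S \<Longrightarrow> lt x y \<Longrightarrow> \<not> lt y x"
  using irrefl trans by blast

abbreviation T :: "nat \<Rightarrow> 'a set \<Rightarrow> nat" where "T q X \<equiv> ty q lt col X"

definition pt :: "nat \<Rightarrow> 'a set \<Rightarrow> 'a \<Rightarrow> nat" where
  "pt q X a = triple (col a) (T q {x \<in> X. lt x a}) (T q {x \<in> X. lt a x})"

lemma T_Suc: "T (Suc q) X = prod_encode (T q X, set_encode (pt q X ` X))"
  by (simp add: pt_def)

lemma T_in_types: "X \<subseteq> S \<Longrightarrow> T q X \<in> types d q"
proof (induction q arbitrary: X)
  case (Suc q)
  have sub: "T q Y \<in> types d q" if "Y \<subseteq> X" for Y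
    using that Suc.prems by (intro Suc.IH) (rule subset_trans)
  have "pt q X a \<in> triples d (types d q)" if "a \<in> X" for a
    using that Suc.prems col_less by (auto simp: pt_def intro: sub)
  then have "(T q X, pt q X ` X) \<in> types d q \<times> Pow (triples d (types d q))"
    using sub by blast
  then show ?case unfolding T_Suc types.simps by (rule rev_image_eqI) simp
qed simp

lemma pt_in_triples: "X \<subseteq> S \<Longrightarrow> pt q X ` X \<subseteq> triples d (types d q)"
proof (rule image_subsetI)
  fix a assume "X \<subseteq> S" "a \<in> X"
  then have "col a < d" "{x \<in> X. lt x a} \<subseteq> S" "{x \<in> X. lt a x} \<subseteq> S" using col_less by blast+
  then show "pt q X a \<in> triples d (types d q)" by (simp add: pt_def T_in_types)
qed

lemma finite_pt: "X \<subseteq> S \<Longrightarrow> finite (pt q X ` X)"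
  using finite_subset[OF pt_in_triples] by simp

lemma lower_T [simp]: "lower (T (Suc q) X) = T q X"
  by simp

lemma splits_T: "X \<subseteq> S \<Longrightarrow> splits (T (Suc q) X) = pt q X ` X"
  unfolding T_Suc by (rule splits_sel) (rule finite_pt)

lemma T_Suc_eqI:
  assumes "X \<subseteq> S" "lower t = T q X" "splits t = pt q X ` X"
  shows "T (Suc q) X = t"
  using assms prod_encode_lower_splits[of t] by (simp only: T_Suc)

lemma T_point: "a \<in> S \<Longrightarrow> T q {a} = tpoint q (col a)"
proof (induction q)
  case (Suc q)
  have "{x \<in> {a}. lt x a} = {}" "{x \<in> {a}. lt a x} = {}" using Suc irrefl by auto
  then have "pt q {a} a = triple (col a) 0 0" by (simp add: pt_def del: Collect_empty_eq)
  then show ?case using Suc unfolding T_Suc by simp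
qed simp

text \<open>If a point of the left summand is chosen, then the part to its right is again an ordered sum,
  and similarly for the right summand. So the claim reduces to lower rank.\<close>

lemma T_add:
  assumes "X \<subseteq> S" "Y \<subseteq> S" and "\<And>x y. x \<in> X \<Longrightarrow> y \<in> Y \<Longrightarrow> lt x y"
  shows "T q (X \<union> Y) = tadd q (T q X) (T q Y)"
  using assms
proof (induction q arbitrary: X Y)
  case (Suc q)
  have IH: "T q (X' \<union> Y') = tadd q (T q X') (T q Y')" if "X' \<subseteq> X" "Y' \<subseteq> Y" for X' Y'
    by (rule Suc.IH) (use that Suc.prems in blast)+
  have X: "pt q (X \<union> Y) a = triple (t_color (pt q X a)) (t_left (pt q X a)) (tadd q (t_right (pt q X a)) (T q Y))"
    if "a \<in> X" for a
  proof -
    have "{x \<in> X \<union> Y. lt x a} = {x \<in> X. lt x a}" "{x \<in> X \<union> Y. lt a x} = {x \<in> X. lt a x} \<union> Y"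
      using that Suc.prems asym by blast+
    then show ?thesis by (simp add: pt_def IH)
  qed
  have Y: "pt q (X \<union> Y) a = triple (t_color (pt q Y a)) (tadd q (T q X) (t_left (pt q Y a))) (t_right (pt q Y a))"
    if "a \<in> Y" for a
  proof -
    have "{x \<in> X \<union> Y. lt x a} = X \<union> {x \<in> Y. lt x a}" "{x \<in> X \<union> Y. lt a x} = {x \<in> Y. lt a x}"
      using that Suc.prems asym by blast+
    then show ?thesis by (simp add: pt_def IH)
  qed
  show ?case
  proof (rule T_Suc_eqI)
    show "X \<union> Y \<subseteq> S" using Suc.prems by auto
    show "lower (tadd (Suc q) (T (Suc q) X) (T (Suc q) Y)) = T q (X \<union> Y)"
      unfolding lower_tadd lower_T by (simp add: IH)
    show "splits (tadd (Suc q) (T (Suc q) X) (T (Suc q) Y)) = pt q (X \<union> Y) ` (X \<union> Y)"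
      unfolding splits_tadd lower_T splits_T[OF Suc.prems(1)] splits_T[OF Suc.prems(2)]
        image_Un image_image using X Y by (simp only: cong: image_cong)
  qed
qed simp

text \<open>Discarding finitely many summands from an \<open>\<omega>\<close>-fold sum leaves an \<open>\<omega>\<close>-fold sum. So the part to the
  right of a point in the \<open>j\<close>-th summand is the rest of that summand followed by an order to which
  the induction hypothesis applies.\<close>

lemma T_omega:
  fixes X :: "nat \<Rightarrow> 'a set"
  assumes "\<And>i. X i \<subseteq> S" and "\<And>i j x y. i < j \<Longrightarrow> x \<in> X i \<Longrightarrow> y \<in> X j \<Longrightarrow> lt x y"
    and "\<And>i. T q (X i) = e" and "tadd q e e = e"
  shows "T q (\<Union>i. X i) = tomega q e"
  using assms
proof (induction q arbitrary: X e)
  case (Suc q)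
  note sub = Suc.prems(1) and less = Suc.prems(2) and e = Suc.prems(3) and idem = Suc.prems(4)
  have e0: "T q (X i) = lower e" for i using e[of i] lower_T[of q "X i"] by simp
  have idem0: "tadd q (lower e) (lower e) = lower e"
    using arg_cong[OF idem, of lower] by (simp only: lower_tadd)
  have init: "T q (\<Union>i<Suc j. X i) = lower e" for j
  proof (induction j)
    case 0
    have "(\<Union>i<Suc 0. X i) = X 0" by auto
    then show ?case using e0 by simp
  next
    case (Suc j)
    have "T q ((\<Union>i<Suc j. X i) \<union> X (Suc j)) = tadd q (T q (\<Union>i<Suc j. X i)) (T q (X (Suc j)))"
      using sub less by (intro T_add) auto
    moreover have "(\<Union>i<Suc j. X i) \<union> X (Suc j) = (\<Union>i<Suc (Suc j). X i)"
      by (auto simp: lessThan_Suc)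
    ultimately show ?case using Suc e0 idem0 by simp
  qed
  have tail: "T q (\<Union>i. X (j + i)) = tomega q (lower e)" for j
  proof -
    have less': "lt x y" if "i < k" "x \<in> X (j + i)" "y \<in> X (j + k)" for i k x y
      by (rule less[of "j + i" "j + k", OF _ that(2,3)]) (simp add: that(1))
    show ?thesis
      by (rule Suc.IH[of "\<lambda>i. X (j + i)" "lower e"]) (rule sub, erule (2) less', rule e0, rule idem0)
  qed
  have pt: "pt q (\<Union>i. X i) a = triple (t_color (pt q (X j) a))
      (if j = 0 then t_left (pt q (X j) a) else tadd q (lower e) (t_left (pt q (X j) a)))
      (tadd q (t_right (pt q (X j) a)) (tomega q (lower e)))" if a: "a \<in> X j" for a j
  proof -
    have "{x \<in> (\<Union>i. X i). lt x a} = (\<Union>i<j. X i) \<union> {x \<in> X j. lt x a}"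
    proof (intro equalityI subsetI)
      fix x assume "x \<in> {x \<in> (\<Union>i. X i). lt x a}"
      then obtain i where i: "x \<in> X i" "lt x a" by blast
      have "\<not> j < i" using less[OF _ a i(1)] asym[of x a] i a sub by blast
      then show "x \<in> (\<Union>i<j. X i) \<union> {x \<in> X j. lt x a}"
        using i by (cases "i = j") auto
    next
      fix x assume "x \<in> (\<Union>i<j. X i) \<union> {x \<in> X j. lt x a}"
      then show "x \<in> {x \<in> (\<Union>i. X i). lt x a}" using less[OF _ _ a] by blast
    qed
    moreover have "T q ((\<Union>i<j. X i) \<union> {x \<in> X j. lt x a}) =
        tadd q (T q (\<Union>i<j. X i)) (T q {x \<in> X j. lt x a})"
      using sub less by (intro T_add) auto
    moreover have "{x \<in> (\<Union>i. X i). lt a x} = {x \<in> X j. lt a x} \<union> (\<Union>i. X (Suc j + i))"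
    proof (intro equalityI subsetI)
      fix x assume "x \<in> {x \<in> (\<Union>i. X i). lt a x}"
      then obtain i where i: "x \<in> X i" "lt a x" by auto
      have "\<not> i < j" using less[OF _ i(1) a] asym[of x a] i a sub by blast
      then show "x \<in> {x \<in> X j. lt a x} \<union> (\<Union>i. X (Suc j + i))"
        using i by (cases "i = j") (auto intro!: exI[of _ "i - Suc j"])
    next
      fix x assume "x \<in> {x \<in> X j. lt a x} \<union> (\<Union>i. X (Suc j + i))"
      then show "x \<in> {x \<in> (\<Union>i. X i). lt a x}" using less[OF _ a] by (auto, meson less_Suc_eq_le le_add1)
    qed
    moreover have "T q ({x \<in> X j. lt a x} \<union> (\<Union>i. X (Suc j + i))) =
        tadd q (T q {x \<in> X j. lt a x}) (T q (\<Union>i. X (Suc j + i)))"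
    proof (rule T_add)
      show "lt x y" if "x \<in> {x \<in> X j. lt a x}" "y \<in> (\<Union>i. X (Suc j + i))" for x y
        using that less[of j "Suc j + _" x y] by auto
    qed (use sub in blast)+
    ultimately show ?thesis
      using init[of "j - 1"] tail[of "Suc j"] by (cases j) (auto simp: pt_def)
  qed
  have spl: "pt q (X j) ` X j = splits e" for j
    using splits_T[OF sub, of q j] e[of j] by simp
  show ?case
  proof (rule T_Suc_eqI)
    show "(\<Union>i. X i) \<subseteq> S" using sub by auto
    show "lower (tomega (Suc q) e) = T q (\<Union>i. X i)"
      using tail[of 0] by (simp only: lower_tomega add_0)
    show "splits (tomega (Suc q) e) = pt q (\<Union>i. X i) ` (\<Union>i. X i)"
    proof (intro equalityI subsetI)
      fix z assume "z \<in> splits (tomega (Suc q) e)"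
      then obtain y where y: "y \<in> splits e" and z:
        "z = triple (t_color y) (t_left y) (tadd q (t_right y) (tomega q (lower e))) \<or>
         z = triple (t_color y) (tadd q (lower e) (t_left y)) (tadd q (t_right y) (tomega q (lower e)))"
        unfolding splits_tomega by blast
      \<comment> \<open>The two kinds of splits in the definition of \<open>tomega\<close> occur at points of the first and of
        the second summand.\<close>
      obtain a0 where a0: "a0 \<in> X 0" "y = pt q (X 0) a0" using y spl[of 0] by blast
      obtain a1 where a1: "a1 \<in> X 1" "y = pt q (X 1) a1" using y spl[of 1] by blast
      have "z = pt q (\<Union>i. X i) a0 \<or> z = pt q (\<Union>i. X i) a1"
        using z unfolding pt[OF a0(1)] pt[OF a1(1)] a0(2)[symmetric] a1(2)[symmetric] by simp
      then show "z \<in> pt q (\<Union>i. X i) ` (\<Union>i. X i)" using a0(1) a1(1) by blast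
    next
      fix z assume "z \<in> pt q (\<Union>i. X i) ` (\<Union>i. X i)"
      then obtain a j where a: "a \<in> X j" "z = pt q (\<Union>i. X i) a" by blast
      then have "pt q (X j) a \<in> splits e" using spl by blast
      then show "z \<in> splits (tomega (Suc q) e)"
        unfolding splits_tomega a(2) pt[OF a(1)] by (cases "j = 0") auto
    qed
  qed
qed simp

end

section \<open>Types and first-order equivalence\<close>

definition strict :: "'a colored \<Rightarrow> 'a \<Rightarrow> 'a \<Rightarrow> bool" where
  "strict A x y \<longleftrightarrow> (x, y) \<in> fst A \<and> x \<noteq> y"

text \<open>In a colored ordinal exactly one class below \<open>d\<close> contains a given point, but classes from \<open>d\<close> on
  are unconstrained. The least index is the one below \<open>d\<close>.\<close>

definition color :: "'a colored \<Rightarrow> 'a \<Rightarrow> nat" where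
  "color A x = (LEAST i. x \<in> snd A i)"

definition otype :: "nat \<Rightarrow> 'a colored \<Rightarrow> nat" where
  "otype q A = ty q (strict A) (color A) (Field (fst A))"

lemma color_iff:
  assumes "colored_ordinal d A" "x \<in> Field (fst A)"
  shows "color A x < d" and "i < d \<Longrightarrow> x \<in> snd A i \<longleftrightarrow> color A x = i"
proof -
  obtain j where j: "j < d" "x \<in> snd A j" using assms by (auto simp: colored_ordinal_def)
  then have le: "color A x \<le> j" and mem: "x \<in> snd A (color A x)"
    unfolding color_def by (auto intro: Least_le LeastI)
  then show less: "color A x < d" using j by simp
  show "x \<in> snd A i \<longleftrightarrow> color A x = i" if "i < d"
    using assms(1) that mem less unfolding colored_ordinal_def disjoint_family_on_def by blast
qed

lemma Well_order_colored_ordinal: "colored_ordinal d A \<Longrightarrow> Well_order (fst A)"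
  by (simp add: colored_ordinal_def)

lemma colored_line_colored_ordinal:
  assumes "colored_ordinal d A"
  shows "colored_line (strict A) (color A) (Field (fst A)) d"
proof
  have *: "Refl (fst A)" "trans (fst A)" "antisym (fst A)" "Total (fst A)"
    using Well_order_colored_ordinal[OF assms]
    by (auto simp: well_order_on_def linear_order_on_def partial_order_on_def preorder_on_def)
  show "strict A x y \<Longrightarrow> strict A y z \<Longrightarrow> strict A x z" for x y z
    using *(2,3) unfolding strict_def trans_def antisym_def by blast
  show "x \<in> Field (fst A) \<Longrightarrow> y \<in> Field (fst A) \<Longrightarrow> x \<noteq> y \<Longrightarrow> strict A x y \<or> strict A y x" for x y
    using *(4) unfolding strict_def total_on_def by blast
qed (use assms in \<open>auto simp: strict_def color_iff\<close>)

lemma otype_in_types: "colored_ordinal d A \<Longrightarrow> otype q A \<in> types d q"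
  unfolding otype_def by (rule colored_line.T_in_types[OF colored_line_colored_ordinal]) auto

text \<open>A position of the Ehrenfeucht-Fraisse game with \<open>q\<close> rounds left, in which the values of
  the variables in \<open>V\<close> are the chosen points. The two orders have been cut at corresponding points
  until no chosen point is left inside a piece, and corresponding pieces have equal types.\<close>

inductive matching :: "('a \<Rightarrow> 'a \<Rightarrow> bool) \<Rightarrow> ('a \<Rightarrow> nat) \<Rightarrow> ('b \<Rightarrow> 'b \<Rightarrow> bool) \<Rightarrow> ('b \<Rightarrow> nat) \<Rightarrow>
    nat \<Rightarrow> (nat \<Rightarrow> 'a) \<Rightarrow> (nat \<Rightarrow> 'b) \<Rightarrow> nat set \<Rightarrow> 'a set \<Rightarrow> 'b set \<Rightarrow> bool"
  for lt col lt' col' q s s' V where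
  leaf: "\<forall>v\<in>V. s v \<notin> X \<and> s' v \<notin> Y \<Longrightarrow> ty q lt col X = ty q lt' col' Y \<Longrightarrow>
    matching lt col lt' col' q s s' V X Y"
| node: "a \<in> X \<Longrightarrow> b \<in> Y \<Longrightarrow> col a = col' b \<Longrightarrow> \<forall>v\<in>V. s v = a \<longleftrightarrow> s' v = b \<Longrightarrow>
    matching lt col lt' col' q s s' V {x \<in> X. lt x a} {y \<in> Y. lt' y b} \<Longrightarrow>
    matching lt col lt' col' q s s' V {x \<in> X. lt a x} {y \<in> Y. lt' b y} \<Longrightarrow>
    matching lt col lt' col' q s s' V X Y"

lemma matching_sym:
  "matching lt col lt' col' q s s' V X Y \<Longrightarrow> matching lt' col' lt col q s' s V Y X"
  by (induction rule: matching.induct) (auto intro: matching.intros)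

locale two_lines =
  A: colored_line lt col S d + B: colored_line lt' col' S' d
  for lt :: "'a \<Rightarrow> 'a \<Rightarrow> bool" and col S d
    and lt' :: "'b \<Rightarrow> 'b \<Rightarrow> bool" and col' S'
begin

abbreviation "matches \<equiv> matching lt col lt' col'"

text \<open>Two different chosen points are separated by one of the cuts, at the latest by the cut at one of
  them, and so their order is the same on both sides.\<close>

lemma matching_atoms:
  assumes "matches q s s' V X Y" "X \<subseteq> S" "Y \<subseteq> S'"
  shows "\<forall>v\<in>V. (s v \<in> X \<longleftrightarrow> s' v \<in> Y) \<and> (s v \<in> X \<longrightarrow> col (s v) = col' (s' v) \<and>
    (\<forall>w\<in>V. s w \<in> X \<longrightarrow> (lt (s v) (s w) \<longleftrightarrow> lt' (s' v) (s' w)) \<and> (s v = s w \<longleftrightarrow> s' v = s' w)))"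
  using assms
proof (induction rule: matching.induct)
  case (leaf X Y)
  then show ?case by blast
next
  case (node a X b Y)
  define XL XR where "XL = {x \<in> X. lt x a}" and "XR = {x \<in> X. lt a x}"
  define YL YR where "YL = {y \<in> Y. lt' y b}" and "YR = {y \<in> Y. lt' b y}"
  note defs = XL_def XR_def YL_def YR_def
  have sub: "XL \<subseteq> S" "YL \<subseteq> S'" "XR \<subseteq> S" "YR \<subseteq> S'"
    and ab: "a \<in> S" "b \<in> S'" using node.prems node.hyps by (auto simp: defs)
  note L = node.IH(1)[folded defs, OF sub(1,2), rule_format]
    and R = node.IH(2)[folded defs, OF sub(3,4), rule_format]
  have X: "x \<in> X \<longleftrightarrow> x = a \<or> x \<in> XL \<or> x \<in> XR" for x
    using A.total ab node.prems(1) node.hyps(1) unfolding defs by blast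
  have Y: "y \<in> Y \<longleftrightarrow> y = b \<or> y \<in> YL \<or> y \<in> YR" for y
    using B.total ab node.prems(2) node.hyps(2) unfolding defs by blast
  have mem: "s v \<in> X \<longleftrightarrow> s' v \<in> Y" if "v \<in> V" for v
    using L[OF that] R[OF that] node.hyps(4) that unfolding X Y by simp
  have pos: "(s v = a \<and> s' v = b) \<or> (s v \<in> XL \<and> s' v \<in> YL) \<or> (s v \<in> XR \<and> s' v \<in> YR)"
    if "v \<in> V" "s v \<in> X" for v
    using L[OF that(1)] R[OF that(1)] node.hyps(4) that unfolding X by auto
  have cross: "(lt (s v) (s w) \<longleftrightarrow> lt' (s' v) (s' w)) \<and> (s v = s w \<longleftrightarrow> s' v = s' w)"
    if v: "v \<in> V" "s v \<in> X" and w: "w \<in> V" "s w \<in> X" for v w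
  proof -
    have S: "s v \<in> S" "s w \<in> S" "s' v \<in> S'" "s' w \<in> S'"
      using v w mem node.prems by auto
    note A = A.asym[OF S(1,2)] A.asym[OF S(1) ab(1)] A.asym[OF S(2) ab(1)] A.irrefl[OF ab(1)]
      A.trans[OF S(1) ab(1) S(2)] A.trans[OF S(2) ab(1) S(1)]
    note B = B.asym[OF S(3,4)] B.asym[OF S(3) ab(2)] B.asym[OF S(4) ab(2)] B.irrefl[OF ab(2)]
      B.trans[OF S(3) ab(2) S(4)] B.trans[OF S(4) ab(2) S(3)]
    consider "s v \<in> XL" "s w \<in> XL" | "s v \<in> XR" "s w \<in> XR"
      | "\<not> (s v \<in> XL \<and> s w \<in> XL)" "\<not> (s v \<in> XR \<and> s w \<in> XR)" by blast
    then show ?thesis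
    proof cases
      case 1
      then show ?thesis using L[OF v(1)] w(1) by simp
    next
      case 2
      then show ?thesis using R[OF v(1)] w(1) by simp
    next
      case 3
      then show ?thesis
        using pos[OF v] pos[OF w] A B A.irrefl[OF S(1)] B.irrefl[OF S(3)]
        unfolding defs mem_Collect_eq by metis
    qed
  qed
  have col: "col (s v) = col' (s' v)" if "v \<in> V" "s v \<in> X" for v
    using pos[OF that] L[OF that(1)] R[OF that(1)] node.hyps(3) by auto
  show ?case using mem cross col by simp
qed

text \<open>Choosing a point outside of a piece does not disturb the matching of that piece.\<close>

lemma matching_update_outside:
  assumes "matches (Suc q) s s' V X Y" "a \<notin> X" "b \<notin> Y"
  shows "matches q (s(v := a)) (s'(v := b)) (insert v V) X Y"
  using assms
proof (induction rule: matching.induct)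
  case (leaf X Y)
  then show ?case by (intro matching.leaf) auto
next
  case (node a' X b' Y)
  then show ?case by (intro matching.node[of a' X b' Y]) auto
qed

text \<open>A move in one of the orders is answered inside the corresponding piece, where equality of the types
  of rank \<open>q + 1\<close> provides a point that splits the piece into parts of the right types of
  rank \<open>q\<close>. This point becomes a new cut.\<close>

lemma matching_forth:
  assumes "matches (Suc q) s s' V X Y" "X \<subseteq> S" "Y \<subseteq> S'" "a \<in> X"
  shows "\<exists>b\<in>Y. matches q (s(v := a)) (s'(v := b)) (insert v V) X Y"
  using assms
proof (induction rule: matching.induct)
  case (leaf X Y)
  have "splits (ty (Suc q) lt col X) = splits (ty (Suc q) lt' col' Y)"
    using leaf.hyps(2) by (rule arg_cong)
  then have "A.pt q X ` X = B.pt q Y ` Y"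
    unfolding A.splits_T[OF leaf.prems(1)] B.splits_T[OF leaf.prems(2)] .
  then obtain b where b: "b \<in> Y" "A.pt q X a = B.pt q Y b" using leaf.prems(3) by blast
  have "a \<in> S" "b \<in> S'" using b leaf.prems by auto
  then have "matches q (s(v := a)) (s'(v := b)) (insert v V) X Y"
    using b leaf A.irrefl B.irrefl
    by (intro matching.node[of a X b Y] matching.leaf) (auto simp: A.pt_def B.pt_def)
  then show ?case using b(1) by blast
next
  case (node a' X b' Y)
  let ?XL = "{x \<in> X. lt x a'}" and ?XR = "{x \<in> X. lt a' x}"
  let ?YL = "{y \<in> Y. lt' y b'}" and ?YR = "{y \<in> Y. lt' b' y}"
  have S: "a \<in> S" "a' \<in> S" "b' \<in> S'" and sub: "?XL \<subseteq> S" "?YL \<subseteq> S'" "?XR \<subseteq> S" "?YR \<subseteq> S'"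
    using node.prems node.hyps by auto
  consider "a = a'" | "lt a a'" | "lt a' a" using A.total S by blast
  then show ?case
  proof cases
    case 1
    have "matches q (s(v := a)) (s'(v := b')) (insert v V) ?XL ?YL"
      "matches q (s(v := a)) (s'(v := b')) (insert v V) ?XR ?YR"
      using node.hyps(5,6) 1 A.irrefl[OF S(1)] B.irrefl[OF S(3)]
      by (auto intro!: matching_update_outside)
    moreover have "\<forall>w\<in>insert v V. (s(v := a)) w = a' \<longleftrightarrow> (s'(v := b')) w = b'"
      using node.hyps(4) 1 by simp
    ultimately show ?thesis
      using node.hyps(2) matching.node[where col = col and col' = col', OF node.hyps(1-3)] by blast
  next
    case 2
    then obtain b where b: "b \<in> ?YL" "matches q (s(v := a)) (s'(v := b)) (insert v V) ?XL ?YL"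
      using node.IH(1)[OF sub(1,2)] node.prems by blast
    have ne: "a \<noteq> a'" "b \<noteq> b'" "\<not> lt a' a" "\<not> lt' b' b"
      using b 2 S A.irrefl B.irrefl A.asym B.asym node.prems(2) by blast+
    then have "matches q (s(v := a)) (s'(v := b)) (insert v V) ?XR ?YR"
      using node.hyps(6) by (intro matching_update_outside) auto
    moreover have "\<forall>w\<in>insert v V. (s(v := a)) w = a' \<longleftrightarrow> (s'(v := b)) w = b'"
      using node.hyps(4) ne by simp
    ultimately show ?thesis
      using b matching.node[where col = col and col' = col', OF node.hyps(1-3)] by blast
  next
    case 3
    then obtain b where b: "b \<in> ?YR" "matches q (s(v := a)) (s'(v := b)) (insert v V) ?XR ?YR"
      using node.IH(2)[OF sub(3,4)] node.prems by blast
    have ne: "a \<noteq> a'" "b \<noteq> b'" "\<not> lt a a'" "\<not> lt' b b'"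
      using b 3 S A.irrefl B.irrefl A.asym B.asym node.prems(2) by blast+
    then have "matches q (s(v := a)) (s'(v := b)) (insert v V) ?XL ?YL"
      using node.hyps(5) by (intro matching_update_outside) auto
    moreover have "\<forall>w\<in>insert v V. (s(v := a)) w = a' \<longleftrightarrow> (s'(v := b)) w = b'"
      using node.hyps(4) ne by simp
    ultimately show ?thesis
      using b matching.node[where col = col and col' = col', OF node.hyps(1-3)] by blast
  qed
qed

end

lemma sat_matching:
  fixes A B :: "'a colored"
  assumes A: "colored_ordinal d A" and B: "colored_ordinal d B"
    and "matching (strict A) (color A) (strict B) (color B) q s s' V (Field (fst A)) (Field (fst B))"
    and "s ` V \<subseteq> Field (fst A)" and "fv \<phi> \<subseteq> V" "colors \<phi> \<subseteq> {..<d}" "qrank \<phi> \<le> q"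
  shows "sat A s \<phi> \<longleftrightarrow> sat B s' \<phi>"
proof -
  interpret AB: two_lines "strict A" "color A" "Field (fst A)" d "strict B" "color B" "Field (fst B)"
    by (intro two_lines.intro colored_line_colored_ordinal A B)
  interpret BA: two_lines "strict B" "color B" "Field (fst B)" d "strict A" "color A" "Field (fst A)"
    by (intro two_lines.intro colored_line_colored_ordinal A B)
  show ?thesis
    using assms(3-)
  proof (induction \<phi> arbitrary: q s s' V)
    case (Less x y)
    then show ?case
      using AB.matching_atoms[OF Less.prems(1)] by (auto simp: strict_def)
  next
    case (Equal x y)
    then show ?case using AB.matching_atoms[OF Equal.prems(1)] by auto
  next
    case (Color i x)
    then have "s x \<in> Field (fst A)" "s' x \<in> Field (fst B)" "color A (s x) = color B (s' x)" "i < d"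
      using AB.matching_atoms[OF Color.prems(1)] by auto
    then show ?case using color_iff(2)[OF A] color_iff(2)[OF B] by simp
  next
    case (Exi x \<phi>)
    obtain q' where q: "q = Suc q'" using Exi.prems by (cases q) auto
    have forward: "\<exists>b\<in>Field (fst B). sat B (s'(x := b)) \<phi> \<longleftrightarrow> sat A (s(x := a)) \<phi>"
      if "a \<in> Field (fst A)" for a
    proof -
      obtain b where "b \<in> Field (fst B)" and "AB.matches q' (s(x := a)) (s'(x := b)) (insert x V)
          (Field (fst A)) (Field (fst B))"
        using AB.matching_forth[OF Exi.prems(1)[unfolded q] subset_refl subset_refl \<open>a \<in> _\<close>] by blast
      moreover from this(2) have "sat A (s(x := a)) \<phi> \<longleftrightarrow> sat B (s'(x := b)) \<phi>"
        by (rule Exi.IH) (use Exi.prems q that in auto)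
      ultimately show ?thesis by blast
    qed
    have backward: "\<exists>a\<in>Field (fst A). sat B (s'(x := b)) \<phi> \<longleftrightarrow> sat A (s(x := a)) \<phi>"
      if "b \<in> Field (fst B)" for b
    proof -
      obtain a where a: "a \<in> Field (fst A)" and "BA.matches q' (s'(x := b)) (s(x := a)) (insert x V)
          (Field (fst B)) (Field (fst A))"
        using BA.matching_forth[OF matching_sym[OF Exi.prems(1)[unfolded q]] subset_refl subset_refl \<open>b \<in> _\<close>]
        by blast
      from matching_sym[OF this(2)] have "sat A (s(x := a)) \<phi> \<longleftrightarrow> sat B (s'(x := b)) \<phi>"
        by (rule Exi.IH) (use Exi.prems q a in auto)
      then show ?thesis using a by blast
    qed
    show ?case using forward backward by auto
  next
    case (Neg \<phi>)
    then show ?case using Neg.IH[OF Neg.prems(1)] by auto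
  next
    case (Conj \<phi> \<psi>)
    then show ?case using Conj.IH(1)[OF Conj.prems(1)] Conj.IH(2)[OF Conj.prems(1)] by auto
  qed simp
qed

lemma otype_eq_imp_equiv:
  assumes "colored_ordinal d A" "colored_ordinal d B" "otype q A = otype q B"
  shows "equiv_q d q A B"
proof -
  have "sat A s \<phi> \<longleftrightarrow> sat B s' \<phi>" if "sentence d \<phi>" "qrank \<phi> \<le> q" for \<phi> s s'
    by (rule sat_matching[OF assms(1,2) matching.leaf[where V = "{}"]])
      (use that assms(3) in \<open>auto simp: sentence_def otype_def\<close>)
  then show ?thesis unfolding equiv_q_def models_def by blast
qed

text \<open>Conversely, types are definable. The formula \<open>type_fm d q u v t\<close> says that the interval
  between the variables \<open>u\<close> and \<open>v\<close>, where \<open>None\<close> means that there is no bound, has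
  type \<open>t\<close>. It quantifies the variable \<open>q\<close>, and its bounds are variables of larger number.\<close>

fun Conjs :: "fm list \<Rightarrow> fm" where
  "Conjs [] = Neg FF"
| "Conjs (\<phi> # \<phi>s) = Conj \<phi> (Conjs \<phi>s)"

lemma Conjs_simps [simp]:
  "sat A s (Conjs \<phi>s) \<longleftrightarrow> (\<forall>\<phi>\<in>set \<phi>s. sat A s \<phi>)"
  "fv (Conjs \<phi>s) = \<Union> (fv ` set \<phi>s)" "colors (Conjs \<phi>s) = \<Union> (colors ` set \<phi>s)"
  "qrank (Conjs \<phi>s) \<le> n \<longleftrightarrow> (\<forall>\<phi>\<in>set \<phi>s. qrank \<phi> \<le> n)"
  by (induction \<phi>s) auto

definition above_fm :: "nat option \<Rightarrow> nat \<Rightarrow> fm" where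
  "above_fm u x = (case u of None \<Rightarrow> Neg FF | Some y \<Rightarrow> Less y x)"
definition below_fm :: "nat \<Rightarrow> nat option \<Rightarrow> fm" where
  "below_fm x v = (case v of None \<Rightarrow> Neg FF | Some y \<Rightarrow> Less x y)"

fun type_fm :: "nat \<Rightarrow> nat \<Rightarrow> nat option \<Rightarrow> nat option \<Rightarrow> nat \<Rightarrow> fm" where
  "type_fm d 0 u v t = Neg FF"
| "type_fm d (Suc q) u v t = Conj (type_fm d q u v (lower t))
     (Conjs (map (\<lambda>z. (if z \<in> splits t then id else Neg)
        (Exi q (Conj (Conj (above_fm u q) (below_fm q v)) (Conj (Color (t_color z) q)
          (Conj (type_fm d q u (Some q) (t_left z)) (type_fm d q (Some q) v (t_right z)))))))
       (sorted_list_of_set (triples d (types d q)))))"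

lemma set_triples [simp]: "set (sorted_list_of_set (triples d (types d q))) = triples d (types d q)"
  by simp

lemma bound_fm_simps [simp]:
  "qrank (above_fm u x) = 0" "qrank (below_fm x v) = 0"
  "colors (above_fm u x) = {}" "colors (below_fm x v) = {}"
  "fv (above_fm u x) \<subseteq> insert x (set_option u)" "fv (below_fm x v) \<subseteq> insert x (set_option v)"
  by (auto simp: above_fm_def below_fm_def split: option.split)

lemma qrank_type_fm: "qrank (type_fm d q u v t) \<le> q"
proof (induction q arbitrary: u v t)
  case (Suc q)
  then show ?case by (simp add: le_SucI)
qed simp

lemma colors_type_fm: "colors (type_fm d q u v t) \<subseteq> {..<d}"
proof (induction q arbitrary: u v t)
  case (Suc q)
  then show ?case by (simp add: UN_subset_iff)
qed simp

lemma fv_type_fm: "fv (type_fm d q u v t) \<subseteq> set_option u \<union> set_option v"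
proof (induction q arbitrary: u v t)
  case (Suc q)
  have "fv (type_fm d q u (Some q) t) \<subseteq> set_option u \<union> {q}"
    and "fv (type_fm d q (Some q) v t) \<subseteq> set_option v \<union> {q}" for t
    using Suc[of u "Some q" t] Suc[of "Some q" v t] by simp_all
  moreover have "fv (above_fm u q) \<subseteq> insert q (set_option u)"
    and "fv (below_fm q v) \<subseteq> insert q (set_option v)" by simp_all
  ultimately have "fv (Exi q (Conj (Conj (above_fm u q) (below_fm q v)) (Conj (Color c q)
      (Conj (type_fm d q u (Some q) l) (type_fm d q (Some q) v r))))) \<subseteq> set_option u \<union> set_option v"
    for c l r unfolding fv.simps by blast
  then show ?case using Suc[of u v "lower t"] by (simp add: UN_subset_iff)
qed simp

definition interval :: "'a colored \<Rightarrow> (nat \<Rightarrow> 'a) \<Rightarrow> nat option \<Rightarrow> nat option \<Rightarrow> 'a set" where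
  "interval A s u v = {x \<in> Field (fst A).
     (\<forall>y\<in>set_option u. strict A (s y) x) \<and> (\<forall>y\<in>set_option v. strict A x (s y))}"

lemma sat_type_fm:
  assumes A: "colored_ordinal d A"
  shows "t \<in> types d q \<Longrightarrow> \<forall>y\<in>set_option u \<union> set_option v. q \<le> y \<and> s y \<in> Field (fst A) \<Longrightarrow>
    sat A s (type_fm d q u v t) \<longleftrightarrow> ty q (strict A) (color A) (interval A s u v) = t"
proof (induction q arbitrary: u v t s)
  case (Suc q)
  interpret colored_line "strict A" "color A" "Field (fst A)" d
    by (rule colored_line_colored_ordinal[OF A])
  let ?X = "interval A s u v"
  have X: "?X \<subseteq> Field (fst A)" by (auto simp: interval_def)
  have t: "lower t \<in> types d q" "splits t \<subseteq> triples d (types d q)"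
    using Suc.prems(1) unfolding types_Suc_iff by auto
  have inside: "sat A (s(q := a)) (Conj (above_fm u q) (below_fm q v)) \<longleftrightarrow> a \<in> ?X"
    if "a \<in> Field (fst A)" for a
    using that Suc.prems(2)
    by (auto simp: above_fm_def below_fm_def interval_def strict_def split: option.split)
  have left: "sat A (s(q := a)) (type_fm d q u (Some q) l) \<longleftrightarrow> T q {x \<in> ?X. strict A x a} = l"
    and right: "sat A (s(q := a)) (type_fm d q (Some q) v l) \<longleftrightarrow> T q {x \<in> ?X. strict A a x} = l"
    if "a \<in> ?X" "l \<in> types d q" for a l
  proof -
    have a: "a \<in> Field (fst A)" using X that by auto
    have upd: "(s(q := a)) y = s y" "s y \<in> Field (fst A)" if "y \<in> set_option u \<union> set_option v" for y
      using Suc.prems(2) that by auto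
    have pre: "\<forall>y\<in>set_option u \<union> set_option (Some q). q \<le> y \<and> (s(q := a)) y \<in> Field (fst A)"
      "\<forall>y\<in>set_option (Some q) \<union> set_option v. q \<le> y \<and> (s(q := a)) y \<in> Field (fst A)"
      using Suc.prems(2) a by auto
    have bounds: "\<And>y. y \<in> set_option u \<Longrightarrow> strict A (s y) a" "\<And>y. y \<in> set_option v \<Longrightarrow> strict A a (s y)"
      using that(1) by (auto simp: interval_def)
    have "interval A (s(q := a)) u (Some q) = {x \<in> ?X. strict A x a}"
      unfolding interval_def using upd bounds trans[OF _ a] by simp blast
    moreover have "interval A (s(q := a)) (Some q) v = {x \<in> ?X. strict A a x}"
      unfolding interval_def using upd bounds trans[OF _ a] by simp blast
    ultimately show "sat A (s(q := a)) (type_fm d q u (Some q) l) \<longleftrightarrow> T q {x \<in> ?X. strict A x a} = l"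
      "sat A (s(q := a)) (type_fm d q (Some q) v l) \<longleftrightarrow> T q {x \<in> ?X. strict A a x} = l"
      using Suc.IH[where s = "s(q := a)", OF that(2) pre(1)]
        Suc.IH[where s = "s(q := a)", OF that(2) pre(2)] by (simp_all del: fun_upd_apply)
  qed
  have ex: "sat A s (Exi q (Conj (Conj (above_fm u q) (below_fm q v)) (Conj (Color (t_color z) q)
      (Conj (type_fm d q u (Some q) (t_left z)) (type_fm d q (Some q) v (t_right z)))))) \<longleftrightarrow>
      z \<in> pt q ?X ` ?X" (is "?L \<longleftrightarrow> ?R") if z: "z \<in> triples d (types d q)" for z
  proof -
    have "?L \<longleftrightarrow> (\<exists>a\<in>?X. color A a = t_color z \<and> T q {x \<in> ?X. strict A x a} = t_left z \<and>
        T q {x \<in> ?X. strict A a x} = t_right z)"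
    proof -
      have "sat A (s(q := a)) (Conj (Conj (above_fm u q) (below_fm q v)) (Conj (Color (t_color z) q)
          (Conj (type_fm d q u (Some q) (t_left z)) (type_fm d q (Some q) v (t_right z))))) \<longleftrightarrow>
        a \<in> ?X \<and> color A a = t_color z \<and> T q {x \<in> ?X. strict A x a} = t_left z \<and>
        T q {x \<in> ?X. strict A a x} = t_right z" if "a \<in> Field (fst A)" for a
        using inside[OF that] left[of a "t_left z"] right[of a "t_right z"] z
          color_iff(2)[OF A that, of "t_color z"] by auto
      then show ?thesis using X by (simp only: sat.simps(7)) blast
    qed
    also have "\<dots> \<longleftrightarrow> (\<exists>a\<in>?X. z = pt q ?X a)"
      unfolding pt_def eq_triple_iff ..
    finally show ?thesis by blast
  qed
  have "sat A s (type_fm d (Suc q) u v t) \<longleftrightarrow> T q ?X = lower t \<and>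
      (\<forall>z\<in>triples d (types d q). z \<in> splits t \<longleftrightarrow> z \<in> pt q ?X ` ?X)"
  proof -
    have "sat A s (type_fm d q u v (lower t)) \<longleftrightarrow> T q ?X = lower t"
      using Suc.prems(2) by (intro Suc.IH[OF t(1)]) auto
    then show ?thesis using ex by (auto simp del: sat.simps(7))
  qed
  also have "\<dots> \<longleftrightarrow> T q ?X = lower t \<and> pt q ?X ` ?X = splits t"
    using t(2) pt_in_triples[OF X, of q] by blast
  also have "\<dots> \<longleftrightarrow> T (Suc q) ?X = t"
    using T_Suc_eqI[OF X, of t q] lower_T splits_T[OF X] by metis
  finally show ?case .
qed simp

abbreviation char_fm :: "nat \<Rightarrow> nat \<Rightarrow> nat \<Rightarrow> fm" where
  "char_fm d q t \<equiv> type_fm d q None None t"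

lemma models_char_fm:
  "colored_ordinal d A \<Longrightarrow> t \<in> types d q \<Longrightarrow> models A (char_fm d q t) \<longleftrightarrow> otype q A = t"
  by (simp add: models_def sat_type_fm otype_def interval_def)

lemma sentence_char_fm: "sentence d (char_fm d q t)"
  using fv_type_fm[of d q None None t] colors_type_fm by (auto simp: sentence_def)

lemma equiv_q_iff_otype:
  assumes "colored_ordinal d A" "colored_ordinal d B"
  shows "equiv_q d q A B \<longleftrightarrow> otype q A = otype q B"
proof
  assume "equiv_q d q A B"
  then have "models A (char_fm d q (otype q A)) \<longleftrightarrow> models B (char_fm d q (otype q A))"
    using sentence_char_fm qrank_type_fm unfolding equiv_q_def by blast
  then show "otype q A = otype q B"
    using assms by (simp add: models_char_fm otype_in_types)
qed (rule otype_eq_imp_equiv[OF assms])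

lemma characteristic_iff:
  fixes A :: "'a colored"
  assumes "colored_ordinal d A"
  shows "characteristic d q A \<sigma> \<longleftrightarrow> sentence d \<sigma> \<and> qrank \<sigma> \<le> q \<and>
    (\<forall>B :: 'a colored. colored_ordinal d B \<longrightarrow> (models B \<sigma> \<longleftrightarrow> otype q B = otype q A))"
  using equiv_q_iff_otype[OF assms] unfolding characteristic_def by metis

lemma ex_characteristic_set: "\<exists>S. characteristic_set TYPE('a) d q S"
proof
  let ?S = "char_fm d q ` otype q ` {A :: 'a colored. colored_ordinal d A}"
  have char: "characteristic d q A (char_fm d q (otype q A))" if "colored_ordinal d A" for A :: "'a colored"
    using that by (simp add: characteristic_iff sentence_char_fm qrank_type_fm models_char_fm otype_in_types)
  have "otype q ` {A :: 'a colored. colored_ordinal d A} \<subseteq> types d q"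
    using otype_in_types by blast
  then have "finite (otype q ` {A :: 'a colored. colored_ordinal d A})"
    by (rule finite_subset) simp
  then have "finite ?S" by (rule finite_imageI)
  moreover have "\<exists>!\<sigma>. \<sigma> \<in> ?S \<and> characteristic d q A \<sigma>" if A: "colored_ordinal d A" for A :: "'a colored"
  proof (rule ex1I[of _ "char_fm d q (otype q A)"])
    fix \<sigma> assume \<sigma>: "\<sigma> \<in> ?S \<and> characteristic d q A \<sigma>"
    then obtain B :: "'a colored" where B: "colored_ordinal d B" "\<sigma> = char_fm d q (otype q B)" by blast
    then have "models A \<sigma>" using \<sigma> A characteristic_iff[OF A] by blast
    then show "\<sigma> = char_fm d q (otype q A)"
      using A B by (simp add: models_char_fm otype_in_types)
  qed (use A char in blast)
  ultimately show "characteristic_set TYPE('a) d q ?S"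
    unfolding characteristic_set_def using char by blast
qed

section \<open>Realizing types by ordinals below \<open>\<omega>\<^sup>\<omega>\<close>\<close>

text \<open>\<open>built d q n t x\<close>: a derivation of height at most \<open>n\<close> produces a colored ordinal of
  type \<open>t\<close> and order type at most \<open>x\<close>. The height makes derivations well-founded objects that
  can be checked locally.\<close>

inductive built :: "nat \<Rightarrow> nat \<Rightarrow> nat \<Rightarrow> nat \<Rightarrow> cnf \<Rightarrow> bool" for d q where
  empty: "built d q n 0 []"
| point: "c < d \<Longrightarrow> built d q n (tpoint q c) [(0, 1)]"
| sum: "built d q i t x \<Longrightarrow> built d q j u y \<Longrightarrow> i < n \<Longrightarrow> j < n \<Longrightarrow>
    built d q n (tadd q t u) (cadd x y)"
| omega: "built d q i t x \<Longrightarrow> tadd q t t = t \<Longrightarrow> i < n \<Longrightarrow>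
    built d q n (tomega q t) (times_omega x)"

definition buildable :: "nat \<Rightarrow> nat \<Rightarrow> nat \<Rightarrow> cnf \<Rightarrow> bool" where
  "buildable d q t x \<longleftrightarrow> (\<exists>n. built d q n t x)"

lemma buildable_empty: "buildable d q 0 []"
  unfolding buildable_def by (blast intro: built.empty)

lemma buildable_point: "c < d \<Longrightarrow> buildable d q (tpoint q c) [(0, 1)]"
  unfolding buildable_def by (blast intro: built.point)

lemma buildable_sum:
  "buildable d q t x \<Longrightarrow> buildable d q u y \<Longrightarrow> buildable d q (tadd q t u) (cadd x y)"
  unfolding buildable_def
proof (elim exE)
  fix i j assume "built d q i t x" "built d q j u y"
  then show "\<exists>n. built d q n (tadd q t u) (cadd x y)"
    by (intro exI[of _ "Suc (max i j)"] built.sum) auto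
qed

lemma buildable_omega:
  "buildable d q t x \<Longrightarrow> tadd q t t = t \<Longrightarrow> buildable d q (tomega q t) (times_omega x)"
  unfolding buildable_def by (blast intro: built.omega)

lemma built_is_cnf: "built d q n t x \<Longrightarrow> is_cnf x"
  by (induction rule: built.induct) (auto simp: is_cnf_cadd is_cnf_times_omega)

lemma built_in_types: "built d q n t x \<Longrightarrow> t \<in> types d q"
  by (induction rule: built.induct) (auto intro: tpoint_in_types tadd_in_types tomega_in_types)

lemma buildable_is_cnf: "buildable d q t x \<Longrightarrow> is_cnf x"
  and buildable_in_types: "buildable d q t x \<Longrightarrow> t \<in> types d q"
  unfolding buildable_def by (auto intro: built_is_cnf built_in_types)

lemma cadd_less_iff: "is_cnf y \<Longrightarrow> is_cnf z \<Longrightarrow> cadd x y < cadd x z \<longleftrightarrow> y < z"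
  using cadd_strict_mono_right[of z y x] cadd_mono_right[of y z x] by (meson leD leI)

lemma colored_line_cnf: "\<forall>u\<in>X. col u < d \<Longrightarrow> colored_line (<) col (X :: cnf set) d"
  by unfold_locales auto

lemma cmult_separates:
  assumes "is_cnf x" "u \<in> below x" "v \<in> below x" "i < j"
  shows "cadd (cmult x i) u < cadd (cmult x j) v"
proof -
  have "cadd (cmult x i) u < cmult x (Suc i)"
    using assms by (simp add: below_def cadd_strict_mono_right)
  also have "\<dots> \<le> cmult x j" using assms by (intro cmult_mono) auto
  also have "\<dots> \<le> cadd (cmult x j) v" using assms by (intro le_cadd_left) (auto simp: below_def)
  finally show ?thesis .
qed

text \<open>The colored ordinals are realized by sets of normal forms, on which sums and
  \<open>\<omega>\<close>-fold sums become unions of shifted copies.\<close>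

lemma built_realized_below:
  "built d q n t x \<Longrightarrow> \<exists>X col. X \<subseteq> below x \<and> (\<forall>u\<in>X. col u < d) \<and> ty q (<) col X = t"
proof (induction rule: built.induct)
  case (empty n)
  then show ?case by (intro exI[of _ "{}"]) auto
next
  case (point c n)
  interpret colored_line "(<)" "\<lambda>_. c" "{[] :: cnf}" d
    by (rule colored_line_cnf) (use point in auto)
  show ?case
    using point T_point[of "[]" q] by (intro exI[of _ "{[]}"] exI[of _ "\<lambda>_. c"]) auto
next
  case (sum i t x j u y n)
  obtain X c1 where X: "X \<subseteq> below x" "\<forall>u\<in>X. c1 u < d" "ty q (<) c1 X = t"
    using sum.IH(1) by blast
  obtain Y c2 where Y: "Y \<subseteq> below y" "\<forall>u\<in>Y. c2 u < d" "ty q (<) c2 Y = u"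
    using sum.IH(2) by blast
  have x: "is_cnf x" and y: "is_cnf y" using sum.hyps by (auto intro: built_is_cnf)
  have inj: "inj_on (cadd x) Y"
    using Y(1) by (auto simp: inj_on_def below_def cadd_right_inject subset_iff)
  define col where "col u = (if u \<in> X then c1 u else c2 (inv_into Y (cadd x) u))" for u
  have less: "u < cadd x v" if "u \<in> X" "v \<in> Y" for u v
    using that X(1) Y(1) le_cadd_left[of v x] by (auto simp: below_def intro: less_le_trans)
  then have colX: "col u = c1 u" if "u \<in> X" for u using that by (simp add: col_def)
  have colY: "col (cadd x v) = c2 v" if "v \<in> Y" for v
    using that less[of "cadd x v" v] inj by (auto simp: col_def)
  have col: "\<forall>u\<in>X \<union> cadd x ` Y. col u < d" using X(2) Y(2) colX colY by auto
  interpret colored_line "(<)" col "X \<union> cadd x ` Y" d by (rule colored_line_cnf[OF col])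
  have "ty q (<) col X = t" using X(3) ty_cong[of X col c1] colX by simp
  moreover have "ty q (<) col (cadd x ` Y) = u"
    unfolding Y(3)[symmetric] using Y(1) inj colY
    by (intro ty_transport) (auto simp: cadd_less_iff below_def subset_iff)
  moreover have "T q (X \<union> cadd x ` Y) = tadd q (T q X) (T q (cadd x ` Y))"
    by (rule T_add) (use less in auto)
  moreover have "X \<union> cadd x ` Y \<subseteq> below (cadd x y)"
    unfolding below_cadd[OF x y] using X(1) Y(1) by blast
  ultimately show ?case using col by blast
next
  case (omega i t x n)
  obtain X c where X: "X \<subseteq> below x" "\<forall>u\<in>X. c u < d" "ty q (<) c X = t"
    using omega.IH by blast
  have x: "is_cnf x" using omega.hyps by (auto intro: built_is_cnf)
  define Z where "Z i = cadd (cmult x i) ` X" for i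
  define col where "col u = c (SOME v. v \<in> X \<and> (\<exists>i. u = cadd (cmult x i) v))" for u
  have sep: "cadd (cmult x i) u < cadd (cmult x j) v" if "u \<in> X" "v \<in> X" "i < j" for u v i j
    using that X(1) by (intro cmult_separates[OF x]) auto
  have cnf: "is_cnf v" if "v \<in> X" for v using that X(1) by (auto simp: below_def)
  have unique: "u = v" if "u \<in> X" "v \<in> X" "cadd (cmult x i) u = cadd (cmult x j) v" for u v i j
  proof -
    have "i = j"
      using sep[OF that(1,2), of i j] sep[OF that(2,1), of j i] that(3) by (metis less_irrefl linorder_neqE_nat)
    then show ?thesis using that cnf by (simp add: cadd_right_inject)
  qed
  have col: "col (cadd (cmult x i) v) = c v" if "v \<in> X" for v i
  proof -
    have "(SOME w. w \<in> X \<and> (\<exists>j. cadd (cmult x i) v = cadd (cmult x j) w)) = v"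
      by (rule some_equality) (use that unique in blast)+
    then show ?thesis by (simp add: col_def)
  qed
  have col_less: "\<forall>u\<in>(\<Union>i. Z i). col u < d" using X(2) col by (auto simp: Z_def)
  interpret colored_line "(<)" col "\<Union>i. Z i" d by (rule colored_line_cnf[OF col_less])
  have "ty q (<) col (Z i) = t" for i
    unfolding Z_def X(3)[symmetric] using cnf col
    by (intro ty_transport) (auto simp: cadd_less_iff inj_on_def cadd_right_inject)
  then have "T q (\<Union>i. Z i) = tomega q t"
    using omega.hyps by (intro T_omega) (auto simp: Z_def intro: sep)
  moreover have "(\<Union>i. Z i) \<subseteq> below (times_omega x)"
  proof -
    have "cadd (cmult x i) v \<in> below (cmult x (Suc i))" if "v \<in> X" for i v
      using that X(1) is_cnf_cmult[OF x] by (simp add: below_cadd x) blast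
    then show ?thesis unfolding below_times_omega[OF x] Z_def by blast
  qed
  ultimately show ?case using col_less by blast
qed

text \<open>Sets of normal forms are countable and can be copied to any infinite type.\<close>

lemma buildable_realized:
  assumes "infinite (UNIV :: 'a set)" "buildable d q t x"
  shows "\<exists>A :: 'a colored. colored_ordinal d A \<and> otype q A = t \<and> fst A \<le>o cnf_ord x"
proof -
  obtain n where "built d q n t x" using assms(2) by (auto simp: buildable_def)
  from built_realized_below[OF this]
  obtain X col where X: "X \<subseteq> below x" "\<forall>u\<in>X. col u < d" "ty q (<) col X = t"
    by (elim exE conjE)
  have x: "is_cnf x" using assms(2) by (rule buildable_is_cnf)
  obtain f :: "nat \<Rightarrow> 'a" where "inj f" using infinite_countable_subset[OF assms(1)] by blast
  then have "inj (f \<circ> (to_nat :: cnf \<Rightarrow> nat))" by (intro inj_compose) simp_all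
  then obtain h :: "cnf \<Rightarrow> 'a" where h: "inj h" by blast
  define r where "r = {(h u, h v) | u v. u \<in> X \<and> v \<in> X \<and> u \<le> v}"
  define A where "A = (r, \<lambda>i. h ` {u \<in> X. col u = i})"
  have r: "(h u, h v) \<in> r \<longleftrightarrow> u \<in> X \<and> v \<in> X \<and> u \<le> v" for u v
    using h by (auto simp: r_def inj_eq)
  have F: "Field r = h ` X" unfolding Field_def r_def by auto
  have wo: "Well_order r"
  proof (rule Well_order_via_cnf[of _ "inv h"])
    show "inj_on (inv h) (Field r)" using h by (auto simp: F inj_on_def)
  qed (use h X(1) r in \<open>auto simp: F below_def\<close>)
  have A: "colored_ordinal d A"
    using wo X(2) h
    by (auto simp: colored_ordinal_def A_def F disjoint_family_on_def inj_eq)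
  have colr: "color A (h u) = col u" if "u \<in> X" for u
    unfolding color_def A_def using that h by (intro Least_equality) (auto simp: inj_eq)
  have lt: "strict A (h u) (h v) \<longleftrightarrow> u < v" if "u \<in> X" "v \<in> X" for u v
    using that h by (auto simp: strict_def A_def r inj_eq)
  have "ty q (strict A) (color A) (h ` X) = ty q (<) col X"
    by (rule ty_transport) (use h colr lt in \<open>auto intro: inj_on_subset\<close>)
  then have "otype q A = t"
    unfolding otype_def X(3) by (simp add: A_def F)
  moreover have "r \<le>o cnf_ord x"
  proof (rule ordLeq_cnf_ord[OF wo x])
    show "inv h a \<in> below x" if "a \<in> Field r" for a
      using that h X(1) by (auto simp: F)
    show "inv h a < inv h b" if ab: "(a, b) \<in> r" "a \<noteq> b" for a b
    proof -
      obtain u v where "a = h u" "b = h v" "u \<le> v" using ab by (auto simp: r_def)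
      then show ?thesis using h ab(2) by (metis inv_f_f order.not_eq_order_implies_strict)
    qed
  qed
  ultimately show ?thesis using A by (intro exI[of _ A]) (auto simp: A_def)
qed

section \<open>Every colored ordinal lies above a realization of its type\<close>

definition embeds :: "('a \<Rightarrow> 'a \<Rightarrow> bool) \<Rightarrow> cnf \<Rightarrow> 'a set \<Rightarrow> bool" where
  "embeds lt x X \<longleftrightarrow> (\<exists>f. (\<forall>u\<in>below x. f u \<in> X) \<and>
     (\<forall>u\<in>below x. \<forall>v\<in>below x. u < v \<longrightarrow> lt (f u) (f v)))"

lemma embeds_Nil [simp]: "embeds lt [] X"
  by (simp add: embeds_def)

lemma embeds_one: "a \<in> X \<Longrightarrow> embeds lt [(0, 1)] X"
  by (auto simp: embeds_def)

lemma embeds_mono: "embeds lt y X \<Longrightarrow> x \<le> y \<Longrightarrow> X \<subseteq> Y \<Longrightarrow> embeds lt x Y"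
  unfolding embeds_def
proof (elim exE conjE)
  fix f assume *: "x \<le> y" "X \<subseteq> Y" "\<forall>u\<in>below y. f u \<in> X"
    "\<forall>u\<in>below y. \<forall>v\<in>below y. u < v \<longrightarrow> lt (f u) (f v)"
  have "below x \<subseteq> below y" using *(1) by (auto simp: below_def)
  then show "\<exists>f. (\<forall>u\<in>below x. f u \<in> Y) \<and> (\<forall>u\<in>below x. \<forall>v\<in>below x. u < v \<longrightarrow> lt (f u) (f v))"
    using * by (intro exI[of _ f]) blast
qed

lemma embeds_sum:
  assumes "embeds lt x X" "embeds lt y Y" "is_cnf x" "is_cnf y"
    and less: "\<And>a b. a \<in> X \<Longrightarrow> b \<in> Y \<Longrightarrow> lt a b"
  shows "embeds lt (cadd x y) (X \<union> Y)"
proof -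
  obtain f where f: "\<And>u. u \<in> below x \<Longrightarrow> f u \<in> X"
    "\<And>u v. u \<in> below x \<Longrightarrow> v \<in> below x \<Longrightarrow> u < v \<Longrightarrow> lt (f u) (f v)"
    using assms(1) unfolding embeds_def by blast
  obtain g where g: "\<And>u. u \<in> below y \<Longrightarrow> g u \<in> Y"
    "\<And>u v. u \<in> below y \<Longrightarrow> v \<in> below y \<Longrightarrow> u < v \<Longrightarrow> lt (g u) (g v)"
    using assms(2) unfolding embeds_def by blast
  define h where "h u = (if u < x then f u else g (SOME v. v \<in> below y \<and> u = cadd x v))" for u
  have h1: "h u = f u" if "u \<in> below x" for u using that by (simp add: h_def below_def)
  have ge: "x \<le> cadd x v" if "v \<in> below y" for v
    using that by (intro le_cadd_left) (simp add: below_def)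
  have h2: "h (cadd x v) = g v" if "v \<in> below y" for v
  proof -
    have "(SOME w. w \<in> below y \<and> cadd x v = cadd x w) = v"
      by (rule some_equality) (use that in \<open>auto simp: below_def cadd_right_inject\<close>)
    then show ?thesis using ge[OF that] by (simp add: h_def leD)
  qed
  show ?thesis
    unfolding embeds_def below_cadd[OF assms(3,4)]
  proof (intro exI[of _ h] conjI ballI impI)
    show "h u \<in> X \<union> Y" if "u \<in> below x \<union> cadd x ` below y" for u
      using that h1 h2 f(1) g(1) by auto
    fix u v assume u: "u \<in> below x \<union> cadd x ` below y" and v: "v \<in> below x \<union> cadd x ` below y"
      and uv: "u < v"
    show "lt (h u) (h v)"
    proof (cases "u \<in> below x"; cases "v \<in> below x")
      assume "u \<in> below x" "v \<in> below x"
      then show ?thesis using uv by (simp add: h1 f(2))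
    next
      assume "u \<in> below x" "v \<notin> below x"
      then show ?thesis using v h1 h2 f(1) g(1) less by auto
    next
      assume "u \<notin> below x" "v \<in> below x"
      then obtain w where "w \<in> below y" "u = cadd x w" using u by blast
      then have "x \<le> u" using ge by blast
      then show ?thesis using uv \<open>v \<in> below x\<close> by (auto simp: below_def)
    next
      assume "u \<notin> below x" "v \<notin> below x"
      then obtain w z where wz: "w \<in> below y" "u = cadd x w" "z \<in> below y" "v = cadd x z"
        using u v by blast
      then have "w < z" using uv by (simp add: below_def cadd_less_iff)
      then show ?thesis using wz by (simp add: h2 g(2))
    qed
  qed
qed

lemma embeds_omega:
  fixes X :: "nat \<Rightarrow> 'a set"
  assumes "\<And>i. embeds lt x (X i)" and x: "is_cnf x"
    and less: "\<And>i j a b. i < j \<Longrightarrow> a \<in> X i \<Longrightarrow> b \<in> X j \<Longrightarrow> lt a b"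
  shows "embeds lt (times_omega x) (\<Union>i. X i)"
proof -
  obtain f where f: "\<And>i u. u \<in> below x \<Longrightarrow> f i u \<in> X i"
    "\<And>i u v. u \<in> below x \<Longrightarrow> v \<in> below x \<Longrightarrow> u < v \<Longrightarrow> lt (f i u) (f i v)"
    using assms(1) unfolding embeds_def by metis
  have "\<exists>i v. v \<in> below x \<and> u = cadd (cmult x i) v" if u: "u \<in> below (times_omega x)" for u
  proof -
    obtain n where "u \<in> below (cmult x n)" using u unfolding below_times_omega[OF x] by blast
    then show ?thesis
    proof (induction n)
      case (Suc n)
      then show ?case using below_cadd[OF is_cnf_cmult[OF x] x, of n] by auto
    qed simp
  qed
  then obtain i v where iv: "\<And>u. u \<in> below (times_omega x) \<Longrightarrow> v u \<in> below x"
      "\<And>u. u \<in> below (times_omega x) \<Longrightarrow> u = cadd (cmult x (i u)) (v u)"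
    by metis
  have "lt (f (i u) (v u)) (f (i w) (v w))"
    if u: "u \<in> below (times_omega x)" and w: "w \<in> below (times_omega x)" and uw: "u < w" for u w
  proof -
    consider "i u < i w" | "i w < i u" | "i u = i w" by linarith
    then show ?thesis
    proof cases
      case 1
      then show ?thesis using less f(1) iv(1) u w by blast
    next
      case 2
      then have "w < u"
        using cmult_separates[OF x iv(1)[OF w] iv(1)[OF u] 2] iv(2)[OF u] iv(2)[OF w] by simp
      then show ?thesis using uw by simp
    next
      case 3
      have "cadd (cmult x (i u)) (v u) < cadd (cmult x (i u)) (v w)"
        using uw iv(2)[OF u] iv(2)[OF w] 3 by simp
      then have "v u < v w" using iv(1)[OF u] iv(1)[OF w] by (simp add: below_def cadd_less_iff)
      then show ?thesis using f(2) iv(1) u w 3 by simp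
    qed
  qed
  then show ?thesis
    unfolding embeds_def using f(1) iv(1)
    by (intro exI[of _ "\<lambda>u. f (i u) (v u)"]) blast
qed

text \<open>A Lowenheim-Skolem argument for types: close the empty set under witnesses for the splits of
  all intervals. Passing to a subset does not increase the order type, and afterwards all limits have
  cofinality \<open>\<omega>\<close>.\<close>

lemma (in colored_line) countable_subset_same_type:
  "\<exists>Y\<subseteq>S. countable Y \<and> T q Y = T q S"
proof -
  define I where "I u v = {x \<in> S. (\<forall>a\<in>set_option u. lt a x) \<and> (\<forall>b\<in>set_option v. lt x b)}" for u v
  define wit where "wit k u v z = (SOME a. a \<in> I u v \<and> pt k (I u v) a = z)" for k u v z
  define ends where "ends Y = insert None (Some ` Y)" for Y :: "'a set"
  define grow where "grow Y = Y \<union> (S \<inter>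
      (\<lambda>(k, u, v, z). wit k u v z) ` (UNIV \<times> ends Y \<times> ends Y \<times> UNIV))" for Y
  define Y where "Y n = (grow ^^ n) {}" for n
  have Y_Suc: "Y (Suc n) = grow (Y n)" for n by (simp add: Y_def)
  have count: "countable (Y n)" for n
  proof (induction n)
    case 0
    then show ?case by (simp add: Y_def)
  next
    case (Suc n)
    have "countable ((UNIV :: nat set) \<times> ends (Y n) \<times> ends (Y n) \<times> (UNIV :: nat set))"
      using Suc by (intro countable_SIGMA) (auto simp: ends_def)
    then show ?case unfolding Y_Suc grow_def using Suc by simp
  qed
  have sub: "Y n \<subseteq> S" for n
  proof (induction n)
    case 0
    then show ?case by (simp add: Y_def)
  next
    case (Suc n)
    then show ?case unfolding Y_Suc grow_def by blast
  qed
  have "Y n \<subseteq> Y (Suc n)" for n unfolding Y_Suc grow_def by blast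
  then have mono: "Y m \<subseteq> Y n" if "m \<le> n" for m n
    using that by (rule lift_Suc_mono_le)
  let ?Y = "\<Union>n. Y n"
  have ends_mono: "u \<in> ends (Y n)" if "u \<in> ends (Y m)" "m \<le> n" for u m n
    using that mono[OF that(2)] by (auto simp: ends_def)
  have wit_in: "wit k u v z \<in> ?Y" if uv: "u \<in> ends ?Y" "v \<in> ends ?Y" and S: "wit k u v z \<in> S" for k u v z
  proof -
    obtain m n where "u \<in> ends (Y m)" "v \<in> ends (Y n)" using uv by (auto simp: ends_def)
    then have "u \<in> ends (Y (max m n))" "v \<in> ends (Y (max m n))"
      by (auto intro: ends_mono)
    then have "wit k u v z \<in> Y (Suc (max m n))"
      unfolding Y_Suc grow_def using S by (intro UnI2 IntI) (auto intro!: image_eqI[of _ _ "(k, u, v, z)"])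
    then show ?thesis by blast
  qed
  have I_sub: "I u v \<subseteq> S" for u v by (auto simp: I_def)
  have endS: "a \<in> S" if "u \<in> ends ?Y" "a \<in> set_option u" for u a
    using that sub by (auto simp: ends_def)
  have "T k (I u v \<inter> ?Y) = T k (I u v)" if "u \<in> ends ?Y" "v \<in> ends ?Y" for k u v
    using that
  proof (induction k arbitrary: u v)
    case (Suc k)
    have pt_eq: "pt k (I u v \<inter> ?Y) a = pt k (I u v) a" if a: "a \<in> I u v \<inter> ?Y" for a
    proof -
      have aS: "a \<in> S" using a I_sub by blast
      have aY: "Some a \<in> ends ?Y" using a by (auto simp: ends_def)
      have lo: "lt b a" "b \<in> S" if "b \<in> set_option u" for b
        using a that endS[OF Suc.prems(1)] by (auto simp: I_def)
      have hi: "lt a b" "b \<in> S" if "b \<in> set_option v" for b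
        using a that endS[OF Suc.prems(2)] by (auto simp: I_def)
      have L: "{x \<in> I u v. lt x a} = I u (Some a)"
        unfolding I_def using hi trans[OF _ aS] by auto
      have R: "{x \<in> I u v. lt a x} = I (Some a) v"
        unfolding I_def using lo trans[OF _ aS] by auto
      have L': "{x \<in> I u v \<inter> ?Y. lt x a} = I u (Some a) \<inter> ?Y"
        and R': "{x \<in> I u v \<inter> ?Y. lt a x} = I (Some a) v \<inter> ?Y"
        unfolding L[symmetric] R[symmetric] by blast+
      show ?thesis
        unfolding pt_def L R L' R' Suc.IH[OF Suc.prems(1) aY] Suc.IH[OF aY Suc.prems(2)] ..
    qed
    have "pt k (I u v) ` I u v = pt k (I u v \<inter> ?Y) ` (I u v \<inter> ?Y)"
    proof (intro equalityI subsetI)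
      fix z assume "z \<in> pt k (I u v) ` I u v"
      then have "\<exists>a. a \<in> I u v \<and> pt k (I u v) a = z" by blast
      then have w: "wit k u v z \<in> I u v \<and> pt k (I u v) (wit k u v z) = z"
        unfolding wit_def by (rule someI_ex)
      then have "wit k u v z \<in> S" using I_sub[of u v] by blast
      then have w': "wit k u v z \<in> I u v \<inter> ?Y" using w wit_in[OF Suc.prems] by simp
      then have "pt k (I u v \<inter> ?Y) (wit k u v z) = z" using pt_eq w by simp
      then show "z \<in> pt k (I u v \<inter> ?Y) ` (I u v \<inter> ?Y)" by (rule image_eqI[OF sym w'])
    next
      fix z assume "z \<in> pt k (I u v \<inter> ?Y) ` (I u v \<inter> ?Y)"
      then obtain a where a: "a \<in> I u v \<inter> ?Y" "z = pt k (I u v \<inter> ?Y) a" by blast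
      then show "z \<in> pt k (I u v) ` I u v" using pt_eq[OF a(1)] by simp
    qed
    then show ?case
      unfolding T_Suc using Suc.IH[OF Suc.prems] by simp
  qed simp
  then have "T q (I None None \<inter> ?Y) = T q (I None None)" by (simp add: ends_def)
  moreover have "I None None = S" "S \<inter> ?Y = ?Y" using sub by (auto simp: I_def)
  ultimately show ?thesis using sub count by (intro exI[of _ ?Y]) auto
qed

text \<open>The induction step: a set all of whose proper initial segments lie above realizations of
  their types does so, too. A countable set without last element is cut at a cofinal sequence
  that Ramsey's theorem makes homogeneous, so that beyond some point it is an \<open>\<omega>\<close>-fold sum
  of pieces of one idempotent type.\<close>

lemma (in colored_line) embeds_buildable_step:
  assumes Z: "Z \<subseteq> S" "countable Z"
    and IH: "\<And>b Y. b \<in> Z \<Longrightarrow> Y \<subseteq> {x \<in> Z. lt x b} \<Longrightarrow>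
      \<exists>x. buildable d q (T q Y) x \<and> embeds lt x Y"
  shows "\<exists>x. buildable d q (T q Z) x \<and> embeds lt x Z"
proof -
  consider "Z = {}" | m where "m \<in> Z" "\<And>x. x \<in> Z \<Longrightarrow> x \<noteq> m \<Longrightarrow> lt x m"
    | "Z \<noteq> {}" "\<And>m. m \<in> Z \<Longrightarrow> \<exists>x\<in>Z. lt m x"
    using total Z(1) by (metis subsetD)
  then show ?thesis
  proof cases
    case 1
    then show ?thesis using buildable_empty by (intro exI[of _ "[]"]) simp
  next
    case (2 m)
    have m: "m \<in> S" using 2 Z by auto
    obtain x where x: "buildable d q (T q {x \<in> Z. lt x m}) x" "embeds lt x {x \<in> Z. lt x m}"
      using IH[OF 2(1) subset_refl] by blast
    have split: "Z = {x \<in> Z. lt x m} \<union> {m}" using 2 by blast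
    have "T q ({x \<in> Z. lt x m} \<union> {m}) = tadd q (T q {x \<in> Z. lt x m}) (T q {m})"
      by (rule T_add) (use Z m in auto)
    then have "T q Z = tadd q (T q {x \<in> Z. lt x m}) (tpoint q (col m))"
      unfolding split[symmetric] T_point[OF m] .
    then have "buildable d q (T q Z) (cadd x [(0, 1)])"
      using buildable_sum[OF x(1) buildable_point[OF col_less[OF m]]] by simp
    moreover have "embeds lt (cadd x [(0, 1)]) ({x \<in> Z. lt x m} \<union> {m})"
      by (rule embeds_sum[OF x(2) embeds_one]) (use buildable_is_cnf[OF x(1)] in auto)
    ultimately show ?thesis unfolding split[symmetric] by blast
  next
    case 3
    have "\<exists>c\<in>Z. lt a c \<and> lt b c" if ab: "a \<in> Z" "b \<in> Z" for a b
    proof -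
      obtain a' b' where "a' \<in> Z" "lt a a'" "b' \<in> Z" "lt b b'" using 3(2) ab by blast
      moreover have "lt a' b' \<or> a' = b' \<or> lt b' a'" using total Z \<open>a' \<in> Z\<close> \<open>b' \<in> Z\<close> by blast
      moreover have "a \<in> S" "b \<in> S" "a' \<in> S" "b' \<in> S" using Z ab \<open>a' \<in> Z\<close> \<open>b' \<in> Z\<close> by auto
      ultimately show ?thesis using trans by blast
    qed
    then obtain above where above: "\<And>a b. a \<in> Z \<Longrightarrow> b \<in> Z \<Longrightarrow>
        above a b \<in> Z \<and> lt a (above a b) \<and> lt b (above a b)" by metis
    define h where "h = rec_nat (from_nat_into Z 0) (\<lambda>n a. above a (from_nat_into Z n))"
    have enum: "from_nat_into Z n \<in> Z" for n using 3(1) by (rule from_nat_into)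
    have h: "h n \<in> Z" for n by (induction n) (use enum above in \<open>auto simp: h_def\<close>)
    have h_Suc: "lt (h n) (h (Suc n)) \<and> lt (from_nat_into Z n) (h (Suc n))" for n
      using above[OF h enum] by (simp add: h_def)
    have h_less: "lt (h i) (h j)" if "i < j" for i j
      using that
    proof (induction j)
      case (Suc j)
      then show ?case
        using h_Suc[of j] trans[of "h i" "h j" "h (Suc j)"] h Z by (auto simp: less_Suc_eq)
    qed simp
    have h_cofinal: "\<exists>n. lt z (h n)" if "z \<in> Z" for z
      using h_Suc that Z(2) 3(1) by (metis from_nat_into_to_nat_on)
    define seg where "seg a b = {x \<in> Z. (x = a \<or> lt a x) \<and> lt x b}" for a b
    have seg: "seg a b \<subseteq> S" for a b using Z by (auto simp: seg_def)
    \<comment> \<open>The version of Ramsey's theorem used here colors unordered pairs.\<close>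
    define col where "col E = T q (seg (h (Min E)) (h (Max E)))" for E
    have "col E < Suc (Max (types d q))" for E
      unfolding col_def using T_in_types[OF seg] by (simp add: less_Suc_eq_le)
    then obtain N e where N: "infinite N" and hom: "\<forall>i\<in>N. \<forall>j\<in>N. i \<noteq> j \<longrightarrow> col {i, j} = e"
      using Ramsey2[of "UNIV :: nat set" col "Suc (Max (types d q))"] by auto
    define g where "g n = h (enumerate N n)" for n
    have g: "g n \<in> Z" "g n \<in> S" for n using h Z by (auto simp: g_def)
    have g_less: "lt (g i) (g j)" if "i < j" for i j
      unfolding g_def by (rule h_less) (rule enumerate_mono[OF that N])
    have g_seg: "T q (seg (g i) (g j)) = e" if "i < j" for i j
    proof -
      have "enumerate N i < enumerate N j" by (rule enumerate_mono[OF that N])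
      then show ?thesis
        using hom enumerate_in_set[OF N, of i] enumerate_in_set[OF N, of j]
        by (fastforce simp: col_def g_def)
    qed
    have g_cofinal: "\<exists>n. lt z (g n)" if z: "z \<in> Z" for z
    proof -
      obtain n where n: "lt z (h n)" using h_cofinal[OF z] by blast
      have "n \<le> enumerate N n" using N by (rule le_enumerate)
      then have "h n = g n \<or> lt (h n) (g n)" using h_less unfolding g_def by (cases "n = enumerate N n") auto
      then have "lt z (g n)" using n trans[of z "h n" "g n"] z h g Z by auto
      then show ?thesis ..
    qed
    have seg_less: "lt a b" if "a \<in> seg (g i) (g (Suc i))" "b \<in> seg (g j) (g (Suc j))" "i < j" for a b i j
    proof -
      have "g (Suc i) = g j \<or> lt (g (Suc i)) (g j)"
        using that(3) g_less[of "Suc i" j] by (cases "Suc i = j") auto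
      moreover have "a \<in> S" "b \<in> S" using that seg by auto
      moreover have "lt a (g (Suc i))" "b = g j \<or> lt (g j) b" using that by (auto simp: seg_def)
      ultimately show ?thesis using trans g(2) by metis
    qed
    have idem: "tadd q e e = e"
    proof -
      have "seg (g 0) (g 2) = seg (g 0) (g 1) \<union> seg (g 1) (g 2)"
      proof (intro equalityI subsetI)
        fix x assume x: "x \<in> seg (g 0) (g 2)"
        then have "x = g 1 \<or> lt (g 1) x \<or> lt x (g 1)" using total[OF _ g(2)] seg by blast
        then show "x \<in> seg (g 0) (g 1) \<union> seg (g 1) (g 2)" using x by (auto simp: seg_def)
      next
        fix x assume x: "x \<in> seg (g 0) (g 1) \<union> seg (g 1) (g 2)"
        have "x \<in> S" using x seg by blast
        note t = trans[OF \<open>x \<in> S\<close> g(2)[of 1] g(2)[of 2]] trans[OF g(2)[of 0] g(2)[of 1] \<open>x \<in> S\<close>]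
        show "x \<in> seg (g 0) (g 2)"
          using x t g_less[of 0 1] g_less[of 1 2] g(1) by (auto simp: seg_def)
      qed
      moreover have "T q (seg (g 0) (g 1) \<union> seg (g 1) (g 2)) = tadd q (T q (seg (g 0) (g 1))) (T q (seg (g 1) (g 2)))"
        by (rule T_add) (use seg seg_less[of _ 0 _ 1] in \<open>auto simp: numeral_2_eq_2\<close>)
      ultimately show ?thesis using g_seg[of 0 1] g_seg[of 1 2] g_seg[of 0 2] by simp
    qed
    let ?Z0 = "{x \<in> Z. lt x (g 0)}" and ?W = "\<Union>i. seg (g i) (g (Suc i))"
    have decomp: "Z = ?Z0 \<union> ?W"
    proof (intro equalityI subsetI)
      fix x assume x: "x \<in> Z"
      define n where "n = (LEAST n. lt x (g n))"
      have n: "lt x (g n)" unfolding n_def using g_cofinal[OF x] by (rule LeastI_ex)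
      show "x \<in> ?Z0 \<union> ?W"
      proof (cases n)
        case 0
        then show ?thesis using n x by simp
      next
        case (Suc m)
        then have "\<not> lt x (g m)" unfolding n_def using not_less_Least by (metis lessI)
        then have "x = g m \<or> lt (g m) x" using total g x Z by blast
        then have "x \<in> seg (g m) (g (Suc m))" using n x Suc by (simp add: seg_def)
        then show ?thesis by blast
      qed
    qed (auto simp: seg_def)
    have Z0_less: "lt a b" if ab: "a \<in> ?Z0" "b \<in> ?W" for a b
    proof -
      obtain j where "b \<in> seg (g j) (g (Suc j))" using ab(2) by blast
      then have "b \<in> S" "b = g j \<or> lt (g j) b" using seg by (auto simp: seg_def)
      moreover have "g j = g 0 \<or> lt (g 0) (g j)" using g_less by (cases j) auto
      ultimately show ?thesis using ab(1) Z trans[of a "g 0" b] trans[of "g 0" "g j" b] g(2) by auto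
    qed
    have TW: "T q ?W = tomega q e"
    proof (rule T_omega[where X = "\<lambda>i. seg (g i) (g (Suc i))"])
      show "lt a b" if "i < j" "a \<in> seg (g i) (g (Suc i))" "b \<in> seg (g j) (g (Suc j))" for i j a b
        using seg_less[OF that(2,3,1)] .
    qed (rule seg, rule g_seg, rule lessI, rule idem)
    have "T q (?Z0 \<union> ?W) = tadd q (T q ?Z0) (T q ?W)"
      by (rule T_add[OF _ _ Z0_less]) (use Z seg in blast)+
    then have TZ: "T q Z = tadd q (T q ?Z0) (tomega q e)" unfolding TW decomp[symmetric] .
    obtain x0 where x0: "buildable d q (T q ?Z0) x0" "embeds lt x0 ?Z0"
      using IH[OF g(1) subset_refl] by blast
    have "\<exists>x. buildable d q e x \<and> embeds lt x (seg (g i) (g (Suc i)))" for i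
      using IH[OF g(1)[of "Suc i"], of "seg (g i) (g (Suc i))"] g_seg[of i "Suc i"] by (auto simp: seg_def)
    then obtain xs where xs: "\<And>i. buildable d q e (xs i)" "\<And>i. embeds lt (xs i) (seg (g i) (g (Suc i)))"
      by metis
    \<comment> \<open>The pieces all have type \<open>e\<close>, but the induction hypothesis may give them different ordinals.
      The least ordinal built for \<open>e\<close> embeds in each of them.\<close>
    obtain x where x: "is_cnf x" "buildable d q e x" "\<And>y. is_cnf y \<Longrightarrow> buildable d q e y \<Longrightarrow> x \<le> y"
      using cnf_minimal[of "xs 0" "buildable d q e"] xs(1) buildable_is_cnf by metis
    have "embeds lt x (seg (g i) (g (Suc i)))" for i
      using embeds_mono[OF xs(2) x(3)[OF buildable_is_cnf[OF xs(1)] xs(1)] subset_refl] .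
    then have "embeds lt (times_omega x) ?W"
    proof (rule embeds_omega[OF _ x(1)])
      show "lt a b" if "i < j" "a \<in> seg (g i) (g (Suc i))" "b \<in> seg (g j) (g (Suc j))" for i j a b
        using seg_less[OF that(2,3,1)] .
    qed
    then have "embeds lt (cadd x0 (times_omega x)) (?Z0 \<union> ?W)"
      by (rule embeds_sum[OF x0(2) _ buildable_is_cnf[OF x0(1)] is_cnf_times_omega[OF x(1)] Z0_less])
    then have "embeds lt (cadd x0 (times_omega x)) Z"
      unfolding decomp[symmetric] .
    moreover have "buildable d q (T q Z) (cadd x0 (times_omega x))"
      unfolding TZ using buildable_sum[OF x0(1) buildable_omega[OF x(2) idem]] .
    ultimately show ?thesis by blast
  qed
qed

lemma (in colored_line) embeds_buildable:
  assumes wf: "wf {(x, y). x \<in> S \<and> y \<in> S \<and> lt x y}"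
  shows "\<exists>x. buildable d q (T q S) x \<and> embeds lt x S"
proof -
  obtain Y where Y: "Y \<subseteq> S" "countable Y" "T q Y = T q S"
    using countable_subset_same_type by blast
  have bounded: "b \<in> S \<Longrightarrow> \<forall>Z. Z \<subseteq> {x \<in> Y. lt x b} \<longrightarrow> (\<exists>x. buildable d q (T q Z) x \<and> embeds lt x Z)" for b
  proof (induction b rule: wf_induct_rule[OF wf])
    case (1 b)
    show ?case
    proof (intro allI impI)
      fix Z assume Z: "Z \<subseteq> {x \<in> Y. lt x b}"
      show "\<exists>x. buildable d q (T q Z) x \<and> embeds lt x Z"
      proof (rule embeds_buildable_step)
        show "Z \<subseteq> S" "countable Z" using Z Y by (auto intro: countable_subset)
        show "\<exists>x. buildable d q (T q Z') x \<and> embeds lt x Z'"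
          if c: "c \<in> Z" and Z': "Z' \<subseteq> {x \<in> Z. lt x c}" for c Z'
        proof -
          have "c \<in> S" "lt c b" using c Z Y by auto
          moreover have "Z' \<subseteq> {x \<in> Y. lt x c}" using Z Z' by blast
          ultimately show ?thesis using 1 by blast
        qed
      qed
    qed
  qed
  have "\<exists>x. buildable d q (T q Y) x \<and> embeds lt x Y"
  proof (rule embeds_buildable_step[OF Y(1,2)])
    show "\<exists>x. buildable d q (T q Z) x \<and> embeds lt x Z" if "b \<in> Y" "Z \<subseteq> {x \<in> Y. lt x b}" for b Z
      using bounded[of b] that Y by blast
  qed
  then show ?thesis using Y embeds_mono[OF _ order_refl Y(1)] by auto
qed

lemma colored_ordinal_above_buildable:
  assumes A: "colored_ordinal d A"
  shows "\<exists>x. buildable d q (otype q A) x \<and> cnf_ord x \<le>o fst A"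
proof -
  interpret colored_line "strict A" "color A" "Field (fst A)" d
    by (rule colored_line_colored_ordinal[OF A])
  note wo = Well_order_colored_ordinal[OF A]
  have "wf (fst A - Id)" using wo by (simp add: well_order_on_def)
  then have "wf {(x, y). x \<in> Field (fst A) \<and> y \<in> Field (fst A) \<and> strict A x y}"
    by (rule wf_subset) (auto simp: strict_def)
  then obtain x where x: "buildable d q (otype q A) x" and "embeds (strict A) x (Field (fst A))"
    using embeds_buildable[of q] unfolding otype_def by blast
  then obtain f where f: "\<forall>u\<in>below x. f u \<in> Field (fst A)"
    "\<forall>u\<in>below x. \<forall>v\<in>below x. u < v \<longrightarrow> strict A (f u) (f v)"
    unfolding embeds_def by blast
  have "cnf_ord x \<le>o fst A"
    by (rule cnf_ord_ordLeq[OF wo buildable_is_cnf[OF x], of f]) (use f in \<open>auto simp: strict_def\<close>)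
  then show ?thesis using x by blast
qed

section \<open>The value of \<open>g\<^sub>o\<^sub>r\<^sub>d\<close> in terms of types\<close>

text \<open>\<open>x\<close> is the largest of the least ordinals at which the types are realized.\<close>

definition max_min_built :: "nat \<Rightarrow> nat \<Rightarrow> cnf \<Rightarrow> bool" where
  "max_min_built d q x \<longleftrightarrow>
     (\<exists>t. buildable d q t x \<and> (\<forall>y. buildable d q t y \<longrightarrow> x \<le> y)) \<and>
     (\<forall>t y. buildable d q t y \<longrightarrow> (\<exists>z. buildable d q t z \<and> z \<le> x))"

text \<open>A characteristic sentence determines a type, and the colored ordinals of this type have as their
  least order type the least ordinal built for it: it is realized, and it embeds in all of them.\<close>

lemma is_g_ord_max_min_built:
  assumes inf: "infinite (UNIV :: 'a set)" and max: "max_min_built d q x"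
  shows "is_g_ord TYPE('a) d q (cnf_ord x)"
  unfolding is_g_ord_def
proof (intro conjI allI impI ex_characteristic_set)
  fix S assume S: "characteristic_set TYPE('a) d q S"
  obtain t where t: "buildable d q t x" and least: "\<And>y. buildable d q t y \<Longrightarrow> x \<le> y"
    using max unfolding max_min_built_def by blast
  have x: "is_cnf x" using t by (rule buildable_is_cnf)
  have lower: "cnf_ord x \<le>o fst A" if A: "colored_ordinal d A" "otype q A = t" for A :: "'a colored"
  proof -
    obtain y where "buildable d q t y" "cnf_ord y \<le>o fst A"
      using colored_ordinal_above_buildable[OF A(1), of q] A(2) by blast
    then show ?thesis
      using cnf_ord_mono[OF x buildable_is_cnf least] by (blast intro: ordLeq_transitive)
  qed
  obtain A :: "'a colored" where A: "colored_ordinal d A" "otype q A = t" "fst A \<le>o cnf_ord x"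
    using buildable_realized[OF inf t] by blast
  obtain \<sigma> where \<sigma>: "\<sigma> \<in> S" "characteristic d q A \<sigma>"
    using S A(1) unfolding characteristic_set_def by blast
  have models: "models B \<sigma> \<longleftrightarrow> otype q B = t" if "colored_ordinal d B" for B :: "'a colored"
    using \<sigma>(2) that unfolding characteristic_iff[OF A(1)] A(2) by blast
  have "fst A =o cnf_ord x" using A lower ordIso_iff_ordLeq by blast
  then have "min_otp TYPE('a) d \<sigma> (cnf_ord x)"
    unfolding min_otp_def using A lower models by blast
  moreover have "r \<le>o cnf_ord x" if \<tau>: "\<tau> \<in> S" and r: "min_otp TYPE('a) d \<tau> r" for \<tau> and r :: "'a rel"
  proof -
    obtain B :: "'a colored" where B: "colored_ordinal d B" "characteristic d q B \<tau>"
      using S \<tau> unfolding characteristic_set_def by blast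
    obtain y where "buildable d q (otype q B) y"
      using colored_ordinal_above_buildable[OF B(1)] by blast
    then obtain z where z: "buildable d q (otype q B) z" "z \<le> x"
      using max unfolding max_min_built_def by blast
    obtain C :: "'a colored" where C: "colored_ordinal d C" "otype q C = otype q B" "fst C \<le>o cnf_ord z"
      using buildable_realized[OF inf z(1)] by blast
    have "models C \<tau>" using B C(1,2) characteristic_iff[OF B(1)] by blast
    then have "r \<le>o fst C" using r C(1) unfolding min_otp_def by blast
    also note C(3)
    also have "cnf_ord z \<le>o cnf_ord x" using cnf_ord_mono[OF buildable_is_cnf[OF z(1)] x z(2)] .
    finally show ?thesis .
  qed
  ultimately show "max_min_otp TYPE('a) d S (cnf_ord x)"
    unfolding max_min_otp_def using \<sigma>(1) by blast
qed

section \<open>Bounded formulas are decidable by programs\<close>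

definition recursive :: "nat \<Rightarrow> (nat list \<Rightarrow> nat) \<Rightarrow> bool" where
  "recursive n f \<longleftrightarrow> (\<exists>e. \<forall>xs. length xs = n \<longrightarrow> computes e xs (f xs))"

lemma recursive_cong: "recursive n f \<Longrightarrow> (\<And>xs. length xs = n \<Longrightarrow> f xs = g xs) \<Longrightarrow> recursive n g"
  by (auto simp: recursive_def)

lemma recursive_proj: "i < n \<Longrightarrow> recursive n (\<lambda>xs. xs ! i)"
  unfolding recursive_def by (auto intro: computes.Proj)

lemma recursive_compose:
  assumes f: "recursive (length gs) f" and gs: "\<And>g. g \<in> set gs \<Longrightarrow> recursive n g"
  shows "recursive n (\<lambda>xs. f (map (\<lambda>g. g xs) gs))"
proof -
  obtain e where e: "\<And>xs. length xs = length gs \<Longrightarrow> computes e xs (f xs)"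
    using f by (auto simp: recursive_def)
  obtain p where p: "\<And>g xs. g \<in> set gs \<Longrightarrow> length xs = n \<Longrightarrow> computes (p g) xs (g xs)"
    using gs unfolding recursive_def by metis
  have "computes (Comp e (map p gs)) xs (f (map (\<lambda>g. g xs) gs))" if "length xs = n" for xs
  proof (rule computes.Comp)
    show "list_all2 (\<lambda>g y. computes g xs y) (map p gs) (map (\<lambda>g. g xs) gs)"
      using p that by (auto simp: list_all2_conv_all_nth)
  qed (simp add: e)
  then show ?thesis unfolding recursive_def by blast
qed

lemma recursive_zero: "recursive n (\<lambda>xs. 0)"
  unfolding recursive_def by (auto intro: computes.Zero)

lemma recursive_Suc: "recursive n f \<Longrightarrow> recursive n (\<lambda>xs. Suc (f xs))"
proof -
  assume f: "recursive n f"
  have "recursive 1 (\<lambda>xs. Suc (hd xs))"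
    unfolding recursive_def
    by (intro exI[of _ Succ]) (auto simp: length_Suc_conv intro: computes.Succ)
  then show ?thesis using recursive_compose[of "[f]" "\<lambda>xs. Suc (hd xs)" n] f by simp
qed

lemma recursive_const: "recursive n (\<lambda>xs. k)"
  by (induction k) (auto intro: recursive_zero recursive_Suc)

lemma recursive_primrec:
  assumes f: "recursive n f" and g: "recursive (Suc (Suc n)) g"
  shows "recursive (Suc n) (\<lambda>xs. rec_nat (f (tl xs)) (\<lambda>k y. g (k # y # tl xs)) (hd xs))"
proof -
  obtain p where p: "\<And>xs. length xs = n \<Longrightarrow> computes p xs (f xs)"
    using f by (auto simp: recursive_def)
  obtain e where e: "\<And>xs. length xs = Suc (Suc n) \<Longrightarrow> computes e xs (g xs)"
    using g by (auto simp: recursive_def)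
  have "computes (PrimRec p e) (k # xs) (rec_nat (f xs) (\<lambda>k y. g (k # y # xs)) k)"
    if "length xs = n" for k xs
  proof (induction k)
    case 0
    then show ?case using p that by (auto intro: computes.PrimRec_0)
  next
    case (Suc k)
    then show ?case using e that by (auto intro: computes.PrimRec_Suc)
  qed
  then show ?thesis
    unfolding recursive_def by (intro exI[of _ "PrimRec p e"]) (auto simp: length_Suc_conv)
qed

lemma recursive_Least:
  assumes f: "recursive (Suc n) f" and ex: "\<And>xs. length xs = n \<Longrightarrow> \<exists>k. f (k # xs) = 0"
  shows "recursive n (\<lambda>xs. LEAST k. f (k # xs) = 0)"
proof -
  obtain e where e: "\<And>xs. length xs = Suc n \<Longrightarrow> computes e xs (f xs)"
    using f by (auto simp: recursive_def)
  have "computes (Mu e) xs (LEAST k. f (k # xs) = 0)" if xs: "length xs = n" for xs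
  proof (rule computes.Mu)
    show "computes e ((LEAST k. f (k # xs) = 0) # xs) 0"
      using e[of "(LEAST k. f (k # xs) = 0) # xs"] LeastI_ex[OF ex[OF xs]] xs by simp
    show "\<forall>m<(LEAST k. f (k # xs) = 0). \<exists>y. computes e (m # xs) (Suc y)"
    proof (intro allI impI)
      fix m assume "m < (LEAST k. f (k # xs) = 0)"
      then have "f (m # xs) \<noteq> 0" by (rule not_less_Least)
      then obtain y where "f (m # xs) = Suc y" by (cases "f (m # xs)") auto
      then show "\<exists>y. computes e (m # xs) (Suc y)" using e[of "m # xs"] xs by auto
    qed
  qed
  then show ?thesis unfolding recursive_def by blast
qed

definition recursive2 :: "(nat \<Rightarrow> nat \<Rightarrow> nat) \<Rightarrow> bool" where
  "recursive2 F \<longleftrightarrow> recursive 2 (\<lambda>xs. F (xs ! 0) (xs ! 1))"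

lemma recursive2_apply:
  "recursive2 F \<Longrightarrow> recursive n f \<Longrightarrow> recursive n g \<Longrightarrow> recursive n (\<lambda>xs. F (f xs) (g xs))"
  using recursive_compose[of "[f, g]" "\<lambda>xs. F (xs ! 0) (xs ! 1)" n]
  by (auto simp: recursive2_def numeral_2_eq_2)

lemma recursive2_first:
  "recursive2 (\<lambda>k x. F k) \<Longrightarrow> recursive n f \<Longrightarrow> recursive n (\<lambda>xs. F (f xs))"
  using recursive2_apply[of "\<lambda>k x. F k" n f "\<lambda>_. 0"] recursive_zero by simp

lemma recursive2_swap: "recursive2 F \<Longrightarrow> recursive2 (\<lambda>x y. F y x)"
  using recursive2_apply[of F 2 "\<lambda>xs. xs ! 1" "\<lambda>xs. xs ! 0"] recursive_proj[of 1 2] recursive_proj[of 0 2]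
  by (simp add: recursive2_def[of "\<lambda>x y. F y x"])

lemma recursive2_primrec:
  assumes f: "recursive 1 (\<lambda>xs. f (xs ! 0))" and g: "recursive 3 (\<lambda>xs. g (xs ! 0) (xs ! 1) (xs ! 2))"
    and F: "\<And>x. F 0 x = f x" "\<And>k x. F (Suc k) x = g k (F k x) x"
  shows "recursive2 F"
proof -
  have F': "F k x = rec_nat (f x) (\<lambda>k y. g k y x) k" for k x
    by (induction k) (auto simp: F)
  have "recursive (Suc 1) (\<lambda>xs. rec_nat (f (tl xs ! 0))
      (\<lambda>k y. g ((k # y # tl xs) ! 0) ((k # y # tl xs) ! 1) ((k # y # tl xs) ! 2)) (hd xs))"
    by (rule recursive_primrec) (use f g in \<open>simp_all add: numeral_3_eq_3\<close>)
  then have "recursive (Suc 1) (\<lambda>xs. F (xs ! 0) (xs ! 1))"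
    by (rule recursive_cong) (auto simp: F' length_Suc_conv)
  then show ?thesis by (simp add: recursive2_def numeral_2_eq_2)
qed

lemma recursive2_add: "recursive2 (+)"
  by (rule recursive2_primrec[where f = "\<lambda>x. x" and g = "\<lambda>k y x. Suc y"])
    (auto intro!: recursive_proj recursive_Suc)

lemma recursive2_pred: "recursive2 (\<lambda>k x. k - 1)"
  by (rule recursive2_primrec[where f = "\<lambda>x. 0" and g = "\<lambda>k y x. k"])
    (auto intro!: recursive_proj recursive_zero)

lemma recursive2_diff: "recursive2 (-)"
proof -
  have "recursive 3 (\<lambda>xs. xs ! 1 - 1)"
    by (intro recursive2_first[OF recursive2_pred] recursive_proj) simp
  then have "recursive2 (\<lambda>k x. x - k)"
    by (intro recursive2_primrec[where f = "\<lambda>x. x" and g = "\<lambda>k y x. y - 1"])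
      (auto intro!: recursive_proj)
  then show ?thesis by (rule recursive2_swap)
qed

lemma recursive2_triangle: "recursive2 (\<lambda>k x. triangle k)"
  by (rule recursive2_primrec[where f = "\<lambda>x. 0" and g = "\<lambda>k y x. y + Suc k"])
    (auto intro!: recursive2_apply[OF recursive2_add] recursive_proj recursive_zero recursive_Suc
      simp del: add_Suc_right)

lemma recursive2_prod_encode: "recursive2 (\<lambda>x y. prod_encode (x, y))"
proof -
  have "recursive2 (\<lambda>x y. triangle (x + y) + x)"
    unfolding recursive2_def
    by (intro recursive2_apply[OF recursive2_add] recursive2_first[OF recursive2_triangle] recursive_proj)
      simp_all
  then show ?thesis by (simp add: prod_encode_def)
qed

lemma recursive2_mod2: "recursive2 (\<lambda>k x. k mod 2)"
  by (rule recursive2_primrec[where f = "\<lambda>x. 0" and g = "\<lambda>k y x. 1 - y"])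
    (auto intro!: recursive2_apply[OF recursive2_diff] recursive_proj recursive_const simp: mod_Suc)

lemma recursive2_div2: "recursive2 (\<lambda>k x. k div 2)"
proof (rule recursive2_primrec[where f = "\<lambda>x. 0" and g = "\<lambda>k y x. y + k mod 2"])
  show "recursive 3 (\<lambda>xs. xs ! 1 + xs ! 0 mod 2)"
    by (intro recursive2_apply[OF recursive2_add] recursive2_first[OF recursive2_mod2] recursive_proj)
      simp_all
  show "Suc k div 2 = k div 2 + k mod 2" for k :: nat by presburger
qed (auto intro: recursive_zero)

lemma recursive2_shift: "recursive2 (\<lambda>k w. w div 2 ^ k)"
proof (rule recursive2_primrec[where f = "\<lambda>x. x" and g = "\<lambda>k y x. y div 2"])
  show "recursive 3 (\<lambda>xs. xs ! 1 div 2)"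
    by (intro recursive2_first[OF recursive2_div2] recursive_proj) simp
  show "w div 2 ^ Suc k = w div 2 ^ k div 2" for w k :: nat
    unfolding power_Suc2 by (rule div_mult2_eq)
qed (auto intro: recursive_proj)

lemma recursive2_mem: "recursive2 (\<lambda>k w. of_bool (k \<in> set_decode w))"
proof -
  have "recursive2 (\<lambda>k w. (w div 2 ^ k) mod 2)"
    unfolding recursive2_def
    by (intro recursive2_first[OF recursive2_mod2] recursive2_apply[OF recursive2_shift] recursive_proj)
      simp_all
  moreover have "(w div 2 ^ k) mod 2 = of_bool (k \<in> set_decode w)" for k w :: nat
    by (simp add: set_decode_def mod2_eq_if)
  ultimately show ?thesis by simp
qed

lemma recursive2_less: "recursive2 (\<lambda>x y. of_bool (x < y))"
proof -
  have "recursive2 (\<lambda>x y. 1 - (1 - (y - x)))"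
    unfolding recursive2_def
    by (intro recursive2_apply[OF recursive2_diff] recursive_proj recursive_const) auto
  moreover have "(\<lambda>x y :: nat. 1 - (1 - (y - x))) = (\<lambda>x y. of_bool (x < y))" by (auto simp: fun_eq_iff)
  ultimately show ?thesis by simp
qed

lemma recursive2_eq: "recursive2 (\<lambda>x y. of_bool (x = y))"
proof -
  have "recursive2 (\<lambda>x y. 1 - ((x - y) + (y - x)))"
    unfolding recursive2_def
    by (intro recursive2_apply[OF recursive2_diff] recursive2_apply[OF recursive2_add]
        recursive_proj recursive_const) auto
  moreover have "(\<lambda>x y :: nat. 1 - ((x - y) + (y - x))) = (\<lambda>x y. of_bool (x = y))"
    by (auto simp: fun_eq_iff)
  ultimately show ?thesis by simp
qed

text \<open>Bounded search is primitive recursion on the bound. Truth values are the numbers \<open>0\<close> and \<open>1\<close>,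
  and truncated subtraction expresses the disjunction of \<open>a\<close> and \<open>b\<close> as \<open>1 - (1 - (a + b))\<close>.\<close>

lemma recursive_bounded_ex:
  assumes P: "recursive (Suc n) (\<lambda>xs. of_bool (P (hd xs) (tl xs)))" and x: "x < n"
  shows "recursive (Suc n) (\<lambda>xs. of_bool (\<exists>a<hd xs. P (hd xs) ((tl xs)[x := a])))"
proof -
  let ?P = "\<lambda>xs :: nat list. of_bool (P (hd xs) (tl xs)) :: nat"
  define gs :: "(nat list \<Rightarrow> nat) list" where "gs = (\<lambda>zs. zs ! 2) # map (\<lambda>i zs. if i = x then zs ! 0 else zs ! (3 + i)) [0..<n]"
  have gs: "map (\<lambda>g. g (a # y # B # ys)) gs = B # ys[x := a]" if "length ys = n" for a y B :: nat and ys
    using that by (auto simp: gs_def nth_list_update intro!: nth_equalityI)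
  have rec: "recursive (3 + n) (\<lambda>zs. if i = x then zs ! 0 else zs ! (3 + i))" if "i < n" for i
    using that by (cases "i = x") (auto intro: recursive_proj)
  have "recursive (3 + n) (\<lambda>zs. ?P (map (\<lambda>g. g zs) gs))"
    by (rule recursive_compose) (use P rec in \<open>auto simp: gs_def intro: recursive_proj\<close>)
  then have step: "recursive (Suc (Suc (Suc n))) (\<lambda>zs. 1 - (1 - (zs ! 1 + ?P (map (\<lambda>g. g zs) gs))))"
    by (intro recursive2_apply[OF recursive2_diff] recursive2_apply[OF recursive2_add]
        recursive_proj recursive_const) (auto simp: numeral_3_eq_3)
  have rec_eq: "rec_nat 0 (\<lambda>k y. 1 - (1 - ((k # y # B # ys) ! 1 + ?P (map (\<lambda>g. g (k # y # B # ys)) gs)))) m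
      = of_bool (\<exists>a<m. P B (ys[x := a]))" if "length ys = n" for m B ys
    by (induction m) (use that in \<open>auto simp: gs less_Suc_eq\<close>)
  have R: "recursive (Suc (Suc n)) (\<lambda>zs. rec_nat 0
      (\<lambda>k y. 1 - (1 - ((k # y # tl zs) ! 1 + ?P (map (\<lambda>g. g (k # y # tl zs)) gs)))) (hd zs))"
    by (rule recursive_primrec[OF recursive_zero step])
  define hs :: "(nat list \<Rightarrow> nat) list" where "hs = (\<lambda>xs. xs ! 0) # map (\<lambda>i xs. xs ! i) [0..<Suc n]"
  have hs: "map (\<lambda>g. g (B # ys)) hs = B # B # ys" if "length ys = n" for B :: nat and ys
    using that unfolding hs_def by (auto intro!: nth_equalityI simp del: upt_Suc)
  have len: "length hs = Suc (Suc n)" by (simp add: hs_def)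
  have "recursive (Suc n) g" if "g \<in> set hs" for g
    using that by (auto simp: hs_def intro: recursive_proj simp del: upt_Suc)
  from recursive_compose[OF R[folded len] this] show ?thesis
  proof (rule recursive_cong)
    fix xs :: "nat list" assume "length xs = Suc n"
    then obtain B ys where xs: "xs = B # ys" and ys: "length ys = n" by (auto simp: length_Suc_conv)
    show "rec_nat 0 (\<lambda>k y. 1 - (1 - ((k # y # tl (map (\<lambda>g. g xs) hs)) ! 1 +
          ?P (map (\<lambda>g. g (k # y # tl (map (\<lambda>g. g xs) hs))) gs)))) (hd (map (\<lambda>g. g xs) hs)) =
        of_bool (\<exists>a<hd xs. P (hd xs) ((tl xs)[x := a]))"
      unfolding xs hs[OF ys] list.sel by (rule rec_eq[OF ys])
  qed
qed

text \<open>All quantifiers of a formula range over the numbers below one common bound \<open>B\<close>, which is a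
  parameter of the semantics, so that a program can search for a bound at which the formula holds.
  A number also codes the finite set of the positions of its binary digits \<open>1\<close>.\<close>

datatype bterm =
    bVar nat
  | bConst nat
  | bSuc bterm
  | bPlus bterm bterm
  | bPair bterm bterm

datatype bfm =
    bEq bterm bterm
  | bLt bterm bterm
  | bMem bterm bterm
  | bNot bfm
  | bAnd bfm bfm
  | bEx nat bfm

fun bval :: "(nat \<Rightarrow> nat) \<Rightarrow> bterm \<Rightarrow> nat" where
  "bval s (bVar i) = s i"
| "bval s (bConst k) = k"
| "bval s (bSuc t) = Suc (bval s t)"
| "bval s (bPlus t u) = bval s t + bval s u"
| "bval s (bPair t u) = prod_encode (bval s t, bval s u)"

fun holds :: "nat \<Rightarrow> (nat \<Rightarrow> nat) \<Rightarrow> bfm \<Rightarrow> bool" where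
  "holds B s (bEq t u) \<longleftrightarrow> bval s t = bval s u"
| "holds B s (bLt t u) \<longleftrightarrow> bval s t < bval s u"
| "holds B s (bMem t u) \<longleftrightarrow> bval s t \<in> set_decode (bval s u)"
| "holds B s (bNot \<phi>) \<longleftrightarrow> \<not> holds B s \<phi>"
| "holds B s (bAnd \<phi> \<psi>) \<longleftrightarrow> holds B s \<phi> \<and> holds B s \<psi>"
| "holds B s (bEx x \<phi>) \<longleftrightarrow> (\<exists>a<B. holds B (s(x := a)) \<phi>)"

fun tvars :: "bterm \<Rightarrow> nat set" where
  "tvars (bVar i) = {i}"
| "tvars (bConst k) = {}"
| "tvars (bSuc t) = tvars t"
| "tvars (bPlus t u) = tvars t \<union> tvars u"
| "tvars (bPair t u) = tvars t \<union> tvars u"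

fun bvars :: "bfm \<Rightarrow> nat set" where
  "bvars (bEq t u) = tvars t \<union> tvars u"
| "bvars (bLt t u) = tvars t \<union> tvars u"
| "bvars (bMem t u) = tvars t \<union> tvars u"
| "bvars (bNot \<phi>) = bvars \<phi>"
| "bvars (bAnd \<phi> \<psi>) = bvars \<phi> \<union> bvars \<psi>"
| "bvars (bEx x \<phi>) = insert x (bvars \<phi>)"

lemma recursive_bval: "tvars t \<subseteq> {..<n} \<Longrightarrow> recursive (Suc n) (\<lambda>xs. bval (\<lambda>i. tl xs ! i) t)"
proof (induction t)
  case (bVar i)
  then have "recursive (Suc n) (\<lambda>xs. xs ! Suc i)" by (intro recursive_proj) simp
  then show ?case by (rule recursive_cong) (use bVar in \<open>auto simp: nth_tl\<close>)
next
  case (bPlus t u)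
  then show ?case by (auto intro: recursive2_apply[OF recursive2_add])
next
  case (bPair t u)
  then show ?case by (auto intro: recursive2_apply[OF recursive2_prod_encode])
qed (auto intro: recursive_const recursive_Suc)

lemma recursive_holds:
  "bvars \<phi> \<subseteq> {..<n} \<Longrightarrow> recursive (Suc n) (\<lambda>xs. of_bool (holds (hd xs) (\<lambda>i. tl xs ! i) \<phi>))"
proof (induction \<phi>)
  case (bEq t u)
  then show ?case by (auto intro!: recursive2_apply[OF recursive2_eq] recursive_bval)
next
  case (bLt t u)
  then show ?case by (auto intro!: recursive2_apply[OF recursive2_less] recursive_bval)
next
  case (bMem t u)
  then show ?case by (auto intro!: recursive2_apply[OF recursive2_mem] recursive_bval)
next
  case (bNot \<phi>)
  then have "recursive (Suc n) (\<lambda>xs. 1 - of_bool (holds (hd xs) (\<lambda>i. tl xs ! i) \<phi>))"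
    by (intro recursive2_apply[OF recursive2_diff] recursive_const) auto
  then show ?case by (rule recursive_cong) auto
next
  case (bAnd \<phi> \<psi>)
  then have "recursive (Suc n) (\<lambda>xs. of_bool (holds (hd xs) (\<lambda>i. tl xs ! i) \<phi>) +
      of_bool (holds (hd xs) (\<lambda>i. tl xs ! i) \<psi>) - 1)"
    by (intro recursive2_apply[OF recursive2_diff] recursive2_apply[OF recursive2_add] recursive_const) auto
  then show ?case by (rule recursive_cong) auto
next
  case (bEx x \<phi>)
  then have "recursive (Suc n) (\<lambda>xs. of_bool (\<exists>a<hd xs. holds (hd xs) (\<lambda>i. (tl xs)[x := a] ! i) \<phi>))"
    by (intro recursive_bounded_ex[where P = "\<lambda>B ys. holds B (\<lambda>i. ys ! i) \<phi>"]) auto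
  then show ?case
  proof (rule recursive_cong)
    fix xs :: "nat list" assume "length xs = Suc n"
    then have "(\<lambda>i. (tl xs)[x := a] ! i) = (\<lambda>i. tl xs ! i)(x := a)" for a
      using bEx.prems by (auto simp: fun_eq_iff)
    then show "of_bool (\<exists>a<hd xs. holds (hd xs) (\<lambda>i. (tl xs)[x := a] ! i) \<phi>) =
        of_bool (holds (hd xs) (\<lambda>i. tl xs ! i) (bEx x \<phi>))"
      unfolding holds.simps by (simp only:)
  qed
qed

text \<open>The inputs are the values of the variables \<open>1\<close> and \<open>2\<close>, the output is the value of variable \<open>0\<close>,
  and the zeros are placeholders for the quantified variables. One minimization finds a bound below
  which an output exists. Only for this bound is the second minimization, which finds the output,
  known to terminate; therefore the first one is a part of the program to which it is applied.\<close>

lemma search_program: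
  assumes vars: "bvars \<phi> \<subseteq> {..<m + 3}"
    and ex: "\<And>d q. \<exists>B out. out < B \<and> holds B (\<lambda>i. (out # d # q # replicate m 0) ! i) \<phi>"
  shows "\<exists>e. \<forall>d q. \<exists>B out. computes e [d, q] out \<and>
    holds B (\<lambda>i. (out # d # q # replicate m 0) ! i) \<phi>"
proof -
  let ?env = "\<lambda>out d q. out # d # q # replicate m (0 :: nat)"
  define chk :: "nat list \<Rightarrow> nat" where "chk xs = of_bool (holds (hd xs) (\<lambda>i. tl xs ! i) \<phi>)" for xs
  have dec: "recursive (Suc (Suc (Suc (Suc m)))) chk"
    using recursive_holds[OF vars] by (simp add: chk_def[abs_def] numeral_3_eq_3)
  have compose: "recursive k (\<lambda>xs. 1 - chk (f xs # g xs # d xs # q xs # replicate m 0))"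
    if "recursive k f" "recursive k g" "recursive k d" "recursive k q" for k f g d q
  proof -
    have "recursive k (\<lambda>xs. chk (map (\<lambda>g. g xs) (f # g # d # q # replicate m (\<lambda>_. 0))))"
      by (rule recursive_compose) (use dec that recursive_zero in auto)
    then have "recursive k (\<lambda>xs. chk (f xs # g xs # d xs # q xs # replicate m 0))"
      by (rule recursive_cong) simp
    then show ?thesis by (intro recursive2_apply[OF recursive2_diff] recursive_const)
  qed
  have vars': "bvars (bEx 0 \<phi>) \<subseteq> {..<m + 3}" using vars by auto
  define chk' :: "nat list \<Rightarrow> nat" where "chk' xs = of_bool (holds (hd xs) (\<lambda>i. tl xs ! i) (bEx 0 \<phi>))" for xs
  have dec': "recursive (Suc (Suc (Suc (Suc m)))) chk'"
    using recursive_holds[OF vars'] by (simp add: chk'_def[abs_def] numeral_3_eq_3)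
  have "recursive 3 (\<lambda>xs. chk' (map (\<lambda>g. g xs) ((\<lambda>xs. xs ! 0) # (\<lambda>_. 0) # (\<lambda>xs. xs ! 1) # (\<lambda>xs. xs ! 2) #
      replicate m (\<lambda>_. 0))))"
    by (rule recursive_compose) (use dec' in \<open>auto intro: recursive_proj recursive_zero\<close>)
  then have "recursive (Suc 2) (\<lambda>xs. 1 - chk' ((xs ! 0) # 0 # (xs ! 1) # (xs ! 2) # replicate m 0))"
    by (intro recursive2_apply[OF recursive2_diff] recursive_const) (simp add: numeral_3_eq_3 numeral_2_eq_2)
  then have bound: "recursive 2 (\<lambda>xs. LEAST B. 1 - chk' (((B # xs) ! 0) # 0 # ((B # xs) ! 1) # ((B # xs) ! 2) # replicate m 0) = 0)"
  proof (rule recursive_Least)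
    fix xs :: "nat list" assume "length xs = 2"
    then obtain d q where xs: "xs = [d, q]" by (auto simp: numeral_2_eq_2 length_Suc_conv)
    obtain B out where *: "out < B" "holds B (\<lambda>i. ?env out d q ! i) \<phi>" using ex by blast
    have "(\<lambda>i. ?env 0 d q ! i)(0 := out) = (\<lambda>i. ?env out d q ! i)" by (auto simp: fun_eq_iff nth_Cons')
    then have "holds B (\<lambda>i. ?env 0 d q ! i) (bEx 0 \<phi>)" using * by auto
    then show "\<exists>B. 1 - chk' (((B # xs) ! 0) # 0 # ((B # xs) ! 1) # ((B # xs) ! 2) # replicate m 0) = 0"
      by (intro exI[of _ B]) (simp add: chk'_def xs)
  qed
  define bnd where "bnd d q = (LEAST B. holds B (\<lambda>i. ?env 0 d q ! i) (bEx 0 \<phi>))" for d q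
  have bound: "recursive2 bnd"
    unfolding recursive2_def
    by (rule recursive_cong[OF bound]) (simp add: chk'_def bnd_def)
  have ex_out: "\<exists>out. holds (bnd d q) (\<lambda>i. ?env out d q ! i) \<phi>" for d q
  proof -
    obtain B out where *: "out < B" "holds B (\<lambda>i. ?env out d q ! i) \<phi>" using ex by blast
    have upd: "(\<lambda>i. ?env 0 d q ! i)(0 := out) = (\<lambda>i. ?env out d q ! i)" for out
      by (auto simp: fun_eq_iff nth_Cons')
    then have "holds B (\<lambda>i. ?env 0 d q ! i) (bEx 0 \<phi>)" using * by auto
    then have "holds (bnd d q) (\<lambda>i. ?env 0 d q ! i) (bEx 0 \<phi>)"
      unfolding bnd_def by (rule LeastI)
    then show ?thesis using upd by auto
  qed
  have "recursive 3 (\<lambda>xs. bnd (xs ! 1) (xs ! 2))"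
    by (rule recursive2_apply[OF bound]) (auto intro: recursive_proj)
  then have "recursive 3 (\<lambda>xs. 1 - chk (bnd (xs ! 1) (xs ! 2) # xs ! 0 # xs ! 1 # xs ! 2 # replicate m 0))"
    by (intro compose) (auto intro: recursive_proj)
  then have "recursive (Suc 2) (\<lambda>xs. 1 - chk (bnd (xs ! 1) (xs ! 2) # xs ! 0 # xs ! 1 # xs ! 2 # replicate m 0))"
    by (simp add: numeral_3_eq_3 numeral_2_eq_2)
  then have "recursive 2 (\<lambda>xs. LEAST out. 1 - chk (bnd ((out # xs) ! 1) ((out # xs) ! 2) #
      (out # xs) ! 0 # (out # xs) ! 1 # (out # xs) ! 2 # replicate m 0) = 0)"
  proof (rule recursive_Least)
    fix xs :: "nat list" assume "length xs = 2"
    then obtain d q where xs: "xs = [d, q]" by (auto simp: numeral_2_eq_2 length_Suc_conv)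
    show "\<exists>out. 1 - chk (bnd ((out # xs) ! 1) ((out # xs) ! 2) #
      (out # xs) ! 0 # (out # xs) ! 1 # (out # xs) ! 2 # replicate m 0) = 0"
      using ex_out[of d q] by (auto simp: chk_def xs)
  qed
  then obtain e where e: "\<And>xs. length xs = 2 \<Longrightarrow> computes e xs (LEAST out. 1 - chk (bnd ((out # xs) ! 1) ((out # xs) ! 2) #
      (out # xs) ! 0 # (out # xs) ! 1 # (out # xs) ! 2 # replicate m 0) = 0)"
    unfolding recursive_def by blast
  have "computes e [d, q] (LEAST out. holds (bnd d q) (\<lambda>i. ?env out d q ! i) \<phi>)" for d q
    using e[of "[d, q]"] by (simp add: chk_def Suc_le_eq)
  moreover have "holds (bnd d q) (\<lambda>i. ?env (LEAST out. holds (bnd d q) (\<lambda>i. ?env out d q ! i) \<phi>) d q ! i) \<phi>" for d q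
    using ex_out by (rule LeastI_ex)
  ultimately show ?thesis by blast
qed

section \<open>Certificates\<close>

fun tuple :: "nat list \<Rightarrow> nat" where
  "tuple [] = 0"
| "tuple [x] = x"
| "tuple (x # y # xs) = prod_encode (x, tuple (y # xs))"

definition code_cons :: "nat \<Rightarrow> nat \<Rightarrow> nat \<Rightarrow> nat" where
  "code_cons a c x = Suc (prod_encode (prod_encode (a, c), x))"

definition cnf_of_code :: "nat \<Rightarrow> cnf" where
  "cnf_of_code n = map prod_decode (list_decode n)"

lemma cnf_code_simps [simp]:
  "cnf_code [] = 0" "cnf_code ((a, c) # x) = code_cons a c (cnf_code x)"
  by (simp_all add: cnf_code_def code_cons_def)

lemma cnf_of_code_simps [simp]:
  "cnf_of_code 0 = []" "cnf_of_code (code_cons a c n) = (a, c) # cnf_of_code n"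
  by (simp_all add: cnf_of_code_def code_cons_def)

lemma cnf_of_code_cnf_code [simp]: "cnf_of_code (cnf_code x) = x"
  by (simp add: cnf_of_code_def cnf_code_def comp_def)

lemma cnf_code_cnf_of_code [simp]: "cnf_code (cnf_of_code n) = n"
  by (simp add: cnf_of_code_def cnf_code_def comp_def)

text \<open>The tables of a certificate are \<open>A\<close>, \<open>W\<close> and \<open>P\<close> for \<open>tadd\<close>, \<open>tomega\<close> and \<open>tpoint\<close>, \<open>C\<close> for
  \<open>cadd\<close>, and \<open>R\<close> for derivations. Every entry must be justified by entries of smaller
  rank in \<open>A\<close>, \<open>W\<close> and \<open>P\<close>, by entries with a shorter left summand in \<open>C\<close>, and by entries of
  smaller height in \<open>R\<close>. So these local conditions exclude circular justifications and force all
  entries to be correct.\<close>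

definition add_splits ::
    "nat \<Rightarrow> nat set \<Rightarrow> nat \<Rightarrow> nat \<Rightarrow> nat \<Rightarrow> nat \<Rightarrow> nat \<Rightarrow> nat \<Rightarrow> bool" where
  "add_splits B A k x0 X y0 Y Z \<longleftrightarrow> (\<forall>c<B. \<forall>l<B. \<forall>r<B.
     (tuple [c, l, r] \<in> set_decode X \<longrightarrow>
        (\<exists>u<B. tuple [k, r, y0, u] \<in> A \<and> tuple [c, l, u] \<in> set_decode Z)) \<and>
     (tuple [c, l, r] \<in> set_decode Y \<longrightarrow>
        (\<exists>u<B. tuple [k, x0, l, u] \<in> A \<and> tuple [c, u, r] \<in> set_decode Z)) \<and>
     (tuple [c, l, r] \<in> set_decode Z \<longrightarrow>
        (\<exists>u<B. tuple [c, l, u] \<in> set_decode X \<and> tuple [k, u, y0, r] \<in> A) \<or>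
        (\<exists>u<B. tuple [c, u, r] \<in> set_decode Y \<and> tuple [k, x0, u, l] \<in> A)))"

definition add_table :: "nat \<Rightarrow> nat set \<Rightarrow> bool" where
  "add_table B A \<longleftrightarrow> (\<forall>k<B. \<forall>x<B. \<forall>y<B. \<forall>z<B. tuple [k, x, y, z] \<in> A \<longrightarrow>
     k = 0 \<and> z = 0 \<or>
     (\<exists>k'<B. \<exists>x0<B. \<exists>X<B. \<exists>y0<B. \<exists>Y<B. \<exists>z0<B. \<exists>Z<B.
        k = Suc k' \<and> x = tuple [x0, X] \<and> y = tuple [y0, Y] \<and> z = tuple [z0, Z] \<and>
        tuple [k', x0, y0, z0] \<in> A \<and> add_splits B A k' x0 X y0 Y Z))"

definition omega_splits ::
    "nat \<Rightarrow> nat set \<Rightarrow> nat \<Rightarrow> nat \<Rightarrow> nat \<Rightarrow> nat \<Rightarrow> nat \<Rightarrow> bool" where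
  "omega_splits B A k x0 X z0 Z \<longleftrightarrow> (\<forall>c<B. \<forall>l<B. \<forall>r<B.
     (tuple [c, l, r] \<in> set_decode X \<longrightarrow>
        (\<exists>u<B. \<exists>v<B. tuple [k, x0, l, u] \<in> A \<and> tuple [k, r, z0, v] \<in> A \<and>
           tuple [c, l, v] \<in> set_decode Z \<and> tuple [c, u, v] \<in> set_decode Z)) \<and>
     (tuple [c, l, r] \<in> set_decode Z \<longrightarrow>
        (\<exists>u<B. \<exists>v<B. tuple [c, u, v] \<in> set_decode X \<and> tuple [k, v, z0, r] \<in> A \<and>
           (l = u \<or> tuple [k, x0, u, l] \<in> A))))"

definition omega_table :: "nat \<Rightarrow> nat set \<Rightarrow> nat set \<Rightarrow> bool" where
  "omega_table B A W \<longleftrightarrow> (\<forall>k<B. \<forall>x<B. \<forall>z<B. tuple [k, x, z] \<in> W \<longrightarrow>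
     k = 0 \<and> z = 0 \<or>
     (\<exists>k'<B. \<exists>x0<B. \<exists>X<B. \<exists>z0<B. \<exists>Z<B.
        k = Suc k' \<and> x = tuple [x0, X] \<and> z = tuple [z0, Z] \<and> tuple [k', x0, z0] \<in> W \<and>
        omega_splits B A k' x0 X z0 Z))"

definition point_table :: "nat \<Rightarrow> nat set \<Rightarrow> bool" where
  "point_table B P \<longleftrightarrow> (\<forall>k<B. \<forall>c<B. \<forall>x<B. tuple [k, c, x] \<in> P \<longrightarrow>
     k = 0 \<and> x = 0 \<or>
     (\<exists>k'<B. \<exists>x0<B. \<exists>X<B. k = Suc k' \<and> x = tuple [x0, X] \<and> tuple [k', c, x0] \<in> P \<and>
        tuple [c, 0, 0] \<in> set_decode X \<and> (\<forall>z<B. z \<in> set_decode X \<longrightarrow> z = tuple [c, 0, 0])))"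

definition cadd_table :: "nat \<Rightarrow> nat set \<Rightarrow> bool" where
  "cadd_table B C \<longleftrightarrow> (\<forall>x<B. \<forall>y<B. \<forall>z<B. tuple [x, y, z] \<in> C \<longrightarrow>
     x = 0 \<and> z = y \<or> y = 0 \<and> z = x \<or>
     (\<exists>a<B. \<exists>c<B. \<exists>x'<B. \<exists>b<B. \<exists>e<B. \<exists>y'<B.
        x = code_cons a c x' \<and> y = code_cons b (Suc e) y' \<and>
        (a < b \<and> z = y \<or> a = b \<and> z = code_cons a (c + Suc e) y' \<or>
         b < a \<and> (\<exists>z'<B. tuple [x', y, z'] \<in> C \<and> z = code_cons a c z'))))"

definition omega_code :: "nat \<Rightarrow> nat \<Rightarrow> nat \<Rightarrow> bool" where
  "omega_code B y x \<longleftrightarrow> y = 0 \<and> x = 0 \<or>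
     (\<exists>a<B. \<exists>c<B. \<exists>y'<B. y = code_cons a c y' \<and> x = code_cons (Suc a) 1 0)"

definition built_table ::
    "nat \<Rightarrow> nat \<Rightarrow> nat \<Rightarrow> nat set \<Rightarrow> nat set \<Rightarrow> nat set \<Rightarrow> nat set \<Rightarrow> nat set \<Rightarrow> bool" where
  "built_table B d q A W P C R \<longleftrightarrow> (\<forall>n<B. \<forall>t<B. \<forall>x<B. tuple [n, t, x] \<in> R \<longrightarrow>
     t = 0 \<and> x = 0 \<or>
     (\<exists>c<B. c < d \<and> tuple [q, c, t] \<in> P \<and> x = code_cons 0 1 0) \<or>
     (\<exists>i<B. \<exists>u<B. \<exists>y<B. \<exists>j<B. \<exists>v<B. \<exists>z<B. i < n \<and> j < n \<and>
        tuple [i, u, y] \<in> R \<and> tuple [j, v, z] \<in> R \<and> tuple [q, u, v, t] \<in> A \<and> tuple [y, z, x] \<in> C) \<or>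
     (\<exists>i<B. \<exists>u<B. \<exists>y<B. i < n \<and> tuple [i, u, y] \<in> R \<and> tuple [q, u, u, u] \<in> A \<and>
        tuple [q, u, t] \<in> W \<and> omega_code B y x))"

text \<open>That \<open>y\<close> is at most \<open>x\<close> is witnessed by the difference \<open>w\<close> with \<open>x = y + w\<close>.\<close>

definition dominated :: "nat \<Rightarrow> nat set \<Rightarrow> nat set \<Rightarrow> nat \<Rightarrow> nat \<Rightarrow> bool" where
  "dominated B C R t x \<longleftrightarrow> (\<exists>n<B. \<exists>y<B. \<exists>w<B. tuple [n, t, y] \<in> R \<and> tuple [y, w, x] \<in> C)"

text \<open>Minimality quantifies over infinitely many derivations. It suffices, however, that the
  result of each construction step on entries of \<open>R\<close> is dominated by an entry: addition and
  multiplication by \<open>\<omega>\<close> are monotone, so by induction every derivation is dominated.\<close>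

definition dominating_table ::
    "nat \<Rightarrow> nat \<Rightarrow> nat \<Rightarrow> nat set \<Rightarrow> nat set \<Rightarrow> nat set \<Rightarrow> nat set \<Rightarrow> nat set \<Rightarrow> bool" where
  "dominating_table B d q A W P C R \<longleftrightarrow> d < B \<and> dominated B C R 0 0 \<and>
     (\<forall>c<B. c < d \<longrightarrow> (\<exists>t<B. tuple [q, c, t] \<in> P \<and> dominated B C R t (code_cons 0 1 0))) \<and>
     (\<forall>n<B. \<forall>t<B. \<forall>x<B. \<forall>m<B. \<forall>u<B. \<forall>y<B. tuple [n, t, x] \<in> R \<and> tuple [m, u, y] \<in> R \<longrightarrow>
        (\<exists>v<B. \<exists>z<B. tuple [q, t, u, v] \<in> A \<and> tuple [x, y, z] \<in> C \<and> dominated B C R v z)) \<and>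
     (\<forall>n<B. \<forall>t<B. \<forall>x<B. tuple [n, t, x] \<in> R \<and> tuple [q, t, t, t] \<in> A \<longrightarrow>
        (\<exists>v<B. \<exists>z<B. tuple [q, t, v] \<in> W \<and> omega_code B x z \<and> dominated B C R v z))"

definition max_min_table :: "nat \<Rightarrow> nat set \<Rightarrow> nat set \<Rightarrow> nat \<Rightarrow> bool" where
  "max_min_table B C R out \<longleftrightarrow>
     (\<exists>n<B. \<exists>t<B. tuple [n, t, out] \<in> R \<and>
        (\<forall>m<B. \<forall>y<B. tuple [m, t, y] \<in> R \<longrightarrow> (\<exists>w<B. tuple [out, w, y] \<in> C))) \<and>
     (\<forall>m<B. \<forall>u<B. \<forall>y<B. tuple [m, u, y] \<in> R \<longrightarrow> dominated B C R u out)"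

definition certificate ::
    "nat \<Rightarrow> nat \<Rightarrow> nat \<Rightarrow> nat \<Rightarrow> nat set \<Rightarrow> nat set \<Rightarrow> nat set \<Rightarrow> nat set \<Rightarrow> nat set \<Rightarrow> bool" where
  "certificate B out d q A W P C R \<longleftrightarrow>
     add_table B A \<and> omega_table B A W \<and> point_table B P \<and> cadd_table B C \<and>
     built_table B d q A W P C R \<and> dominating_table B d q A W P C R \<and> max_min_table B C R out"

section \<open>The certificate condition as a bounded formula\<close>

definition bOr :: "bfm \<Rightarrow> bfm \<Rightarrow> bfm" where "bOr \<phi> \<psi> = bNot (bAnd (bNot \<phi>) (bNot \<psi>))"
definition bImp :: "bfm \<Rightarrow> bfm \<Rightarrow> bfm" where "bImp \<phi> \<psi> = bNot (bAnd \<phi> (bNot \<psi>))"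
definition bAll :: "nat \<Rightarrow> bfm \<Rightarrow> bfm" where "bAll x \<phi> = bNot (bEx x (bNot \<phi>))"

lemma holds_derived [simp]:
  "holds B s (bOr \<phi> \<psi>) \<longleftrightarrow> holds B s \<phi> \<or> holds B s \<psi>"
  "holds B s (bImp \<phi> \<psi>) \<longleftrightarrow> (holds B s \<phi> \<longrightarrow> holds B s \<psi>)"
  "holds B s (bAll x \<phi>) \<longleftrightarrow> (\<forall>a<B. holds B (s(x := a)) \<phi>)"
  by (auto simp: bOr_def bImp_def bAll_def)

lemma bvars_derived [simp]:
  "bvars (bOr \<phi> \<psi>) = bvars \<phi> \<union> bvars \<psi>" "bvars (bImp \<phi> \<psi>) = bvars \<phi> \<union> bvars \<psi>"
  "bvars (bAll x \<phi>) = insert x (bvars \<phi>)"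
  by (auto simp: bOr_def bImp_def bAll_def)

fun bAnds :: "bfm list \<Rightarrow> bfm" where
  "bAnds [] = bEq (bConst 0) (bConst 0)"
| "bAnds [\<phi>] = \<phi>"
| "bAnds (\<phi> # \<psi> # \<phi>s) = bAnd \<phi> (bAnds (\<psi> # \<phi>s))"

fun bOrs :: "bfm list \<Rightarrow> bfm" where
  "bOrs [] = bNot (bEq (bConst 0) (bConst 0))"
| "bOrs [\<phi>] = \<phi>"
| "bOrs (\<phi> # \<psi> # \<phi>s) = bOr \<phi> (bOrs (\<psi> # \<phi>s))"

fun btuple :: "bterm list \<Rightarrow> bterm" where
  "btuple [] = bConst 0"
| "btuple [t] = t"
| "btuple (t # u # ts) = bPair t (btuple (u # ts))"

abbreviation "bAlls xs \<phi> \<equiv> foldr bAll xs \<phi>"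
abbreviation "bExs xs \<phi> \<equiv> foldr bEx xs \<phi>"
abbreviation "bIn ts i \<equiv> bMem (btuple (map bVar ts)) (bVar i)"
abbreviation "bcons a c x \<equiv> bSuc (bPair (bPair a c) x)"

text \<open>The variables \<open>0\<close> to \<open>7\<close> stand for the result, \<open>d\<close>, \<open>q\<close> and the codes of the tables
  \<open>A\<close>, \<open>W\<close>, \<open>P\<close>, \<open>C\<close>, \<open>R\<close>.\<close>

definition add_fm :: bfm where
  "add_fm = bAlls [8, 9, 10, 11] (bImp (bIn [8, 9, 10, 11] 3) (bOr
     (bAnd (bEq (bVar 8) (bConst 0)) (bEq (bVar 11) (bConst 0)))
     (bExs [12, 13, 14, 15, 16, 17, 18] (bAnds [
        bEq (bVar 8) (bSuc (bVar 12)), bEq (bVar 9) (btuple [bVar 13, bVar 14]),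
        bEq (bVar 10) (btuple [bVar 15, bVar 16]), bEq (bVar 11) (btuple [bVar 17, bVar 18]),
        bIn [12, 13, 15, 17] 3,
        bAlls [19, 20, 21] (bAnds [
          bImp (bIn [19, 20, 21] 14) (bEx 22 (bAnd (bIn [12, 21, 15, 22] 3) (bIn [19, 20, 22] 18))),
          bImp (bIn [19, 20, 21] 16) (bEx 22 (bAnd (bIn [12, 13, 20, 22] 3) (bIn [19, 22, 21] 18))),
          bImp (bIn [19, 20, 21] 18) (bOr
            (bEx 22 (bAnd (bIn [19, 20, 22] 14) (bIn [12, 22, 15, 21] 3)))
            (bEx 22 (bAnd (bIn [19, 22, 21] 16) (bIn [12, 13, 22, 20] 3))))])]))))"

definition omega_fm :: bfm where
  "omega_fm = bAlls [8, 9, 10] (bImp (bIn [8, 9, 10] 4) (bOr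
     (bAnd (bEq (bVar 8) (bConst 0)) (bEq (bVar 10) (bConst 0)))
     (bExs [12, 13, 14, 15, 16] (bAnds [
        bEq (bVar 8) (bSuc (bVar 12)), bEq (bVar 9) (btuple [bVar 13, bVar 14]),
        bEq (bVar 10) (btuple [bVar 15, bVar 16]), bIn [12, 13, 15] 4,
        bAlls [17, 18, 19] (bAnds [
          bImp (bIn [17, 18, 19] 14) (bExs [20, 21] (bAnds [bIn [12, 13, 18, 20] 3,
            bIn [12, 19, 15, 21] 3, bIn [17, 18, 21] 16, bIn [17, 20, 21] 16])),
          bImp (bIn [17, 18, 19] 16) (bExs [20, 21] (bAnds [bIn [17, 20, 21] 14,
            bIn [12, 21, 15, 19] 3, bOr (bEq (bVar 18) (bVar 20)) (bIn [12, 13, 20, 18] 3)]))])]))))"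

definition point_fm :: bfm where
  "point_fm = bAlls [8, 9, 10] (bImp (bIn [8, 9, 10] 5) (bOr
     (bAnd (bEq (bVar 8) (bConst 0)) (bEq (bVar 10) (bConst 0)))
     (bExs [11, 12, 13] (bAnds [bEq (bVar 8) (bSuc (bVar 11)),
        bEq (bVar 10) (btuple [bVar 12, bVar 13]), bIn [11, 9, 12] 5,
        bMem (btuple [bVar 9, bConst 0, bConst 0]) (bVar 13),
        bAll 14 (bImp (bMem (bVar 14) (bVar 13)) (bEq (bVar 14) (btuple [bVar 9, bConst 0, bConst 0])))]))))"

definition cadd_fm :: bfm where
  "cadd_fm = bAlls [8, 9, 10] (bImp (bIn [8, 9, 10] 6) (bOrs [
     bAnd (bEq (bVar 8) (bConst 0)) (bEq (bVar 10) (bVar 9)),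
     bAnd (bEq (bVar 9) (bConst 0)) (bEq (bVar 10) (bVar 8)),
     bExs [11, 12, 13, 14, 15, 16] (bAnds [
       bEq (bVar 8) (bcons (bVar 11) (bVar 12) (bVar 13)),
       bEq (bVar 9) (bcons (bVar 14) (bSuc (bVar 15)) (bVar 16)),
       bOrs [bAnd (bLt (bVar 11) (bVar 14)) (bEq (bVar 10) (bVar 9)),
         bAnd (bEq (bVar 11) (bVar 14))
           (bEq (bVar 10) (bcons (bVar 11) (bPlus (bVar 12) (bSuc (bVar 15))) (bVar 16))),
         bAnd (bLt (bVar 14) (bVar 11)) (bEx 17 (bAnd (bIn [13, 9, 17] 6)
           (bEq (bVar 10) (bcons (bVar 11) (bVar 12) (bVar 17)))))]])]))"

definition omega_code_fm :: "nat \<Rightarrow> nat \<Rightarrow> bfm" where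
  "omega_code_fm y x = bOr (bAnd (bEq (bVar y) (bConst 0)) (bEq (bVar x) (bConst 0)))
     (bExs [20, 21, 22] (bAnd (bEq (bVar y) (bcons (bVar 20) (bVar 21) (bVar 22)))
       (bEq (bVar x) (bcons (bSuc (bVar 20)) (bConst 1) (bConst 0)))))"

abbreviation "bone \<equiv> bcons (bConst 0) (bConst 1) (bConst 0)"

definition built_fm :: bfm where
  "built_fm = bAlls [8, 9, 10] (bImp (bIn [8, 9, 10] 7) (bOrs [
     bAnd (bEq (bVar 9) (bConst 0)) (bEq (bVar 10) (bConst 0)),
     bEx 11 (bAnds [bLt (bVar 11) (bVar 1), bIn [2, 11, 9] 5, bEq (bVar 10) bone]),
     bExs [11, 12, 13, 14, 15, 16] (bAnds [bLt (bVar 11) (bVar 8), bLt (bVar 14) (bVar 8),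
       bIn [11, 12, 13] 7, bIn [14, 15, 16] 7, bIn [2, 12, 15, 9] 3, bIn [13, 16, 10] 6]),
     bExs [11, 12, 13] (bAnds [bLt (bVar 11) (bVar 8), bIn [11, 12, 13] 7, bIn [2, 12, 12, 12] 3,
       bIn [2, 12, 9] 4, omega_code_fm 13 10])]))"

definition dominated_fm :: "bterm \<Rightarrow> bterm \<Rightarrow> bfm" where
  "dominated_fm t x = bExs [20, 21, 22] (bAnd (bMem (btuple [bVar 20, t, bVar 21]) (bVar 7))
     (bMem (btuple [bVar 21, bVar 22, x]) (bVar 6)))"

definition dominating_fm :: bfm where
  "dominating_fm = bAnds [bEx 8 (bEq (bVar 8) (bVar 1)), dominated_fm (bConst 0) (bConst 0),
     bAll 8 (bImp (bLt (bVar 8) (bVar 1)) (bEx 9 (bAnd (bIn [2, 8, 9] 5) (dominated_fm (bVar 9) bone)))),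
     bAlls [8, 9, 10, 11, 12, 13] (bImp (bAnd (bIn [8, 9, 10] 7) (bIn [11, 12, 13] 7))
       (bExs [14, 15] (bAnds [bIn [2, 9, 12, 14] 3, bIn [10, 13, 15] 6, dominated_fm (bVar 14) (bVar 15)]))),
     bAlls [8, 9, 10] (bImp (bAnd (bIn [8, 9, 10] 7) (bIn [2, 9, 9, 9] 3))
       (bExs [14, 15] (bAnds [bIn [2, 9, 14] 4, omega_code_fm 10 15, dominated_fm (bVar 14) (bVar 15)])))]"

definition max_min_fm :: bfm where
  "max_min_fm = bAnd
     (bExs [8, 9] (bAnd (bIn [8, 9, 0] 7)
       (bAlls [10, 11] (bImp (bIn [10, 9, 11] 7) (bEx 12 (bIn [0, 12, 11] 6))))))
     (bAlls [8, 9, 10] (bImp (bIn [8, 9, 10] 7) (dominated_fm (bVar 9) (bVar 0))))"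

definition certificate_fm :: bfm where
  "certificate_fm = bExs [3, 4, 5, 6, 7]
     (bAnds [add_fm, omega_fm, point_fm, cadd_fm, built_fm, dominating_fm, max_min_fm])"

lemma bvars_certificate_fm: "bvars certificate_fm \<subseteq> {..<20 + 3}"
  by (simp add: certificate_fm_def add_fm_def omega_fm_def point_fm_def cadd_fm_def built_fm_def
      dominating_fm_def max_min_fm_def dominated_fm_def omega_code_fm_def)

lemma holds_add_fm: "holds B s add_fm \<longleftrightarrow> add_table B (set_decode (s 3))"
  by (simp add: add_fm_def add_table_def add_splits_def)

lemma holds_omega_fm: "holds B s omega_fm \<longleftrightarrow> omega_table B (set_decode (s 3)) (set_decode (s 4))"
  by (simp add: omega_fm_def omega_table_def omega_splits_def)

lemma holds_point_fm: "holds B s point_fm \<longleftrightarrow> point_table B (set_decode (s 5))"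
  by (simp add: point_fm_def point_table_def)

lemma holds_cadd_fm: "holds B s cadd_fm \<longleftrightarrow> cadd_table B (set_decode (s 6))"
  by (simp add: cadd_fm_def cadd_table_def code_cons_def)

lemma holds_built_fm: "holds B s built_fm \<longleftrightarrow> built_table B (s 1) (s 2)
    (set_decode (s 3)) (set_decode (s 4)) (set_decode (s 5)) (set_decode (s 6)) (set_decode (s 7))"
  by (simp add: built_fm_def built_table_def code_cons_def omega_code_fm_def omega_code_def)

lemma holds_dominating_fm: "holds B s dominating_fm \<longleftrightarrow> dominating_table B (s 1) (s 2)
    (set_decode (s 3)) (set_decode (s 4)) (set_decode (s 5)) (set_decode (s 6)) (set_decode (s 7))"
  by (simp add: dominating_fm_def dominating_table_def dominated_fm_def dominated_def code_cons_def
      omega_code_fm_def omega_code_def)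

lemma holds_max_min_fm: "holds B s max_min_fm \<longleftrightarrow>
    max_min_table B (set_decode (s 6)) (set_decode (s 7)) (s 0)"
  by (simp add: max_min_fm_def max_min_table_def dominated_fm_def dominated_def)

lemma holds_certificate_fm:
  "holds B s certificate_fm \<longleftrightarrow> (\<exists>A<B. \<exists>W<B. \<exists>P<B. \<exists>C<B. \<exists>R<B. certificate B (s 0) (s 1) (s 2)
     (set_decode A) (set_decode W) (set_decode P) (set_decode C) (set_decode R))"
  by (simp add: certificate_fm_def certificate_def holds_add_fm holds_omega_fm holds_point_fm
      holds_cadd_fm holds_built_fm holds_dominating_fm holds_max_min_fm)

section \<open>Certificates are sound\<close>

lemma set_decode_less: "z \<in> set_decode w \<Longrightarrow> z < w"
proof -
  assume "z \<in> set_decode w"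
  then have "w div 2 ^ z \<noteq> 0" by (auto simp: set_decode_def intro!: Nat.gr0I)
  then have "2 ^ z \<le> w" by (simp add: div_eq_0_iff not_less)
  then show "z < w" using less_exp[of z] by (rule less_le_trans[rotated])
qed

lemma prod_encode_less:
  assumes "prod_encode (a, b) < B"
  shows "a < B" "b < B"
  using assms le_prod_encode_1[of a b] le_prod_encode_2[of b a] by auto

lemma tuple_less: "tuple xs < B \<Longrightarrow> x \<in> set xs \<Longrightarrow> x < B"
  by (induction xs rule: tuple.induct) (auto dest: prod_encode_less)

lemma code_cons_less:
  assumes "code_cons a c x < B"
  shows "a < B" "c < B" "x < B" "x < code_cons a c x"
  using assms le_prod_encode_1[of a c] le_prod_encode_2[of c a]
    le_prod_encode_1[of "prod_encode (a, c)" x] le_prod_encode_2[of x "prod_encode (a, c)"]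
  by (auto simp: code_cons_def)

lemma tuple3_eq_triple: "tuple [c, l, r] = triple c l r"
  by (simp add: triple_def)

lemma splits_tuple: "splits (tuple [x, X]) = set_decode X" "lower (tuple [x, X]) = x"
  by (simp_all add: splits_def lower_def)

lemma type_eqI: "lower x = lower y \<Longrightarrow> splits x = splits y \<Longrightarrow> x = y"
  by (metis prod_encode_lower_splits)

lemma split_less: "triple c l r \<in> set_decode X \<Longrightarrow> X < B \<Longrightarrow> c < B \<and> l < B \<and> r < B"
  using tuple_less[of "[c, l, r]" B] set_decode_less[of "triple c l r" X]
  by (simp add: tuple3_eq_triple[symmetric])

locale bounded_tables =
  fixes B :: nat and A W P C R :: "nat set"
  assumes bounded: "z \<in> A \<union> W \<union> P \<union> C \<union> R \<Longrightarrow> z < B"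
begin

lemma entry_less: "tuple xs \<in> A \<union> W \<union> P \<union> C \<union> R \<Longrightarrow> x \<in> set xs \<Longrightarrow> x < B"
  using bounded tuple_less by blast

lemma entry_A: "tuple [k, x, y, z] \<in> A \<Longrightarrow> k < B \<and> x < B \<and> y < B \<and> z < B"
  using entry_less[of "[k, x, y, z]"] by simp
lemma entry_W: "tuple [k, x, z] \<in> W \<Longrightarrow> k < B \<and> x < B \<and> z < B"
  using entry_less[of "[k, x, z]"] by simp
lemma entry_P: "tuple [k, x, z] \<in> P \<Longrightarrow> k < B \<and> x < B \<and> z < B"
  using entry_less[of "[k, x, z]"] by simp
lemma entry_C: "tuple [k, x, z] \<in> C \<Longrightarrow> k < B \<and> x < B \<and> z < B"
  using entry_less[of "[k, x, z]"] by simp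
lemma entry_R: "tuple [k, x, z] \<in> R \<Longrightarrow> k < B \<and> x < B \<and> z < B"
  using entry_less[of "[k, x, z]"] by simp

lemma add_table_sound:
  assumes "add_table B A"
  shows "tuple [k, x, y, z] \<in> A \<Longrightarrow> z = tadd k x y"
proof (induction k arbitrary: x y z)
  case 0
  have "0 < B" "x < B" "y < B" "z < B" using entry_A[OF 0] by auto
  then show ?case
    using 0 assms[unfolded add_table_def, rule_format, of 0 x y z] by auto
next
  case (Suc k)
  have "Suc k < B" "x < B" "y < B" "z < B" using entry_A[OF Suc.prems] by auto
  from assms[unfolded add_table_def, rule_format, OF this Suc.prems]
  obtain x0 X y0 Y z0 Z where less: "X < B" "Y < B" "Z < B"
    and xyz: "x = tuple [x0, X]" "y = tuple [y0, Y]" "z = tuple [z0, Z]"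
    and low: "tuple [k, x0, y0, z0] \<in> A" and step: "add_splits B A k x0 X y0 Y Z"
    using Suc_neq_Zero Suc_inject by blast
  note step = step[unfolded add_splits_def tuple3_eq_triple, rule_format]
  have X: "triple c l (tadd k r y0) \<in> set_decode Z" if "triple c l r \<in> set_decode X" for c l r
    using step[of c l r] split_less[OF that less(1)] that Suc.IH[of r y0] by blast
  have Y: "triple c (tadd k x0 l) r \<in> set_decode Z" if "triple c l r \<in> set_decode Y" for c l r
    using step[of c l r] split_less[OF that less(2)] that Suc.IH[of x0 l] by blast
  have Z: "(\<exists>u. triple c l u \<in> set_decode X \<and> r = tadd k u y0) \<or>
      (\<exists>u. triple c u r \<in> set_decode Y \<and> l = tadd k x0 u)" if "triple c l r \<in> set_decode Z" for c l r
    using step[of c l r] split_less[OF that less(3)] that Suc.IH by blast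
  show ?case
  proof (rule type_eqI)
    show "lower z = lower (tadd (Suc k) x y)"
      unfolding lower_tadd xyz splits_tuple by (rule Suc.IH[OF low])
    show "splits z = splits (tadd (Suc k) x y)"
      unfolding splits_tadd xyz splits_tuple
    proof (intro equalityI subsetI)
      fix w assume "w \<in> set_decode Z"
      then consider u where "triple (t_color w) (t_left w) u \<in> set_decode X" "t_right w = tadd k u y0"
        | u where "triple (t_color w) u (t_right w) \<in> set_decode Y" "t_left w = tadd k x0 u"
        using Z[of "t_color w" "t_left w" "t_right w"] unfolding triple_sel by blast
      then show "w \<in> (\<lambda>z. triple (t_color z) (t_left z) (tadd k (t_right z) y0)) ` set_decode X \<union>
          (\<lambda>z. triple (t_color z) (tadd k x0 (t_left z)) (t_right z)) ` set_decode Y"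
      proof cases
        case 1
        from 1(2) show ?thesis by (intro UnI1 image_eqI[OF _ 1(1)]) (simp add: eq_triple_iff)
      next
        case 2
        from 2(2) show ?thesis by (intro UnI2 image_eqI[OF _ 2(1)]) (simp add: eq_triple_iff)
      qed
    qed (use X Y in auto)
  qed
qed

lemma omega_table_sound:
  assumes "add_table B A" "omega_table B A W"
  shows "tuple [k, x, z] \<in> W \<Longrightarrow> z = tomega k x"
proof (induction k arbitrary: x z)
  case 0
  have "0 < B" "x < B" "z < B" using entry_W[OF 0] by auto
  then show ?case
    using 0 assms(2)[unfolded omega_table_def, rule_format, of 0 x z] by auto
next
  case (Suc k)
  note A = add_table_sound[OF assms(1)]
  have "Suc k < B" "x < B" "z < B" using entry_W[OF Suc.prems] by auto
  from assms(2)[unfolded omega_table_def, rule_format, OF this Suc.prems]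
  obtain x0 X z0 Z where less: "X < B" "Z < B" and xz: "x = tuple [x0, X]" "z = tuple [z0, Z]"
    and low: "tuple [k, x0, z0] \<in> W" and step: "omega_splits B A k x0 X z0 Z"
    using Suc_neq_Zero Suc_inject by blast
  note step = step[unfolded omega_splits_def tuple3_eq_triple, rule_format]
  have z0: "z0 = tomega k x0" by (rule Suc.IH[OF low])
  have X: "triple c l (tadd k r z0) \<in> set_decode Z \<and> triple c (tadd k x0 l) (tadd k r z0) \<in> set_decode Z"
    if X: "triple c l r \<in> set_decode X" for c l r
  proof -
    obtain u v where "tuple [k, x0, l, u] \<in> A" "tuple [k, r, z0, v] \<in> A"
      "triple c l v \<in> set_decode Z" "triple c u v \<in> set_decode Z"
      using step[of c l r] split_less[OF X less(1)] X by blast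
    then show ?thesis using A by blast
  qed
  have Z: "\<exists>u v. triple c u v \<in> set_decode X \<and> r = tadd k v z0 \<and> (l = u \<or> l = tadd k x0 u)"
    if "triple c l r \<in> set_decode Z" for c l r
    using step[of c l r] split_less[OF that less(2)] that A by blast
  show ?case
  proof (rule type_eqI)
    show "lower z = lower (tomega (Suc k) x)"
      unfolding lower_tomega xz splits_tuple by (rule z0)
    show "splits z = splits (tomega (Suc k) x)"
      unfolding splits_tomega xz splits_tuple z0[symmetric]
    proof (intro equalityI subsetI)
      fix w assume "w \<in> set_decode Z"
      then obtain u v where uv: "triple (t_color w) u v \<in> set_decode X"
        and "t_right w = tadd k v z0" "t_left w = u \<or> t_left w = tadd k x0 u"
        using Z[of "t_color w" "t_left w" "t_right w"] unfolding triple_sel by blast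
      then have "w = triple (t_color w) u (tadd k v z0) \<or> w = triple (t_color w) (tadd k x0 u) (tadd k v z0)"
        by (auto simp: eq_triple_iff)
      then show "w \<in> (\<lambda>z. triple (t_color z) (t_left z) (tadd k (t_right z) z0)) ` set_decode X \<union>
          (\<lambda>z. triple (t_color z) (tadd k x0 (t_left z)) (tadd k (t_right z) z0)) ` set_decode X"
      proof
        assume w: "w = triple (t_color w) u (tadd k v z0)"
        show ?thesis by (rule UnI1, rule image_eqI[OF _ uv]) (subst w, simp)
      next
        assume w: "w = triple (t_color w) (tadd k x0 u) (tadd k v z0)"
        show ?thesis by (rule UnI2, rule image_eqI[OF _ uv]) (subst w, simp)
      qed
    qed (use X in auto)
  qed
qed

lemma point_table_sound:
  assumes "point_table B P"
  shows "tuple [k, c, x] \<in> P \<Longrightarrow> x = tpoint k c"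
proof (induction k arbitrary: x)
  case 0
  have "0 < B" "c < B" "x < B" using entry_P[OF 0] by auto
  then show ?case
    using 0 assms[unfolded point_table_def, rule_format, of 0 c x] by auto
next
  case (Suc k)
  have "Suc k < B" "c < B" "x < B" using entry_P[OF Suc.prems] by auto
  from assms[unfolded point_table_def, rule_format, OF this Suc.prems]
  obtain x0 X where x: "X < B" "x = tuple [x0, X]" "tuple [k, c, x0] \<in> P" "triple c 0 0 \<in> set_decode X"
    "\<forall>z<B. z \<in> set_decode X \<longrightarrow> z = triple c 0 0"
    unfolding tuple3_eq_triple by auto
  have "set_decode X = {triple c 0 0}"
    using x set_decode_less[of _ X] by fastforce
  then have "X = set_encode {triple c 0 0}" using set_decode_inverse[of X] by simp
  then show ?case unfolding x(2) Suc.IH[OF x(3)] by simp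
qed

text \<open>A table entry can only increase the left summand, because its rule demands a positive leading
  coefficient of the right summand. This is why entries of \<open>C\<close> witness comparisons.\<close>

lemma cadd_table_sound:
  assumes "cadd_table B C"
  shows "tuple [x, y, z] \<in> C \<Longrightarrow> z = cnf_code (cadd (cnf_of_code x) (cnf_of_code y)) \<and>
    cnf_of_code x \<le> cnf_of_code z"
proof (induction x arbitrary: z rule: less_induct)
  case (less x)
  have "x < B" "y < B" "z < B" using entry_C[OF less.prems] by auto
  from assms[unfolded cadd_table_def, rule_format, OF this less.prems]
  consider "x = 0" "z = y" | "y = 0" "z = x"
    | a c x' b e y' where "x = code_cons a c x'" "y = code_cons b (Suc e) y'"
      "a < b \<and> z = y \<or> a = b \<and> z = code_cons a (c + Suc e) y' \<or>
       b < a \<and> (\<exists>z'. tuple [x', y, z'] \<in> C \<and> z = code_cons a c z')"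
    by blast
  then show ?case
  proof cases
    case 3
    then consider "a < b" "z = y" | "a = b" "z = code_cons a (c + Suc e) y'"
      | z' where "b < a" "tuple [x', y, z'] \<in> C" "z = code_cons a c z'" by blast
    then show ?thesis
    proof cases
      case tail: 3
      have "x' < x" using 3(1) code_cons_less(4)[of a c x' "Suc x"] by simp
      note IH = less.IH[OF this tail(2)]
      note z' = conjunct1[OF IH]
      have "cnf_of_code x' \<le> cadd (cnf_of_code x') (cnf_of_code y)"
        using conjunct2[OF IH] unfolding z' by simp
      then show ?thesis using tail(1) unfolding tail(3) z' 3(1,2) by simp
    qed (use 3(1,2) in simp_all)
  qed simp_all
qed

lemma omega_code_sound:
  "omega_code B y x \<Longrightarrow> x = cnf_code (times_omega (cnf_of_code y))"
  by (auto simp: omega_code_def)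

lemma built_table_sound:
  assumes "add_table B A" "omega_table B A W" "point_table B P" "cadd_table B C"
    and "built_table B d q A W P C R"
  shows "tuple [n, t, x] \<in> R \<Longrightarrow> built d q n t (cnf_of_code x)"
proof (induction n arbitrary: t x rule: less_induct)
  case (less n)
  note A = add_table_sound[OF assms(1)] and W = omega_table_sound[OF assms(1,2)]
    and P = point_table_sound[OF assms(3)] and C = cadd_table_sound[OF assms(4)]
  have "n < B" "t < B" "x < B" using entry_R[OF less.prems] by auto
  from assms(5)[unfolded built_table_def, rule_format, OF this less.prems]
  consider "t = 0" "x = 0"
    | c where "c < d" "tuple [q, c, t] \<in> P" "x = code_cons 0 1 0"
    | i u y j v z where "i < n" "j < n" "tuple [i, u, y] \<in> R" "tuple [j, v, z] \<in> R"
      "tuple [q, u, v, t] \<in> A" "tuple [y, z, x] \<in> C"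
    | i u y where "i < n" "tuple [i, u, y] \<in> R" "tuple [q, u, u, u] \<in> A" "tuple [q, u, t] \<in> W"
      "omega_code B y x"
    by blast
  then show ?case
  proof cases
    case 1
    then show ?thesis by (simp add: built.empty)
  next
    case 2
    then show ?thesis using P built.point[of c d q n] by simp
  next
    case 3
    then show ?thesis
      using A[OF 3(5)] C[OF 3(6)] built.sum[OF less.IH[OF 3(1,3)] less.IH[OF 3(2,4)] 3(1,2)] by simp
  next
    case 4
    then show ?thesis
      using A[OF 4(3)] W[OF 4(4)] omega_code_sound[OF 4(5)] built.omega[OF less.IH[OF 4(1,2)] _ 4(1)] by simp
  qed
qed

text \<open>Soundness of the tables shows that all entries of \<open>R\<close> are derivable. For the converse bound,
  \<open>covered\<close> shows by induction on derivations that each of them is dominated by an entry.\<close>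

lemma certificate_sound:
  assumes cert: "certificate B out d q A W P C R"
  shows "max_min_built d q (cnf_of_code out)"
proof -
  have tables: "add_table B A" "omega_table B A W" "point_table B P" "cadd_table B C"
    "built_table B d q A W P C R" and dom: "dominating_table B d q A W P C R"
    and max: "max_min_table B C R out"
    using cert by (simp_all add: certificate_def)
  note A = add_table_sound[OF tables(1)] and W = omega_table_sound[OF tables(1,2)]
    and P = point_table_sound[OF tables(3)] and C = cadd_table_sound[OF tables(4)]
    and R = built_table_sound[OF tables]
  have dominatedD: "\<exists>n y. tuple [n, t, y] \<in> R \<and> cnf_of_code y \<le> cnf_of_code x"
    if "dominated B C R t x" for t x
    using that C unfolding dominated_def by blast
  have dB: "d < B" and D0: "dominated B C R 0 0"
    using dom by (simp_all add: dominating_table_def)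
  note dom = dom[unfolded dominating_table_def, THEN conjunct2, THEN conjunct2]
  have DP: "\<exists>t. tuple [q, c, t] \<in> P \<and> dominated B C R t (code_cons 0 1 0)" if "c < d" for c
    using conjunct1[OF dom, rule_format, of c] that dB by auto
  have DA: "\<exists>v z. tuple [q, t, u, v] \<in> A \<and> tuple [x, y, z] \<in> C \<and> dominated B C R v z"
    if "tuple [n, t, x] \<in> R" "tuple [m, u, y] \<in> R" for n t x m u y
    using conjunct1[OF conjunct2[OF dom], rule_format, of n t x m u y] that
      entry_R[OF that(1)] entry_R[OF that(2)] by blast
  have DW: "\<exists>v z. tuple [q, t, v] \<in> W \<and> omega_code B x z \<and> dominated B C R v z"
    if "tuple [n, t, x] \<in> R" "tuple [q, t, t, t] \<in> A" for n t x
    using conjunct2[OF conjunct2[OF dom], rule_format, of n t x] that entry_R[OF that(1)] by blast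
  have covered: "\<exists>n y. tuple [n, t, y] \<in> R \<and> cnf_of_code y \<le> x" if "built d q n t x" for n t x
    using that
  proof (induction rule: built.induct)
    case (empty n)
    then show ?case using dominatedD[OF D0] by simp
  next
    case (point c n)
    then obtain t where "tuple [q, c, t] \<in> P" and t: "dominated B C R t (code_cons 0 1 0)"
      using DP by blast
    then have "t = tpoint q c" using P by blast
    then show ?case using dominatedD[OF t] by simp
  next
    case (sum i t x j u y n)
    obtain m k x' y' where R': "tuple [m, t, x'] \<in> R" "cnf_of_code x' \<le> x" "tuple [k, u, y'] \<in> R" "cnf_of_code y' \<le> y"
      using sum.IH by blast
    obtain v z where vz: "tuple [q, t, u, v] \<in> A" "tuple [x', y', z] \<in> C" and "dominated B C R v z"
      using DA[OF R'(1,3)] by blast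
    then obtain l w where "tuple [l, v, w] \<in> R" "cnf_of_code w \<le> cnf_of_code z"
      using dominatedD by blast
    moreover have "cnf_of_code z = cadd (cnf_of_code x') (cnf_of_code y')" using C[OF vz(2)] by simp
    moreover have "\<dots> \<le> cadd x (cnf_of_code y')"
      using R' sum.hyps R by (intro cadd_mono_left) (auto intro: built_is_cnf)
    moreover have "\<dots> \<le> cadd x y"
      using R' sum.hyps by (intro cadd_mono_right) (auto intro: built_is_cnf)
    ultimately show ?case using A[OF vz(1)] by (metis order_trans)
  next
    case (omega i t x n)
    obtain m x' where R': "tuple [m, t, x'] \<in> R" "cnf_of_code x' \<le> x" using omega.IH by blast
    obtain v where "tuple [q, t, t, v] \<in> A" using DA[OF R'(1) R'(1)] by blast
    then have "tuple [q, t, t, t] \<in> A" using A omega.hyps(2) by metis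
    then obtain v z where vz: "tuple [q, t, v] \<in> W" "omega_code B x' z" and "dominated B C R v z"
      using DW[OF R'(1)] by blast
    then obtain l w where "tuple [l, v, w] \<in> R" "cnf_of_code w \<le> cnf_of_code z"
      using dominatedD by blast
    moreover have "cnf_of_code z = times_omega (cnf_of_code x')" using omega_code_sound[OF vz(2)] by simp
    moreover have "\<dots> \<le> times_omega x"
      using R' omega.hyps by (intro times_omega_mono) (auto intro: built_is_cnf)
    ultimately show ?case using W[OF vz(1)] by (metis order_trans)
  qed
  show ?thesis
    unfolding max_min_built_def
  proof
    obtain n t where nt: "tuple [n, t, out] \<in> R"
      and least: "\<forall>m<B. \<forall>y<B. tuple [m, t, y] \<in> R \<longrightarrow> (\<exists>w<B. tuple [out, w, y] \<in> C)"
      using conjunct1[OF max[unfolded max_min_table_def]] by blast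
    have "cnf_of_code out \<le> y" if y: "buildable d q t y" for y
    proof -
      obtain m y' where m: "tuple [m, t, y'] \<in> R" "cnf_of_code y' \<le> y"
        using y covered unfolding buildable_def by blast
      then have "cnf_of_code out \<le> cnf_of_code y'"
        using least[rule_format, of m y'] entry_R[OF m(1)] C by blast
      then show ?thesis using m(2) by simp
    qed
    then show "\<exists>t. buildable d q t (cnf_of_code out) \<and> (\<forall>y. buildable d q t y \<longrightarrow> cnf_of_code out \<le> y)"
      using R[OF nt] unfolding buildable_def by blast
    show "\<forall>t y. buildable d q t y \<longrightarrow> (\<exists>z. buildable d q t z \<and> z \<le> cnf_of_code out)"
    proof (intro allI impI)
      fix t y assume "buildable d q t y"
      then obtain m y' where m: "tuple [m, t, y'] \<in> R"
        using covered unfolding buildable_def by blast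
      then have "dominated B C R t out"
        using conjunct2[OF max[unfolded max_min_table_def], rule_format, of m t y'] entry_R[OF m] by blast
      then show "\<exists>z. buildable d q t z \<and> z \<le> cnf_of_code out"
        using dominatedD R unfolding buildable_def by blast
    qed
  qed
qed

end

section \<open>Certificates exist\<close>

definition upper :: "nat \<Rightarrow> nat" where "upper x = snd (prod_decode x)"

lemma tuple_lower_upper: "tuple [lower x, upper x] = x"
  by (simp add: lower_def upper_def)

lemma set_decode_upper: "set_decode (upper x) = splits x"
  by (simp add: upper_def splits_def)

lemma lower_upper_less: "x < B \<Longrightarrow> lower x < B \<and> upper x < B"
  using prod_encode_less[of "lower x" "upper x" B] tuple_lower_upper[of x] by simp

lemma triple_in_splits:
  assumes "triple c l r \<in> splits x" "x \<in> types d (Suc k)"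
  shows "c < d" "l \<in> types d k" "r \<in> types d k"
  using assms unfolding types_Suc_iff by (auto dest!: subsetD)

context bounded_tables
begin

text \<open>The full table of \<open>tadd\<close> on the candidate types is closed under justification, since the value
  at rank \<open>k + 1\<close> is computed from values at rank \<open>k\<close> whose arguments are again candidates. This
  works for the other tables, too; in the one for \<open>cadd\<close> it matters that the tail of a normal form
  has a smaller code.\<close>

lemma add_table_complete:
  assumes A: "A = {tuple [k, x, y, tadd k x y] | k x y. k \<le> q \<and> x \<in> types d k \<and> y \<in> types d k}"
  shows "add_table B A"
  unfolding add_table_def
proof (intro allI impI)
  fix k x y z assume less: "k < B" "x < B" "y < B" "z < B" and mem: "tuple [k, x, y, z] \<in> A"
  have k: "k \<le> q" and xy: "x \<in> types d k" "y \<in> types d k" and z: "z = tadd k x y"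
    using mem unfolding A by auto
  have AI: "tuple [i, u, v, tadd i u v] \<in> A" if "i \<le> q" "u \<in> types d i" "v \<in> types d i" for i u v
    using that unfolding A by blast
  show "k = 0 \<and> z = 0 \<or>
     (\<exists>k'<B. \<exists>x0<B. \<exists>X<B. \<exists>y0<B. \<exists>Y<B. \<exists>z0<B. \<exists>Z<B.
        k = Suc k' \<and> x = tuple [x0, X] \<and> y = tuple [y0, Y] \<and> z = tuple [z0, Z] \<and>
        tuple [k', x0, y0, z0] \<in> A \<and> add_splits B A k' x0 X y0 Y Z)"
  proof (cases k)
    case 0
    then show ?thesis using z by simp
  next
    case (Suc k')
    have k': "k' \<le> q" and low: "lower x \<in> types d k'" "lower y \<in> types d k'"
      using k xy unfolding Suc types_Suc_iff by simp_all
    have z': "lower z = tadd k' (lower x) (lower y)" unfolding z Suc lower_tadd ..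
    have "add_splits B A k' (lower x) (upper x) (lower y) (upper y) (upper z)"
      unfolding add_splits_def tuple3_eq_triple set_decode_upper
    proof (intro allI impI conjI)
      fix c l r
      {
        assume x: "triple c l r \<in> splits x"
        then have "tuple [k', r, lower y, tadd k' r (lower y)] \<in> A"
          using triple_in_splits(3)[OF x] xy low k' Suc by (intro AI) auto
        moreover have "triple c l (tadd k' r (lower y)) \<in> splits z"
          unfolding z Suc splits_tadd by (rule UnI1, rule image_eqI[OF _ x]) simp
        ultimately show "\<exists>u<B. tuple [k', r, lower y, u] \<in> A \<and> triple c l u \<in> splits z"
          using entry_A by blast
      next
        assume y: "triple c l r \<in> splits y"
        then have "tuple [k', lower x, l, tadd k' (lower x) l] \<in> A"
          using triple_in_splits(2)[OF y] xy low k' Suc by (intro AI) auto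
        moreover have "triple c (tadd k' (lower x) l) r \<in> splits z"
          unfolding z Suc splits_tadd by (rule UnI2, rule image_eqI[OF _ y]) simp
        ultimately show "\<exists>u<B. tuple [k', lower x, l, u] \<in> A \<and> triple c u r \<in> splits z"
          using entry_A by blast
      next
        assume "triple c l r \<in> splits z"
        then consider w where "w \<in> splits x" "triple c l r = triple (t_color w) (t_left w) (tadd k' (t_right w) (lower y))"
          | w where "w \<in> splits y" "triple c l r = triple (t_color w) (tadd k' (lower x) (t_left w)) (t_right w)"
          unfolding z Suc splits_tadd by blast
        then show "(\<exists>u<B. triple c l u \<in> splits x \<and> tuple [k', u, lower y, r] \<in> A) \<or>
            (\<exists>u<B. triple c u r \<in> splits y \<and> tuple [k', lower x, u, l] \<in> A)"
        proof cases
          case 1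
          then have w: "triple c l (t_right w) \<in> splits x" and r: "r = tadd k' (t_right w) (lower y)"
            by simp_all
          have "tuple [k', t_right w, lower y, r] \<in> A"
            unfolding r using triple_in_splits(3)[OF w] xy low k' Suc by (intro AI) auto
          then show ?thesis using w entry_A by blast
        next
          case 2
          then have w: "triple c (t_left w) r \<in> splits y" and l: "l = tadd k' (lower x) (t_left w)"
            by simp_all
          have "tuple [k', lower x, t_left w, l] \<in> A"
            unfolding l using triple_in_splits(2)[OF w] xy low k' Suc by (intro AI) auto
          then show ?thesis using w entry_A by blast
        qed
      }
    qed
    moreover have "tuple [k', lower x, lower y, lower z] \<in> A"
      unfolding z' using k' low by (rule AI)
    moreover have "k' < B" using less(1) Suc by simp
    ultimately show ?thesis
      using Suc tuple_lower_upper lower_upper_less[OF less(2)] lower_upper_less[OF less(3)]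
        lower_upper_less[OF less(4)] by metis
  qed
qed

lemma omega_table_complete:
  assumes A: "A = {tuple [k, x, y, tadd k x y] | k x y. k \<le> q \<and> x \<in> types d k \<and> y \<in> types d k}"
    and W: "W = {tuple [k, x, tomega k x] | k x. k \<le> q \<and> x \<in> types d k}"
  shows "omega_table B A W"
  unfolding omega_table_def
proof (intro allI impI)
  fix k x z assume less: "k < B" "x < B" "z < B" and mem: "tuple [k, x, z] \<in> W"
  have k: "k \<le> q" and x: "x \<in> types d k" and z: "z = tomega k x"
    using mem unfolding W by auto
  have AI: "tuple [i, u, v, tadd i u v] \<in> A" if "i \<le> q" "u \<in> types d i" "v \<in> types d i" for i u v
    using that unfolding A by blast
  show "k = 0 \<and> z = 0 \<or> (\<exists>k'<B. \<exists>x0<B. \<exists>X<B. \<exists>z0<B. \<exists>Z<B.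
        k = Suc k' \<and> x = tuple [x0, X] \<and> z = tuple [z0, Z] \<and> tuple [k', x0, z0] \<in> W \<and>
        omega_splits B A k' x0 X z0 Z)"
  proof (cases k)
    case 0
    then show ?thesis using z by simp
  next
    case (Suc k')
    have k': "k' \<le> q" and low: "lower x \<in> types d k'"
      using k x unfolding Suc types_Suc_iff by simp_all
    have z': "lower z = tomega k' (lower x)" unfolding z Suc lower_tomega ..
    have lowz: "lower z \<in> types d k'" unfolding z' by (rule tomega_in_types[OF low])
    have "omega_splits B A k' (lower x) (upper x) (lower z) (upper z)"
      unfolding omega_splits_def tuple3_eq_triple set_decode_upper
    proof (intro allI impI conjI)
      fix c l r
      {
        assume lr: "triple c l r \<in> splits x"
        have "tuple [k', lower x, l, tadd k' (lower x) l] \<in> A" "tuple [k', r, lower z, tadd k' r (lower z)] \<in> A"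
          by (rule AI[OF k' low triple_in_splits(2)[OF lr x[unfolded Suc]]],
              rule AI[OF k' triple_in_splits(3)[OF lr x[unfolded Suc]] lowz])
        moreover have "triple c l (tadd k' r (lower z)) \<in> splits z"
          unfolding z' unfolding z Suc splits_tomega by (rule UnI1, rule image_eqI[OF _ lr]) simp
        moreover have "triple c (tadd k' (lower x) l) (tadd k' r (lower z)) \<in> splits z"
          unfolding z' unfolding z Suc splits_tomega by (rule UnI2, rule image_eqI[OF _ lr]) simp
        ultimately show "\<exists>u<B. \<exists>v<B. tuple [k', lower x, l, u] \<in> A \<and> tuple [k', r, lower z, v] \<in> A \<and>
            triple c l v \<in> splits z \<and> triple c u v \<in> splits z"
          using entry_A by blast
      next
        assume "triple c l r \<in> splits z"
        then obtain w where w: "w \<in> splits x"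
          and "triple c l r = triple (t_color w) (t_left w) (tadd k' (t_right w) (lower z)) \<or>
            triple c l r = triple (t_color w) (tadd k' (lower x) (t_left w)) (tadd k' (t_right w) (lower z))"
          unfolding z' unfolding z Suc splits_tomega by blast
        then have c: "triple c (t_left w) (t_right w) \<in> splits x" and r: "r = tadd k' (t_right w) (lower z)"
          and l: "l = t_left w \<or> l = tadd k' (lower x) (t_left w)" by auto
        have "tuple [k', t_right w, lower z, r] \<in> A" "tuple [k', lower x, t_left w, tadd k' (lower x) (t_left w)] \<in> A"
          unfolding r
          by (rule AI[OF k' triple_in_splits(3)[OF c x[unfolded Suc]] lowz],
              rule AI[OF k' low triple_in_splits(2)[OF c x[unfolded Suc]]])
        then show "\<exists>u<B. \<exists>v<B. triple c u v \<in> splits x \<and> tuple [k', v, lower z, r] \<in> A \<and>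
            (l = u \<or> tuple [k', lower x, u, l] \<in> A)"
          using c l entry_A by metis
      }
    qed
    moreover have "tuple [k', lower x, lower z] \<in> W"
      unfolding z' W using k' low by blast
    moreover have "k' < B" using less(1) Suc by simp
    ultimately show ?thesis
      using Suc tuple_lower_upper lower_upper_less[OF less(2)] lower_upper_less[OF less(3)] by metis
  qed
qed

lemma point_table_complete:
  assumes P: "P = {tuple [k, c, tpoint k c] | k c. k \<le> q \<and> c < d}"
  shows "point_table B P"
  unfolding point_table_def
proof (intro allI impI)
  fix k c x assume less: "k < B" "c < B" "x < B" and mem: "tuple [k, c, x] \<in> P"
  have k: "k \<le> q" "c < d" and x: "x = tpoint k c" using mem unfolding P by auto
  show "k = 0 \<and> x = 0 \<or> (\<exists>k'<B. \<exists>x0<B. \<exists>X<B. k = Suc k' \<and> x = tuple [x0, X] \<and> tuple [k', c, x0] \<in> P \<and>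
        tuple [c, 0, 0] \<in> set_decode X \<and> (\<forall>z<B. z \<in> set_decode X \<longrightarrow> z = tuple [c, 0, 0]))"
  proof (cases k)
    case 0
    then show ?thesis using x by simp
  next
    case (Suc k')
    have "lower x = tpoint k' c" by (simp add: x Suc)
    then have "tuple [k', c, lower x] \<in> P" unfolding P using k Suc by auto
    moreover have X: "set_decode (upper x) = {tuple [c, 0, 0]}"
      unfolding set_decode_upper x Suc tpoint.simps tuple3_eq_triple by (rule splits_sel) simp
    then have "tuple [c, 0, 0] \<in> set_decode (upper x)"
      and "\<forall>z<B. z \<in> set_decode (upper x) \<longrightarrow> z = tuple [c, 0, 0]" by blast+
    moreover have "k' < B" using less(1) Suc by simp
    ultimately show ?thesis
      using Suc tuple_lower_upper[of x] lower_upper_less[OF less(3)] by metis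
  qed
qed

lemma cadd_table_complete:
  assumes C: "C = {tuple [cnf_code x, cnf_code y, cnf_code (cadd x y)] | x y.
      is_cnf x \<and> is_cnf y \<and> cnf_code x < K \<and> cnf_code y < K}"
  shows "cadd_table B C"
  unfolding cadd_table_def
proof (intro allI impI)
  fix x y z assume less: "x < B" "y < B" "z < B" and mem: "tuple [x, y, z] \<in> C"
  obtain u v where u: "x = cnf_code u" "is_cnf u" "cnf_code u < K" and v: "y = cnf_code v" "is_cnf v" "cnf_code v < K"
    and z: "z = cnf_code (cadd u v)" using mem unfolding C by auto
  show "x = 0 \<and> z = y \<or> y = 0 \<and> z = x \<or>
     (\<exists>a<B. \<exists>c<B. \<exists>x'<B. \<exists>b<B. \<exists>e<B. \<exists>y'<B.
        x = code_cons a c x' \<and> y = code_cons b (Suc e) y' \<and>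
        (a < b \<and> z = y \<or> a = b \<and> z = code_cons a (c + Suc e) y' \<or>
         b < a \<and> (\<exists>z'<B. tuple [x', y, z'] \<in> C \<and> z = code_cons a c z')))"
  proof (cases u; cases v)
    fix p u' r v' assume "u = p # u'" "v = r # v'"
    then obtain a c b e where uv: "u = (a, c) # u'" "v = (b, Suc e) # v'"
      using v(2) by (cases p; cases r; cases "snd r") auto
    have x: "x = code_cons a c (cnf_code u')" and y: "y = code_cons b (Suc e) (cnf_code v')"
      using u v uv by simp_all
    have bounds: "a < B" "c < B" "cnf_code u' < B" "b < B" "e < B" "cnf_code v' < B"
      using code_cons_less[of a c "cnf_code u'" B] code_cons_less[of b "Suc e" "cnf_code v'" B] less x y by simp_all
    have "b < a \<Longrightarrow> \<exists>z'<B. tuple [cnf_code u', y, z'] \<in> C \<and> z = code_cons a c z'"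
    proof -
      assume ba: "b < a"
      have "cnf_code u' < K" using u(1,3) x code_cons_less(3)[of a c "cnf_code u'" K] by simp
      then have "tuple [cnf_code u', y, cnf_code (cadd u' v)] \<in> C"
        using u(2) uv(1) v unfolding C by (intro CollectI exI[of _ u'] exI[of _ v]) simp
      moreover have "z = code_cons a c (cnf_code (cadd u' v))" using ba z uv by simp
      ultimately show ?thesis using entry_C by blast
    qed
    moreover have "a < b \<Longrightarrow> z = y" "a = b \<Longrightarrow> z = code_cons a (c + Suc e) (cnf_code v')"
      using z uv v by simp_all
    ultimately have "a < b \<and> z = y \<or> a = b \<and> z = code_cons a (c + Suc e) (cnf_code v') \<or>
        b < a \<and> (\<exists>z'<B. tuple [cnf_code u', y, z'] \<in> C \<and> z = code_cons a c z')"
      using linorder_less_linear[of a b] by argo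
    with x y have "x = code_cons a c (cnf_code u') \<and> y = code_cons b (Suc e) (cnf_code v') \<and>
        (a < b \<and> z = y \<or> a = b \<and> z = code_cons a (c + Suc e) (cnf_code v') \<or>
         b < a \<and> (\<exists>z'<B. tuple [cnf_code u', y, z'] \<in> C \<and> z = code_cons a c z'))"
      by (intro conjI)
    with bounds show ?thesis
      by (intro disjI2) (rule exI[of _ a], rule conjI, assumption, rule exI[of _ c], rule conjI, assumption,
        rule exI[of _ "cnf_code u'"], rule conjI, assumption, rule exI[of _ b], rule conjI, assumption,
        rule exI[of _ e], rule conjI, assumption, rule exI[of _ "cnf_code v'"], rule conjI)
  qed (use u v z in auto)
qed

end

text \<open>The premises of the last construction step belong to \<open>F\<close>.\<close>

definition step_from :: "nat \<Rightarrow> nat \<Rightarrow> (nat \<times> nat \<times> cnf) set \<Rightarrow> nat \<Rightarrow> nat \<Rightarrow> cnf \<Rightarrow> bool" where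
  "step_from d q F n t x \<longleftrightarrow> t = 0 \<and> x = [] \<or> (\<exists>c<d. t = tpoint q c \<and> x = [(0, 1)]) \<or>
      (\<exists>i u y j v z. i < n \<and> j < n \<and> (i, u, y) \<in> F \<and> (j, v, z) \<in> F \<and> t = tadd q u v \<and> x = cadd y z) \<or>
      (\<exists>i u y. i < n \<and> (i, u, y) \<in> F \<and> tadd q u u = u \<and> t = tomega q u \<and> x = times_omega y)"

definition derivation :: "nat \<Rightarrow> nat \<Rightarrow> (nat \<times> nat \<times> cnf) set \<Rightarrow> bool" where
  "derivation d q F \<longleftrightarrow> (\<forall>n t x. (n, t, x) \<in> F \<longrightarrow> built d q n t x \<and> step_from d q F n t x)"

lemma step_from_mono: "step_from d q F n t x \<Longrightarrow> F \<subseteq> G \<Longrightarrow> step_from d q G n t x"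
  unfolding step_from_def by (elim disjE) (simp, blast+)

lemma derivation_insert:
  assumes "derivation d q F" "built d q n t x" "step_from d q F n t x"
  shows "derivation d q (insert (n, t, x) F)"
  using assms step_from_mono[OF _ subset_insertI[of F "(n, t, x)"]] unfolding derivation_def by simp

lemma derivation_Union:
  assumes "\<And>F. F \<in> \<F> \<Longrightarrow> derivation d q F"
  shows "derivation d q (\<Union>\<F>)"
  unfolding derivation_def
proof (intro allI impI)
  fix n t x assume "(n, t, x) \<in> \<Union>\<F>"
  then obtain F where F: "F \<in> \<F>" "(n, t, x) \<in> F" by blast
  then have "built d q n t x" "step_from d q F n t x" using assms unfolding derivation_def by blast+
  then show "built d q n t x \<and> step_from d q (\<Union>\<F>) n t x"
    using step_from_mono[OF _ Union_upper[OF F(1)]] by blast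
qed

lemma ex_derivation:
  "built d q n t x \<Longrightarrow> \<exists>F. finite F \<and> (n, t, x) \<in> F \<and> derivation d q F"
proof (induction rule: built.induct)
  case (empty n)
  have "derivation d q {(n, 0, [])}"
    using built.empty by (intro derivation_insert) (auto simp: derivation_def step_from_def)
  then show ?case by blast
next
  case (point c n)
  have "derivation d q {(n, tpoint q c, [(0, 1)])}"
    by (intro derivation_insert built.point[OF point]) (use point in \<open>auto simp: derivation_def step_from_def\<close>)
  then show ?case by blast
next
  case (sum i t x j u y n)
  then obtain F G where FG: "finite F" "(i, t, x) \<in> F" "derivation d q F"
    "finite G" "(j, u, y) \<in> G" "derivation d q G" by blast
  have "derivation d q (\<Union>{F, G})" by (rule derivation_Union) (use FG in auto)
  moreover have "built d q n (tadd q t u) (cadd x y)" using sum.hyps by (rule built.sum)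
  moreover have "step_from d q (\<Union>{F, G}) n (tadd q t u) (cadd x y)"
    unfolding step_from_def using FG(2,5) sum.hyps(3,4) by blast
  ultimately have "derivation d q (insert (n, tadd q t u, cadd x y) (\<Union>{F, G}))"
    by (rule derivation_insert)
  then show ?case using FG(1,4) by (intro exI[of _ "insert (n, tadd q t u, cadd x y) (\<Union>{F, G})"]) simp
next
  case (omega i t x n)
  then obtain F where F: "finite F" "(i, t, x) \<in> F" "derivation d q F" by blast
  have "built d q n (tomega q t) (times_omega x)" using omega.hyps by (rule built.omega)
  moreover have "step_from d q F n (tomega q t) (times_omega x)"
    unfolding step_from_def using F(2) omega.hyps(2,3) by blast
  ultimately have "derivation d q (insert (n, tomega q t, times_omega x) F)"
    by (rule derivation_insert[OF F(3)])
  then show ?case using F(1) by (intro exI[of _ "insert (n, tomega q t, times_omega x) F"]) simp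
qed

text \<open>For each of the finitely many types that can be built, take a derivation of its least ordinal. The
  union of these derivations is dominating, since the least ordinal for the type of a new
  pair is at most the ordinal of that pair.\<close>

lemma ex_certificate:
  "\<exists>B out A W P C R. out < B \<and> A < B \<and> W < B \<and> P < B \<and> C < B \<and> R < B \<and>
     certificate B out d q (set_decode A) (set_decode W) (set_decode P) (set_decode C) (set_decode R)"
proof -
  define Ts where "Ts = {t. \<exists>x. buildable d q t x}"
  have "Ts \<subseteq> types d q" unfolding Ts_def using buildable_in_types by blast
  then have fin_Ts: "finite Ts" by (rule finite_subset) simp
  have zero: "0 \<in> Ts" unfolding Ts_def using buildable_empty by blast
  have "\<exists>y. buildable d q t y \<and> (\<forall>z. buildable d q t z \<longrightarrow> y \<le> z)" if t: "t \<in> Ts" for t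
  proof -
    obtain x where "buildable d q t x" using t unfolding Ts_def by blast
    then show ?thesis
      using cnf_minimal[of x "buildable d q t"] buildable_is_cnf by metis
  qed
  then have "\<exists>mn. \<forall>t\<in>Ts. buildable d q t (mn t) \<and> (\<forall>z. buildable d q t z \<longrightarrow> mn t \<le> z)"
    by (intro bchoice ballI)
  then obtain mn where "\<forall>t\<in>Ts. buildable d q t (mn t) \<and> (\<forall>z. buildable d q t z \<longrightarrow> mn t \<le> z)" ..
  then have mn: "\<And>t. t \<in> Ts \<Longrightarrow> buildable d q t (mn t)"
    and least: "\<And>t z. t \<in> Ts \<Longrightarrow> buildable d q t z \<Longrightarrow> mn t \<le> z" by blast+
  have "\<exists>F. finite F \<and> (\<exists>n. (n, t, mn t) \<in> F) \<and> derivation d q F" if "t \<in> Ts" for t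
    using mn[OF that] ex_derivation[of d q _ t "mn t"] unfolding buildable_def by blast
  then have "\<exists>Fs. \<forall>t\<in>Ts. finite (Fs t) \<and> (\<exists>n. (n, t, mn t) \<in> Fs t) \<and> derivation d q (Fs t)"
    by (intro bchoice ballI)
  then obtain Fs where "\<forall>t\<in>Ts. finite (Fs t) \<and> (\<exists>n. (n, t, mn t) \<in> Fs t) \<and> derivation d q (Fs t)" ..
  then have Fs: "\<And>t. t \<in> Ts \<Longrightarrow> finite (Fs t)"
    "\<And>t. t \<in> Ts \<Longrightarrow> \<exists>n. (n, t, mn t) \<in> Fs t" "\<And>t. t \<in> Ts \<Longrightarrow> derivation d q (Fs t)"
    by blast+
  define F where "F = \<Union>(Fs ` Ts)"
  have fin_F: "finite F" unfolding F_def using fin_Ts Fs(1) by blast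
  have mn_F: "\<exists>n. (n, t, mn t) \<in> F" if "t \<in> Ts" for t unfolding F_def using Fs(2) that by blast
  have der: "derivation d q F" unfolding F_def by (rule derivation_Union) (use Fs(3) in blast)
  have F_built: "built d q n t x" and F_step: "step_from d q F n t x" if "(n, t, x) \<in> F" for n t x
    using der that unfolding derivation_def by blast+
  have F_Ts: "t \<in> Ts" if "(n, t, x) \<in> F" for n t x
    using F_built[OF that] unfolding Ts_def buildable_def by blast
  define sub where "sub x z = (SOME y. is_cnf y \<and> z = cadd x y)" for x z
  have sub: "is_cnf (sub x z)" "z = cadd x (sub x z)" if "is_cnf x" "is_cnf z" "x \<le> z" for x z
    using someI_ex[OF cadd_subtract[OF that]] unfolding sub_def by blast+
  \<comment> \<open>The ordinals of the derivations, the results of one further construction step, and the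
    differences that witness comparisons between these. Their codes determine how large the
    addition table has to be.\<close>
  define Q0 where "Q0 = (\<lambda>(n, t, x). x) ` F \<union> {[], [(0, 1)]}"
  define Q1 where "Q1 = Q0 \<union> (\<lambda>(x, y). cadd x y) ` (Q0 \<times> Q0) \<union> times_omega ` Q0"
  define Q2 where "Q2 = Q1 \<union> (\<lambda>(x, y). sub x y) ` (Q1 \<times> Q1)"
  have "finite Q0" unfolding Q0_def using fin_F by simp
  then have "finite Q1" unfolding Q1_def by simp
  then have "finite (cnf_code ` Q2)" unfolding Q2_def by simp
  then obtain K where "\<forall>n\<in>cnf_code ` Q2. n < K" using finite_nat_set_iff_bounded by blast
  then have K: "cnf_code x < K" if "x \<in> Q2" for x using that by blast
  have F_Q0: "x \<in> Q0" if "(n, t, x) \<in> F" for n t x unfolding Q0_def using that by force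
  have Q0_cnf: "is_cnf x" if "x \<in> Q0" for x
    using that built_is_cnf[OF F_built] unfolding Q0_def by auto
  have Q1_cnf: "is_cnf x" if "x \<in> Q1" for x
    using that Q0_cnf unfolding Q1_def by (auto intro: is_cnf_cadd is_cnf_times_omega)
  have mn_Q1: "mn t \<in> Q1" if "t \<in> Ts" for t using F_Q0 mn_F[OF that] unfolding Q1_def by blast
  define A where "A = {tuple [k, x, y, tadd k x y] | k x y. k \<le> q \<and> x \<in> types d k \<and> y \<in> types d k}"
  define W where "W = {tuple [k, x, tomega k x] | k x. k \<le> q \<and> x \<in> types d k}"
  define P where "P = {tuple [k, c, tpoint k c] | k c. k \<le> q \<and> c < d}"
  define C where "C = {tuple [cnf_code x, cnf_code y, cnf_code (cadd x y)] | x y.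
      is_cnf x \<and> is_cnf y \<and> cnf_code x < K \<and> cnf_code y < K}"
  define R where "R = {tuple [n, t, cnf_code x] | n t x. (n, t, x) \<in> F}"
  have "A = (\<lambda>(k, x, y). tuple [k, x, y, tadd k x y]) ` (SIGMA k:{..q}. types d k \<times> types d k)"
    unfolding A_def by force
  then have fin_A: "finite A" by simp
  have "W = (\<lambda>(k, x). tuple [k, x, tomega k x]) ` (SIGMA k:{..q}. types d k)"
    unfolding W_def by force
  then have fin_W: "finite W" by simp
  have "P = (\<lambda>(k, c). tuple [k, c, tpoint k c]) ` ({..q} \<times> {..<d})"
    unfolding P_def by force
  then have fin_P: "finite P" by simp
  have "C \<subseteq> (\<lambda>(m, n). tuple [m, n, cnf_code (cadd (cnf_of_code m) (cnf_of_code n))]) ` ({..<K} \<times> {..<K})"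
  proof
    fix z assume "z \<in> C"
    then obtain x y where "z = tuple [cnf_code x, cnf_code y, cnf_code (cadd x y)]"
      "cnf_code x < K" "cnf_code y < K" unfolding C_def by blast
    then show "z \<in> (\<lambda>(m, n). tuple [m, n, cnf_code (cadd (cnf_of_code m) (cnf_of_code n))]) ` ({..<K} \<times> {..<K})"
      by (intro image_eqI[of _ _ "(cnf_code x, cnf_code y)"]) simp_all
  qed
  then have fin_C: "finite C" by (rule finite_subset) simp
  have "R = (\<lambda>(n, t, x). tuple [n, t, cnf_code x]) ` F" unfolding R_def by force
  then have fin_R: "finite R" using fin_F by simp
  define ub where "ub = Max (mn ` Ts)"
  obtain tm where tm: "tm \<in> Ts" "ub = mn tm"
    using Max_in[of "mn ` Ts"] fin_Ts zero unfolding ub_def by blast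
  have ub: "mn t \<le> ub" if "t \<in> Ts" for t unfolding ub_def using fin_Ts that by simp
  define B where "B = Suc (set_encode A + set_encode W + set_encode P + set_encode C + set_encode R +
      d + cnf_code ub)"
  have codes: "set_encode A < B" "set_encode W < B" "set_encode P < B" "set_encode C < B"
    "set_encode R < B" "d < B" "cnf_code ub < B" by (simp_all add: B_def)
  interpret bounded_tables B A W P C R
  proof
    fix z assume "z \<in> A \<union> W \<union> P \<union> C \<union> R"
    then have "z < set_encode A \<or> z < set_encode W \<or> z < set_encode P \<or> z < set_encode C \<or> z < set_encode R"
      using fin_A fin_W fin_P fin_C fin_R set_decode_less set_encode_inverse by (metis Un_iff)
    then show "z < B" using codes by linarith
  qed
  have tadd_A: "tuple [q, t, u, tadd q t u] \<in> A" if "t \<in> Ts" "u \<in> Ts" for t u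
    using that \<open>Ts \<subseteq> types d q\<close> unfolding A_def by blast
  have tomega_W: "tuple [q, t, tomega q t] \<in> W" if "t \<in> Ts" for t
    using that \<open>Ts \<subseteq> types d q\<close> unfolding W_def by blast
  have tpoint_P: "tuple [q, c, tpoint q c] \<in> P" if "c < d" for c
    using that unfolding P_def by blast
  have cadd_C: "tuple [cnf_code x, cnf_code y, cnf_code (cadd x y)] \<in> C" if "x \<in> Q0" "y \<in> Q0" for x y
    using that Q0_cnf K unfolding C_def Q2_def Q1_def by blast
  have le_C: "\<exists>w. tuple [cnf_code x, w, cnf_code y] \<in> C" if "x \<in> Q1" "y \<in> Q1" "x \<le> y" for x y
  proof -
    note s = sub[OF Q1_cnf[OF that(1)] Q1_cnf[OF that(2)] that(3)]
    have "x \<in> Q2" "sub x y \<in> Q2" using that unfolding Q2_def by auto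
    then have "tuple [cnf_code x, cnf_code (sub x y), cnf_code (cadd x (sub x y))] \<in> C"
      unfolding C_def using s(1) Q1_cnf[OF that(1)] K by blast
    then show ?thesis using s(2) by auto
  qed
  have mn_R: "\<exists>n. tuple [n, t, cnf_code (mn t)] \<in> R" if "t \<in> Ts" for t
    unfolding R_def using mn_F[OF that] by blast
  have dom: "dominated B C R t (cnf_code x)" if t: "t \<in> Ts" and x: "x \<in> Q1" "mn t \<le> x" for t x
  proof -
    obtain w where w: "tuple [cnf_code (mn t), w, cnf_code x] \<in> C"
      using le_C[OF mn_Q1[OF t] x] by blast
    then show ?thesis
      unfolding dominated_def using mn_R[OF t] entry_C[OF w] entry_R by blast
  qed
  have dom_built: "t \<in> Ts \<and> dominated B C R t (cnf_code x)" if "buildable d q t x" "x \<in> Q1" for t x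
    using dom[OF _ that(2) least[OF _ that(1)]] that(1) unfolding Ts_def by blast
  have RE: "\<exists>y. x = cnf_code y \<and> (n, t, y) \<in> F" if "tuple [n, t, x] \<in> R" for n t x
    using that unfolding R_def by auto
  have RI: "tuple [n, t, cnf_code x] \<in> R" if "(n, t, x) \<in> F" for n t x
    using that unfolding R_def by blast
  have omega_code: "omega_code B (cnf_code y) (cnf_code (times_omega y))" if "cnf_code y < B" for y
  proof (cases y rule: times_omega.cases)
    case (2 a c y')
    then have "cnf_code y = code_cons a c (cnf_code y')"
      and "cnf_code (times_omega y) = code_cons (Suc a) 1 0" by simp_all
    then show ?thesis
      using code_cons_less[of a c "cnf_code y'" B] that unfolding omega_code_def by metis
  qed (simp add: omega_code_def)
  have F_buildable: "buildable d q t x" if "(n, t, x) \<in> F" for n t x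
    using F_built[OF that] unfolding buildable_def by blast
  have "built_table B d q A W P C R"
    unfolding built_table_def
  proof (intro allI impI)
    fix n t x assume mem: "tuple [n, t, x] \<in> R"
    obtain y where y: "x = cnf_code y" "(n, t, y) \<in> F" using RE[OF mem] by blast
    from F_step[OF y(2), unfolded step_from_def]
    consider "t = 0" "y = []" | c where "c < d" "t = tpoint q c" "y = [(0, 1)]"
      | i u v j w z where "i < n" "j < n" "(i, u, v) \<in> F" "(j, w, z) \<in> F" "t = tadd q u w" "y = cadd v z"
      | i u v where "i < n" "(i, u, v) \<in> F" "tadd q u u = u" "t = tomega q u" "y = times_omega v"
      by blast
    then show "t = 0 \<and> x = 0 \<or> (\<exists>c<B. c < d \<and> tuple [q, c, t] \<in> P \<and> x = code_cons 0 1 0) \<or>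
     (\<exists>i<B. \<exists>u<B. \<exists>y<B. \<exists>j<B. \<exists>v<B. \<exists>z<B. i < n \<and> j < n \<and>
        tuple [i, u, y] \<in> R \<and> tuple [j, v, z] \<in> R \<and> tuple [q, u, v, t] \<in> A \<and> tuple [y, z, x] \<in> C) \<or>
     (\<exists>i<B. \<exists>u<B. \<exists>y<B. i < n \<and> tuple [i, u, y] \<in> R \<and> tuple [q, u, u, u] \<in> A \<and>
        tuple [q, u, t] \<in> W \<and> omega_code B y x)"
    proof cases
      case 1
      then show ?thesis using y by simp
    next
      case 2
      then have "c < B" "tuple [q, c, t] \<in> P" "x = code_cons 0 1 0" using tpoint_P y codes(6) by simp_all
      then show ?thesis using 2(1) by blast
    next
      case 3
      have "tuple [q, u, w, t] \<in> A" "tuple [cnf_code v, cnf_code z, x] \<in> C"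
        unfolding 3(5,6) y(1) using tadd_A F_Ts[OF 3(3)] F_Ts[OF 3(4)] cadd_C F_Q0[OF 3(3)] F_Q0[OF 3(4)] by simp_all
      then have "i < n \<and> j < n \<and> tuple [i, u, cnf_code v] \<in> R \<and> tuple [j, w, cnf_code z] \<in> R \<and>
          tuple [q, u, w, t] \<in> A \<and> tuple [cnf_code v, cnf_code z, x] \<in> C"
        using 3(1,2) RI[OF 3(3)] RI[OF 3(4)] by (intro conjI)
      then show ?thesis
        using entry_R[OF RI[OF 3(3)]] entry_R[OF RI[OF 3(4)]]
        by (elim conjE) (rule disjI2, rule disjI2, rule disjI1,
          rule exI[of _ "i"], rule conjI, assumption, rule exI[of _ "u"], rule conjI, assumption, rule exI[of _ "cnf_code v"], rule conjI, assumption,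
          rule exI[of _ "j"], rule conjI, assumption, rule exI[of _ "w"], rule conjI, assumption, 
          rule exI[of _ "cnf_code z"], rule conjI, assumption, intro conjI)
    next
      case 4
      have "tuple [q, u, u, u] \<in> A" "tuple [q, u, t] \<in> W"
        using tadd_A[of u u] tomega_W[of u] F_Ts[OF 4(2)] unfolding 4(3,4) by simp_all
      moreover have "omega_code B (cnf_code v) x"
        unfolding y(1) 4(5) using entry_R[OF RI[OF 4(2)]] by (intro omega_code) simp
      moreover note RI[OF 4(2)]
      ultimately show ?thesis using entry_R[OF RI[OF 4(2)]] 4(1) by blast
    qed
  qed
  moreover have "dominating_table B d q A W P C R"
    unfolding dominating_table_def
  proof (intro conjI allI impI)
    show "d < B" by (rule codes)
    show "dominated B C R 0 0"
      using dom_built[OF buildable_empty] by (simp add: Q1_def Q0_def)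
    show "\<exists>t<B. tuple [q, c, t] \<in> P \<and> dominated B C R t (code_cons 0 1 0)" if "c < d" for c
    proof -
      have "dominated B C R (tpoint q c) (cnf_code [(0, 1)])"
        using dom_built[OF buildable_point[OF that]] by (simp add: Q1_def Q0_def)
      then show ?thesis using tpoint_P[OF that] entry_P[OF tpoint_P[OF that]] by auto
    qed
    show "\<exists>v<B. \<exists>z<B. tuple [q, t, u, v] \<in> A \<and> tuple [x, y, z] \<in> C \<and> dominated B C R v z"
      if nm: "tuple [n, t, x] \<in> R \<and> tuple [m, u, y] \<in> R" for n t x m u y
    proof -
      obtain x' y' where F': "x = cnf_code x'" "(n, t, x') \<in> F" "y = cnf_code y'" "(m, u, y') \<in> F"
        using nm RE by blast
      have Q: "x' \<in> Q0" "y' \<in> Q0" using F_Q0 F' by blast+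
      have a: "tuple [q, t, u, tadd q t u] \<in> A" using tadd_A F_Ts F' by blast
      have c: "tuple [x, y, cnf_code (cadd x' y')] \<in> C" unfolding F' using Q by (rule cadd_C)
      have "cadd x' y' \<in> Q1" unfolding Q1_def using Q by force
      then have "dominated B C R (tadd q t u) (cnf_code (cadd x' y'))"
        using dom_built[OF buildable_sum[OF F_buildable[OF F'(2)] F_buildable[OF F'(4)]]] by blast
      then show ?thesis using a c entry_A[OF a] entry_C[OF c] by blast
    qed
    show "\<exists>v<B. \<exists>z<B. tuple [q, t, v] \<in> W \<and> omega_code B x z \<and> dominated B C R v z"
      if nt: "tuple [n, t, x] \<in> R \<and> tuple [q, t, t, t] \<in> A" for n t x
    proof -
      obtain x' where F': "x = cnf_code x'" "(n, t, x') \<in> F" using nt RE by blast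
      have idem: "tadd q t t = t" using nt unfolding A_def by auto
      have w: "tuple [q, t, tomega q t] \<in> W" using tomega_W F_Ts F' by blast
      have o: "omega_code B x (cnf_code (times_omega x'))"
        unfolding F'(1) using entry_R[OF RI[OF F'(2)]] by (intro omega_code) simp
      have "times_omega x' \<in> Q1" unfolding Q1_def using F_Q0[OF F'(2)] by blast
      then have dm: "dominated B C R (tomega q t) (cnf_code (times_omega x'))"
        using dom_built[OF buildable_omega[OF F_buildable[OF F'(2)] idem]] by blast
      then have "cnf_code (times_omega x') < B" unfolding dominated_def using entry_C by blast
      then show ?thesis using w o dm entry_W[OF w] by blast
    qed
  qed
  moreover have "max_min_table B C R (cnf_code ub)"
    unfolding max_min_table_def
  proof (intro conjI allI impI)
    have least_C: "\<exists>w<B. tuple [cnf_code ub, w, y] \<in> C" if my: "tuple [m, tm, y] \<in> R" for m y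
    proof -
      obtain y' where F': "y = cnf_code y'" "(m, tm, y') \<in> F" using RE[OF my] by blast
      have "ub \<le> y'" unfolding tm(2) using least[OF tm(1) F_buildable[OF F'(2)]] .
      moreover have "y' \<in> Q1" using F_Q0[OF F'(2)] unfolding Q1_def by blast
      ultimately obtain w where w: "tuple [cnf_code ub, w, y] \<in> C"
        using le_C[OF mn_Q1[OF tm(1)], folded tm(2)] unfolding F'(1) by blast
      then show ?thesis using entry_C[OF w] by blast
    qed
    then show "\<exists>n<B. \<exists>t<B. tuple [n, t, cnf_code ub] \<in> R \<and>
        (\<forall>m<B. \<forall>y<B. tuple [m, t, y] \<in> R \<longrightarrow> (\<exists>w<B. tuple [cnf_code ub, w, y] \<in> C))"
      using mn_R[OF tm(1), folded tm(2)] entry_R by blast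
    show "dominated B C R u (cnf_code ub)" if "tuple [m, u, y] \<in> R" for m u y
    proof -
      have "u \<in> Ts" using RE[OF that] F_Ts by blast
      then show ?thesis using dom mn_Q1[OF tm(1)] ub unfolding tm(2)[symmetric] by blast
    qed
  qed
  ultimately have "certificate B (cnf_code ub) d q A W P C R"
    unfolding certificate_def
    using add_table_complete[OF A_def] omega_table_complete[OF A_def W_def]
      point_table_complete[OF P_def] cadd_table_complete[OF C_def] by (intro conjI)
  then have "certificate B (cnf_code ub) d q (set_decode (set_encode A)) (set_decode (set_encode W))
      (set_decode (set_encode P)) (set_decode (set_encode C)) (set_decode (set_encode R))"
    unfolding set_encode_inverse[OF fin_A] set_encode_inverse[OF fin_W] set_encode_inverse[OF fin_P]
      set_encode_inverse[OF fin_C] set_encode_inverse[OF fin_R] .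
  then have "cnf_code ub < B \<and> set_encode A < B \<and> set_encode W < B \<and> set_encode P < B \<and>
      set_encode C < B \<and> set_encode R < B \<and>
      certificate B (cnf_code ub) d q (set_decode (set_encode A)) (set_decode (set_encode W))
        (set_decode (set_encode P)) (set_decode (set_encode C)) (set_decode (set_encode R))"
    using codes by (intro conjI)
  then show ?thesis by (intro exI)
qed

section \<open>Computability of \<open>g\<^sub>o\<^sub>r\<^sub>d\<close>\<close>

theorem theorem9:
  assumes "infinite (UNIV :: 'a set)"
  shows "\<exists>e. \<forall>d\<ge>1. \<forall>q. \<exists>cs.
           computes e [d, q] (cnf_code cs) \<and> is_cnf cs \<and>
           is_g_ord TYPE('a) d q (cnf_ord cs) \<and> is_g_ord TYPE(nat) d q (cnf_ord cs)"
proof -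
  let ?env = "\<lambda>out d q. (!) (out # d # q # replicate 20 0)"
  have env: "holds B (?env out d q) certificate_fm \<longleftrightarrow>
      (\<exists>A<B. \<exists>W<B. \<exists>P<B. \<exists>C<B. \<exists>R<B. certificate B out d q
        (set_decode A) (set_decode W) (set_decode P) (set_decode C) (set_decode R))" for B out d q
    by (simp add: holds_certificate_fm)
  have "\<exists>B out. out < B \<and> holds B (?env out d q) certificate_fm" for d q
    unfolding env using ex_certificate[of d q] by blast
  then obtain e where e: "\<And>d q. \<exists>B out. computes e [d, q] out \<and> holds B (?env out d q) certificate_fm"
    using search_program[OF bvars_certificate_fm] by blast
  have "\<exists>cs. computes e [d, q] (cnf_code cs) \<and> is_cnf cs \<and>
      is_g_ord TYPE('a) d q (cnf_ord cs) \<and> is_g_ord TYPE(nat) d q (cnf_ord cs)" for d q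
  proof -
    obtain B out A W P C R where out: "computes e [d, q] out"
      and less: "A < B" "W < B" "P < B" "C < B" "R < B"
      and cert: "certificate B out d q (set_decode A) (set_decode W) (set_decode P) (set_decode C) (set_decode R)"
      using e[of d q] unfolding env by blast
    interpret bounded_tables B "set_decode A" "set_decode W" "set_decode P" "set_decode C" "set_decode R"
      by standard (use less in \<open>auto dest: set_decode_less\<close>)
    have max: "max_min_built d q (cnf_of_code out)" using cert by (rule certificate_sound)
    have "is_cnf (cnf_of_code out)"
      using max buildable_is_cnf unfolding max_min_built_def by blast
    moreover have "is_g_ord TYPE('a) d q (cnf_ord (cnf_of_code out))"
      using assms max by (rule is_g_ord_max_min_built)
    moreover have "is_g_ord TYPE(nat) d q (cnf_ord (cnf_of_code out))"
      using infinite_UNIV_nat max by (rule is_g_ord_max_min_built)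
    ultimately show ?thesis using out by (intro exI[of _ "cnf_of_code out"]) simp
  qed
  then show ?thesis by blast
qed

end
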